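(* Let $f$ be a continuous and bounded function on $B_1\subset\mathbb{R}^N$ and let $u$ be a viscosity solution to $$\mathcal{H}(x,\nabla u)F(x,D^2u)-f(x)=0\quad\text{in }B_1 .$$ Then $u\in C^{0,\alpha}_{\mathrm{loc}}(B_1)$ for some universal $\alpha\in(0,1)$. Moreover, $$\|u\|_{C^{0,\alpha}(\overline{B_{1/2}})}\le C\left\{\|u\|_{L^\infty(B_1)}+(q+1)^{\frac1{q+1}}\,\Pi^{f,\mathfrak{a}}_{p,q}\right\},$$ where $C>0$ depends only on $N,\lambda,\Lambda$ and $$\Pi^{f,\mathfrak{a}}_{p,q}:=\max\left\{\left[|B_1|^{\frac1N}L_1^{-1}\left\|\tfrac{f}{1+\mathfrak{a}}\right\|_{L^\infty(B_1)}\right]^{\frac1{p+1}},\left[|B_1|^{\frac1N}L_1^{-1}\left\|\tfrac{f}{1+\mathfrak{a}}\right\|_{L^\infty(B_1)}\right]^{\frac1{q+1}}\right\}.$$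
   Context: $B_r$ is the ball of radius $r$ centred at the origin. $\mathrm{Sym}(N)$ is the space of real symmetric $N\times N$ matrices, $0<\lambda\le\Lambda<\infty$, $\mathscr{M}^{-}_{\lambda,\Lambda}(X)=\lambda\sum_{e_i>0}e_i+\Lambda\sum_{e_i<0}e_i$, $\mathscr{M}^{+}_{\lambda,\Lambda}(X)=\Lambda\sum_{e_i>0}e_i+\lambda\sum_{e_i<0}e_i$, with $e_i$ the eigenvalues of $X$. Assumptions. $F:B_1\times\mathrm{Sym}(N)\to\mathbb{R}$ satisfies: for each $x$, $F(x,\cdot)$ is continuous and $F(x,0)=0$; $\mathscr{M}^-_{\lambda,\Lambda}(X-Y)\le F(x,X)-F(x,Y)\le\mathscr{M}^+_{\lambda,\Lambda}(X-Y)$ for all $X,Y$; and there are a modulus of continuity $\omega$ and $C_F>0$ with $\sup_{X\neq0}\frac{|F(x,X)-F(x_0,X)|}{\|X\|}\le C_F\,\omega(|x-x_0|)$. $\mathcal{H}:B_1\times\mathbb{R}^N\to[0,\infty)$ satisfies $L_1(|\xi|^p+\mathfrak{a}(x)|\xi|^q)\le\mathcal{H}(x,\xi)\le L_2(|\xi|^p+\mathfrak{a}(x)|\xi|^q)$ with $0<L_1\le L_2<\infty$, $0<p\le q<\infty$, $\mathfrak{a}\in C^0(B_1,[0,\infty))$. "Universal" means depending only on the structural data $N,\lambda,\Lambda,p,q,L_1,L_2,\mathfrak{a},\omega,C_F$. Viscosity solutions. $u\in C(B_1)$ is a viscosity sub-solution (super-solution) of $\mathcal{H}(x,\nabla u)F(x,D^2u)=f(x)$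 if whenever $\phi\in C^2(B_1)$ and $u-\phi$ has a local maximum (minimum) at $x_0\in B_1$, one has $\mathcal{H}(x_0,\nabla\phi(x_0))F(x_0,D^2\phi(x_0))\ge f(x_0)$ (resp. $\le$). A solution is both. *)

theory Defs
  imports "HOL-Analysis.Analysis" "HOL-Probability.Essential_Supremum"
begin

abbreviation B1 :: "(real ^ 'n) set" where
  "B1 \<equiv> ball 0 1"

definition Sym :: "(real ^ 'n ^ 'n) set" where
  "Sym = {X. transpose X = X}"

subsection \<open>Pucci extremal operators\<close>

definition eigenspace :: "real ^ 'n ^ 'n \<Rightarrow> real \<Rightarrow> (real ^ 'n) set" where
  "eigenspace X e = {v. X *v v = e *\<^sub>R v}"

definition eigenvalues :: "real ^ 'n ^ 'n \<Rightarrow> real set" where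
  "eigenvalues X = {e. \<exists>v \<in> eigenspace X e. v \<noteq> 0}"

text \<open>The eigenvalues \<open>e\<^sub>1, \<dots>, e\<^sub>N\<close> of a symmetric matrix are listed with multiplicity; for
  symmetric matrices the multiplicity of an eigenvalue is the dimension of its eigenspace.\<close>

definition pos_eigenvalue_sum :: "real ^ 'n ^ 'n \<Rightarrow> real" where
  "pos_eigenvalue_sum X = (\<Sum>e \<in> {e \<in> eigenvalues X. e > 0}. real (dim (eigenspace X e)) * e)"

definition neg_eigenvalue_sum :: "real ^ 'n ^ 'n \<Rightarrow> real" where
  "neg_eigenvalue_sum X = (\<Sum>e \<in> {e \<in> eigenvalues X. e < 0}. real (dim (eigenspace X e)) * e)"

definition pucci_min :: "real \<Rightarrow> real \<Rightarrow> real ^ 'n ^ 'n \<Rightarrow> real" where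
  "pucci_min lam Lam X = lam * pos_eigenvalue_sum X + Lam * neg_eigenvalue_sum X"

definition pucci_max :: "real \<Rightarrow> real \<Rightarrow> real ^ 'n ^ 'n \<Rightarrow> real" where
  "pucci_max lam Lam X = Lam * pos_eigenvalue_sum X + lam * neg_eigenvalue_sum X"

subsection \<open>Structural assumptions\<close>

definition modulus_of_continuity :: "(real \<Rightarrow> real) \<Rightarrow> bool" where
  "modulus_of_continuity \<omega> \<longleftrightarrow>
     \<omega> 0 = 0 \<and> (\<forall>t \<ge> 0. \<omega> t \<ge> 0) \<and> mono_on {0..} \<omega> \<and> (\<omega> \<longlongrightarrow> 0) (at_right 0)"

text \<open>The norm on symmetric matrices is the operator (spectral) norm; the library norm on
  \<open>real ^ 'n ^ 'n\<close> would be the Frobenius norm.\<close>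

definition elliptic_assumptions ::
  "real \<Rightarrow> real \<Rightarrow> (real \<Rightarrow> real) \<Rightarrow> real \<Rightarrow> (real ^ 'n \<Rightarrow> real ^ 'n ^ 'n \<Rightarrow> real) \<Rightarrow> bool" where
  "elliptic_assumptions lam Lam \<omega> C\<^sub>F F \<longleftrightarrow>
     (\<forall>x \<in> B1. continuous_on Sym (F x) \<and> F x 0 = 0) \<and>
     (\<forall>x \<in> B1. \<forall>X \<in> Sym. \<forall>Y \<in> Sym.
        pucci_min lam Lam (X - Y) \<le> F x X - F x Y \<and>
        F x X - F x Y \<le> pucci_max lam Lam (X - Y)) \<and>
     (\<forall>x \<in> B1. \<forall>x0 \<in> B1. \<forall>X \<in> Sym. X \<noteq> 0 \<longrightarrow>
        \<bar>F x X - F x0 X\<bar> / onorm (\<lambda>v. X *v v) \<le> C\<^sub>F * \<omega> (norm (x - x0)))"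

definition degeneracy_assumptions ::
  "real \<Rightarrow> real \<Rightarrow> real \<Rightarrow> real \<Rightarrow> (real ^ 'n \<Rightarrow> real) \<Rightarrow> (real ^ 'n \<Rightarrow> real ^ 'n \<Rightarrow> real) \<Rightarrow> bool" where
  "degeneracy_assumptions p q L\<^sub>1 L\<^sub>2 a H \<longleftrightarrow>
     (\<forall>x \<in> B1. \<forall>\<xi>. 0 \<le> H x \<xi> \<and>
        L\<^sub>1 * (norm \<xi> powr p + a x * norm \<xi> powr q) \<le> H x \<xi> \<and>
        H x \<xi> \<le> L\<^sub>2 * (norm \<xi> powr p + a x * norm \<xi> powr q))"

subsection \<open>Viscosity solutions\<close>

definition grad :: "(real ^ 'n \<Rightarrow> real) \<Rightarrow> real ^ 'n \<Rightarrow> real ^ 'n" where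
  "grad \<phi> x = (\<chi> i. frechet_derivative \<phi> (at x) (axis i 1))"

definition hessian :: "(real ^ 'n \<Rightarrow> real) \<Rightarrow> real ^ 'n \<Rightarrow> real ^ 'n ^ 'n" where
  "hessian \<phi> x = jacobian (grad \<phi>) (at x)"

text \<open>Meaningful for open \<open>S\<close> only.\<close>

definition C2_on :: "(real ^ 'n) set \<Rightarrow> (real ^ 'n \<Rightarrow> real) \<Rightarrow> bool" where
  "C2_on S \<phi> \<longleftrightarrow>
     (\<forall>x \<in> S. \<phi> differentiable (at x)) \<and>
     (\<forall>x \<in> S. grad \<phi> differentiable (at x)) \<and>
     continuous_on S (hessian \<phi>)"

definition local_max_at :: "(real ^ 'n \<Rightarrow> real) \<Rightarrow> real ^ 'n \<Rightarrow> bool" where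
  "local_max_at g x0 \<longleftrightarrow> (\<forall>\<^sub>F x in nhds x0. g x \<le> g x0)"

definition local_min_at :: "(real ^ 'n \<Rightarrow> real) \<Rightarrow> real ^ 'n \<Rightarrow> bool" where
  "local_min_at g x0 \<longleftrightarrow> (\<forall>\<^sub>F x in nhds x0. g x0 \<le> g x)"

definition viscosity_subsolution ::
  "(real ^ 'n \<Rightarrow> real ^ 'n \<Rightarrow> real) \<Rightarrow> (real ^ 'n \<Rightarrow> real ^ 'n ^ 'n \<Rightarrow> real) \<Rightarrow>
   (real ^ 'n \<Rightarrow> real) \<Rightarrow> (real ^ 'n \<Rightarrow> real) \<Rightarrow> bool" where
  "viscosity_subsolution H F f u \<longleftrightarrow>
     continuous_on B1 u \<and>
     (\<forall>\<phi>. \<forall>x0 \<in> B1. C2_on B1 \<phi> \<and> local_max_at (\<lambda>x. u x - \<phi> x) x0 \<longrightarrow>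
        H x0 (grad \<phi> x0) * F x0 (hessian \<phi> x0) \<ge> f x0)"

definition viscosity_supersolution ::
  "(real ^ 'n \<Rightarrow> real ^ 'n \<Rightarrow> real) \<Rightarrow> (real ^ 'n \<Rightarrow> real ^ 'n ^ 'n \<Rightarrow> real) \<Rightarrow>
   (real ^ 'n \<Rightarrow> real) \<Rightarrow> (real ^ 'n \<Rightarrow> real) \<Rightarrow> bool" where
  "viscosity_supersolution H F f u \<longleftrightarrow>
     continuous_on B1 u \<and>
     (\<forall>\<phi>. \<forall>x0 \<in> B1. C2_on B1 \<phi> \<and> local_min_at (\<lambda>x. u x - \<phi> x) x0 \<longrightarrow>
        H x0 (grad \<phi> x0) * F x0 (hessian \<phi> x0) \<le> f x0)"

definition viscosity_solution ::
  "(real ^ 'n \<Rightarrow> real ^ 'n \<Rightarrow> real) \<Rightarrow> (real ^ 'n \<Rightarrow> real ^ 'n ^ 'n \<Rightarrow> real) \<Rightarrow>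
   (real ^ 'n \<Rightarrow> real) \<Rightarrow> (real ^ 'n \<Rightarrow> real) \<Rightarrow> bool" where
  "viscosity_solution H F f u \<longleftrightarrow>
     viscosity_subsolution H F f u \<and> viscosity_supersolution H F f u"

subsection \<open>Function spaces\<close>

text \<open>Norms take values in \<open>ennreal\<close>: the norm is \<open>\<infinity>\<close> exactly when the function does not
  belong to the space. In particular \<open>u \<in> C(B\<^sub>1)\<close> may be unbounded.\<close>

definition Linf_norm :: "(real ^ 'n) set \<Rightarrow> (real ^ 'n \<Rightarrow> real) \<Rightarrow> ennreal" where
  "Linf_norm S g = esssup (lebesgue_on S) (\<lambda>x. ennreal \<bar>g x\<bar>)"

definition holder_seminorm :: "real \<Rightarrow> (real ^ 'n) set \<Rightarrow> (real ^ 'n \<Rightarrow> real) \<Rightarrow> ennreal" where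
  "holder_seminorm \<alpha> S g =
     (SUP (x, y) \<in> {(x, y). x \<in> S \<and> y \<in> S \<and> x \<noteq> y}.
        ennreal (\<bar>g x - g y\<bar> / norm (x - y) powr \<alpha>))"

definition holder_norm :: "real \<Rightarrow> (real ^ 'n) set \<Rightarrow> (real ^ 'n \<Rightarrow> real) \<Rightarrow> ennreal" where
  "holder_norm \<alpha> S g = (SUP x \<in> S. ennreal \<bar>g x\<bar>) + holder_seminorm \<alpha> S g"

definition holder_loc :: "real \<Rightarrow> (real ^ 'n) set \<Rightarrow> (real ^ 'n \<Rightarrow> real) \<Rightarrow> bool" where
  "holder_loc \<alpha> S g \<longleftrightarrow> (\<forall>K. compact K \<and> K \<subseteq> S \<longrightarrow> holder_norm \<alpha> K g < \<infinity>)"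

text \<open>For continuous bounded \<open>f\<close> and continuous \<open>a \<ge> 0\<close> the \<open>L\<^sup>\<infinity>\<close> norm below is finite, so
  \<open>enn2real\<close> loses nothing.\<close>

definition Pi_const ::
  "real \<Rightarrow> real \<Rightarrow> real \<Rightarrow> (real ^ 'n \<Rightarrow> real) \<Rightarrow> (real ^ 'n \<Rightarrow> real) \<Rightarrow> real" where
  "Pi_const p q L\<^sub>1 f a =
     (let K = measure lebesgue (B1 :: (real ^ 'n) set) powr (1 / real CARD('n)) * inverse L\<^sub>1 *
              enn2real (Linf_norm B1 (\<lambda>x. f x / (1 + a x)))
      in max (K powr (1 / (p + 1))) (K powr (1 / (q + 1))))"

end

theory Submission
  imports Defs
begin

text \<open>
The constant \<open>C\<close> has to be independent of \<open>p\<close> and \<open>q\<close>, but the exponent may depend on all the data. It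
is therefore enough to prove a bound \<open>|u x - u y| \<le> 2 A J |x - y|\<^sup>\<alpha>\<close>, where \<open>J\<close> is the sum of the
two terms on the right, with any \<open>A\<close> and \<open>\<alpha>\<close> depending on the data: since also
\<open>|u x - u y| \<le> 2 J\<close>, replacing \<open>\<alpha>\<close> by \<open>\<alpha> t\<close> replaces \<open>A\<close> by \<open>A\<^sup>t\<close>, which is 2 for a suitable \<open>t\<close>, and \<open>C = 5\<close> works (\<open>holder_interpolate\<close>).

Where the gradient is at least \<open>g\<close> one may divide by \<open>H\<close>, and both \<open>u\<close> and \<open>- u\<close> become supersolutions
of a uniformly elliptic inequality with bounded right-hand side, while nothing is known at small
gradients (\<open>supersol\<close>, \<open>viscosity_solution_imp_supersol\<close>). After normalizing a ball to radius 3 and the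
oscillation to 1, the threshold and the right-hand side are small if \<open>J\<close> was multiplied by a large
constant (\<open>powr_threshold\<close>). So everything rests on a Krylov-Safonov estimate for equations that hold
only where the gradient is large.

Its heart is a measure estimate. Cusps \<open>- 3 |x - y|\<^sup>1\<^sup>/\<^sup>2\<close>, with \<open>y\<close> in a small ball, are raised until
they touch the graph of \<open>u\<close> from below. Their gradients are never small, so the equation applies at
each contact point other than the vertex. Ellipticity forbids convex corners at small scales
(\<open>two_touch\<close>), hence the slope, and with it the vertex \<open>y\<close>, is a locally Lipschitz function of the
contact point with a controlled constant (\<open>cusp_contact_lipschitz\<close>). As the vertices fill a ball, the
contact points, at which \<open>u\<close> is bounded, have measure bounded below (\<open>vol_sublevel_ge\<close>).

A Gaussian barrier moves the point where \<open>u\<close> is small to the centre (\<open>point_to_measure\<close>); a Vitali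
covering argument improves positive measure to more than half of the ball (\<open>growing_ink_spots\<close>,
\<open>superlevel_set_small\<close>). Applied to whichever of \<open>u\<close> and \<open>- u\<close> is large on half of the ball, this
decreases the oscillation by a fixed factor (\<open>oscillation_decay\<close>), and iteration over scales gives
the Hoelder estimate (\<open>holder_estimate_ball\<close>).
\<close>

section \<open>Supersolutions at large gradients\<close>

text \<open>The class in which the whole regularity argument lives: supersolutions of a uniformly elliptic
inequality that is only known at points where the gradient is at least \<open>\<gamma>\<close>. Testing with quadratic
polynomials whose Hessian is \<open>2 (b v v\<^sup>T - a I)\<close> suffices, and for these the minimal Pucci operator
is controlled from below by \<open>2 (l b - D a)\<close> with \<open>l = \<lambda>\<close> and \<open>D = N \<Lambda>\<close>. In this form the
class is visibly stable under translation, dilation and multiplication by positive constants.\<close>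
definition supersol ::
  "real \<Rightarrow> real \<Rightarrow> real \<Rightarrow> real \<Rightarrow> 'a::euclidean_space set \<Rightarrow> ('a \<Rightarrow> real) \<Rightarrow> bool" where
  "supersol l D \<gamma> \<kappa> S u \<longleftrightarrow>
     (\<forall>x\<in>S. \<forall>p v a b. norm v = 1 \<and> 0 \<le> a \<and> 0 \<le> b \<and> \<gamma> \<le> norm p \<and>
        (\<forall>\<^sub>F y in nhds x. u x + p \<bullet> (y - x) + b * (v \<bullet> (y - x))\<^sup>2 - a * (norm (y - x))\<^sup>2 \<le> u y)
        \<longrightarrow> l * b - D * a \<le> \<kappa>)"

lemma supersolD:
  assumes "supersol l D \<gamma> \<kappa> S u" "x \<in> S" "norm v = 1" "0 \<le> a" "0 \<le> b" "\<gamma> \<le> norm p"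
    and "\<forall>\<^sub>F y in nhds x. u x + p \<bullet> (y - x) + b * (v \<bullet> (y - x))\<^sup>2 - a * (norm (y - x))\<^sup>2 \<le> u y"
  shows "l * b - D * a \<le> \<kappa>"
  using assms unfolding supersol_def by blast

lemma supersol_mono:
  assumes "supersol l D \<gamma> \<kappa> S u" "\<gamma> \<le> \<gamma>'" "\<kappa> \<le> \<kappa>'" "S' \<subseteq> S"
  shows "supersol l D \<gamma>' \<kappa>' S' u"
  unfolding supersol_def
proof (intro ballI allI impI, elim conjE)
  fix x p v and a b :: real
  assume *: "x \<in> S'" "norm v = 1" "0 \<le> a" "0 \<le> b" "\<gamma>' \<le> norm p"
    "\<forall>\<^sub>F y in nhds x. u x + p \<bullet> (y - x) + b * (v \<bullet> (y - x))\<^sup>2 - a * (norm (y - x))\<^sup>2 \<le> u y"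
  have "l * b - D * a \<le> \<kappa>"
    by (rule supersolD[OF assms(1) _ *(2-4) _ *(6)]) (use * assms in auto)
  with assms show "l * b - D * a \<le> \<kappa>'" by simp
qed

lemma supersol_rescale:
  fixes u :: "'a::euclidean_space \<Rightarrow> real"
  assumes "supersol l D \<gamma> \<kappa> S u" "0 < r" "0 < c"
  shows "supersol l D (\<gamma> * r / c) (\<kappa> * r\<^sup>2 / c) {x. z + r *\<^sub>R x \<in> S} (\<lambda>x. (u (z + r *\<^sub>R x) + m) / c)"
  unfolding supersol_def
proof (intro ballI allI impI, elim conjE)
  fix x p and v :: 'a and a b :: real
  let ?T = "\<lambda>y. (1/r) *\<^sub>R (y - z)"
  let ?x = "z + r *\<^sub>R x"
  assume x: "x \<in> {x. z + r *\<^sub>R x \<in> S}" and v: "norm v = 1" and a: "0 \<le> a" and b: "0 \<le> b"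
    and p: "\<gamma> * r / c \<le> norm p"
    and ev: "\<forall>\<^sub>F y in nhds x. (u ?x + m) / c + p \<bullet> (y - x) + b * (v \<bullet> (y - x))\<^sup>2
       - a * (norm (y - x))\<^sup>2 \<le> (u (z + r *\<^sub>R y) + m) / c"
  have "isCont ?T ?x" by (intro continuous_intros)
  then have "filterlim ?T (nhds (?T ?x)) (nhds ?x)"
    unfolding isCont_def by (rule tendsto_at_iff_tendsto_nhds[THEN iffD1])
  moreover have "?T ?x = x" using assms by simp
  ultimately have lim: "filterlim ?T (nhds x) (nhds ?x)" by simp
  have arith: "U + (c / r) * P + (b * c / r\<^sup>2) * V\<^sup>2 - (a * c / r\<^sup>2) * n\<^sup>2 \<le> W"
    if "c * ((U + m) / c + (1/r) * P + b * ((1/r) * V)\<^sup>2 - a * ((1/r) * n)\<^sup>2) \<le> c * ((W + m) / c)"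
    for U P V n W :: real
  proof -
    have "c * ((U + m) / c) = U + m" "c * ((W + m) / c) = W + m" using assms by auto
    with that show ?thesis
      by (simp add: distrib_left right_diff_distrib power_mult_distrib power_divide mult.commute mult.left_commute)
  qed
  have "\<forall>\<^sub>F y in nhds ?x. u ?x + (c / r) *\<^sub>R p \<bullet> (y - ?x) + (b * c / r\<^sup>2) * (v \<bullet> (y - ?x))\<^sup>2
       - (a * c / r\<^sup>2) * (norm (y - ?x))\<^sup>2 \<le> u y"
    using eventually_compose_filterlim[OF ev lim]
  proof (rule eventually_mono)
    fix y
    have e: "?T y - x = (1/r) *\<^sub>R (y - ?x)"
      using assms by (simp add: algebra_simps)
    have e2: "z + r *\<^sub>R ?T y = y" using assms by simp
    assume "(u ?x + m) / c + p \<bullet> (?T y - x) + b * (v \<bullet> (?T y - x))\<^sup>2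
       - a * (norm (?T y - x))\<^sup>2 \<le> (u (z + r *\<^sub>R ?T y) + m) / c"
    then have "c * ((u ?x + m) / c + (1/r) * (p \<bullet> (y - ?x)) + b * ((1/r) * (v \<bullet> (y - ?x)))\<^sup>2
       - a * ((1/r) * norm (y - ?x))\<^sup>2) \<le> c * ((u y + m) / c)"
      unfolding e e2 using assms by (intro mult_left_mono) (auto simp del: scaleR_right_diff_distrib)
    then show "u ?x + (c / r) *\<^sub>R p \<bullet> (y - ?x) + (b * c / r\<^sup>2) * (v \<bullet> (y - ?x))\<^sup>2
       - (a * c / r\<^sup>2) * (norm (y - ?x))\<^sup>2 \<le> u y"
      unfolding inner_scaleR_left by (rule arith)
  qed
  then have "l * (b * c / r\<^sup>2) - D * (a * c / r\<^sup>2) \<le> \<kappa>"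
    using x v a b p assms
    by (intro supersolD[OF assms(1), where v = v and p = "(c / r) *\<^sub>R p" and x = ?x])
      (auto simp: field_simps)
  then have "(l * b - D * a) * (c / r\<^sup>2) \<le> \<kappa>" by (simp add: algebra_simps diff_divide_distrib)
  then show "l * b - D * a \<le> \<kappa> * r\<^sup>2 / c"
    using assms by (simp add: field_simps)
qed

text \<open>Comparison in a ball: if a quadratic lies strictly below \<open>u\<close> on the sphere and not below it at the
centre, then a vertical translate touches \<open>u\<close> from below at an interior point. Re-expanding the
quadratic at that point changes its gradient but not its second-order part.\<close>
lemma interior_touch:
  fixes u :: "'a::euclidean_space \<Rightarrow> real"
  assumes sup: "supersol l D \<gamma> \<kappa> S u" and u: "continuous_on (cball x0 R) u"
    and R: "0 < R" "cball x0 R \<subseteq> S" and v: "norm v = 1" and a: "0 \<le> a" and b: "0 \<le> b"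
    and bd: "\<And>x. dist x0 x = R \<Longrightarrow>
        q + p \<bullet> (x - x0) + b * (v \<bullet> (x - x0))\<^sup>2 - a * (norm (x - x0))\<^sup>2 < u x"
    and in0: "u x0 \<le> q"
    and gr: "\<And>x. x \<in> cball x0 R \<Longrightarrow>
        \<gamma> \<le> norm (p + (2 * b * (v \<bullet> (x - x0))) *\<^sub>R v - (2 * a) *\<^sub>R (x - x0))"
  shows "l * b - D * a \<le> \<kappa>"
proof -
  define Q where "Q x = q + p \<bullet> (x - x0) + b * (v \<bullet> (x - x0))\<^sup>2 - a * (norm (x - x0))\<^sup>2" for x
  have "continuous_on (cball x0 R) (\<lambda>x. u x - Q x)"
    unfolding Q_def by (intro continuous_intros u)
  then obtain x2 where x2: "x2 \<in> cball x0 R" "\<And>x. x \<in> cball x0 R \<Longrightarrow> u x2 - Q x2 \<le> u x - Q x"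
    using continuous_attains_inf[of "cball x0 R" "\<lambda>x. u x - Q x"] R by auto
  have "u x2 - Q x2 \<le> u x0 - Q x0" using R by (intro x2) auto
  also have "\<dots> \<le> 0" using in0 by (simp add: Q_def)
  finally have "dist x0 x2 \<noteq> R" using bd[of x2] by (auto simp: Q_def)
  with x2(1) have x2': "x2 \<in> ball x0 R" by simp
  define p2 where "p2 = p + (2 * b * (v \<bullet> (x2 - x0))) *\<^sub>R v - (2 * a) *\<^sub>R (x2 - x0)"
  have Q2: "Q y = Q x2 + p2 \<bullet> (y - x2) + b * (v \<bullet> (y - x2))\<^sup>2 - a * (norm (y - x2))\<^sup>2" for y
    unfolding Q_def p2_def power2_norm_eq_inner unfolding power2_eq_square
    by (simp add: inner_diff_left inner_diff_right inner_add_left inner_add_right inner_commute algebra_simps)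
  have "\<forall>\<^sub>F y in nhds x2. y \<in> ball x0 R"
    using x2' by (intro eventually_nhds_in_open) auto
  then have ev: "\<forall>\<^sub>F y in nhds x2.
      u x2 + p2 \<bullet> (y - x2) + b * (v \<bullet> (y - x2))\<^sup>2 - a * (norm (y - x2))\<^sup>2 \<le> u y"
  proof (rule eventually_mono)
    fix y assume "y \<in> ball x0 R"
    with x2(2)[of y] Q2[of y]
    show "u x2 + p2 \<bullet> (y - x2) + b * (v \<bullet> (y - x2))\<^sup>2 - a * (norm (y - x2))\<^sup>2 \<le> u y"
      by simp
  qed
  show ?thesis
    by (rule supersolD[OF sup _ v a b _ ev]) (use gr[OF x2(1)] x2(1) R(2) in \<open>auto simp: p2_def\<close>)
qed

text \<open>A supersolution touched from below at two nearby points by paraboloids of the same opening cannot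
have very different slopes there: otherwise it would lie above a convex corner, and a parabola that
is strongly convex across the corner (coefficient \<open>b\<close>) and mildly concave in the other directions
(coefficient \<open>a = 6 B\<close>) could be placed below it, against ellipticity. This plays the role of
the \<open>C\<^sup>1\<^sup>,\<^sup>1\<close> bound on the convex envelope in the Alexandrov-Bakelman-Pucci argument; it
involves \<open>u\<close> only near \<open>x0\<close>, where the test function has gradient close to \<open>p0\<close>, hence it is
insensitive to the degeneracy as long as \<open>p0\<close> is not small.\<close>
lemma two_touch:
  fixes u :: "'a::euclidean_space \<Rightarrow> real"
  assumes l: "0 < l" and D: "0 \<le> D" and beta: "\<beta> = (6 * D + 2) / l + 1"
    and sup: "supersol l D \<gamma> \<kappa> S u" and u: "continuous_on (cball x0 \<rho>) u"
    and S: "cball x0 \<rho> \<subseteq> S"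
    and B: "0 < B" "\<kappa> \<le> B" and p0: "2 * \<gamma> \<le> norm p0" "p0 \<noteq> 0"
    and t0: "\<And>x. x \<in> cball x0 \<rho> \<Longrightarrow> u x0 + p0 \<bullet> (x - x0) - B * (norm (x - x0))\<^sup>2 \<le> u x"
    and t1: "\<And>x. x \<in> cball x0 \<rho> \<Longrightarrow> u x1 + p1 \<bullet> (x - x1) - B * (norm (x - x1))\<^sup>2 \<le> u x"
    and r: "norm (x1 - x0) \<le> r" "0 < r" "\<beta> * r \<le> \<rho>" "\<beta> * r * (2 * B * (3 * \<beta> + 12)) \<le> norm p0"
  shows "norm (p1 - p0) \<le> 4 * \<beta>\<^sup>2 * B * r"
proof (rule ccontr)
  assume "\<not> ?thesis"
  then have K: "norm (p1 - p0) > 4 * \<beta>\<^sup>2 * B * r" by simp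
  \<comment> \<open>These choices give \<open>B R = b r\<close>, so that on the sphere of radius \<open>R\<close> the second paraboloid takes over
    from \<open>s = 2 r\<close> on, safely beyond the corner.\<close>
  define R where "R = \<beta> * r"
  define b where "b = \<beta> * B"
  have b1: "\<beta> \<ge> 1" using beta l D by simp
  have R: "R > 0" "R \<ge> r" "R \<le> \<rho>" using b1 r by (auto simp: R_def)
  have b: "b > 0" using b1 B by (simp add: b_def)
  have bR: "4 * \<beta>\<^sup>2 * B * r = 4 * b * R" by (simp add: b_def R_def power2_eq_square)
  define P where "P = norm (p1 - p0)"
  have P: "P > 4 * b * R" using K bR by (simp add: P_def)
  then have P0: "P > 0" using b R by (intro order.strict_trans[OF _ P] mult_pos_pos) auto
  define e where "e = (1 / P) *\<^sub>R (p1 - p0)"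
  have e1: "norm e = 1" using P0 by (simp add: e_def P_def)
  have pe: "p1 - p0 = P *\<^sub>R e" using P0 by (simp add: e_def)
  have x1: "x1 \<in> cball x0 \<rho>" using r R by (simp add: dist_norm norm_minus_commute)
  \<comment> \<open>The extra slope \<open>b R\<close> along \<open>e\<close> makes the convex part \<open>b s (s + R)\<close> nonpositive on the side where the
    second paraboloid gives no information.\<close>
  have "l * b - D * (6 * B) \<le> \<kappa>"
  proof (rule interior_touch[OF sup _ R(1) _ e1, where q = "u x0" and p = "p0 + (b * R) *\<^sub>R e"])
    show "continuous_on (cball x0 R) u" by (rule continuous_on_subset[OF u]) (use R(3) in auto)
    show "cball x0 R \<subseteq> S" using S R(3) by auto
    fix x assume x: "dist x0 x = R"
    define s where "s = e \<bullet> (x - x0)"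
    have nx: "norm (x - x0) = R" using x by (simp add: dist_norm norm_minus_commute)
    have xr: "x \<in> cball x0 \<rho>" using x R by simp
    have sR: "\<bar>s\<bar> \<le> R" using Cauchy_Schwarz_ineq2[of e "x - x0"] by (simp add: s_def e1 nx)
    have L0: "u x0 + p0 \<bullet> (x - x0) - B * R\<^sup>2 \<le> u x" using t0[OF xr] by (simp add: nx)
    \<comment> \<open>For small \<open>s\<close> the paraboloid at \<open>x0\<close> suffices, for larger \<open>s\<close> the slope of the one at \<open>x1\<close> wins.\<close>
    have "b * s * s + b * R * s - 6 * B * R\<^sup>2 < u x - u x0 - p0 \<bullet> (x - x0)"
    proof (cases "b * s \<le> 2 * B * R")
      case True
      have "b * s * s + b * R * s \<le> 4 * B * R\<^sup>2"
      proof (cases "s \<le> 0")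
        case True
        then have "(b * s) * (s + R) \<le> 0" using sR b by (intro mult_nonpos_nonneg mult_nonneg_nonpos) linarith+
        then have "b * s * s + b * R * s \<le> 0" by (simp add: algebra_simps)
        moreover have "0 \<le> 4 * B * R\<^sup>2" using B by simp
        ultimately show ?thesis by linarith
      next
        case False
        then have "(b * s) * (s + R) \<le> (2 * B * R) * (s + R)" using True R by (intro mult_right_mono) auto
        also have "\<dots> \<le> (2 * B * R) * (2 * R)" using sR B R by (intro mult_left_mono) auto
        finally show ?thesis by (simp add: algebra_simps power2_eq_square)
      qed
      moreover have "B * R\<^sup>2 > 0" using B R by simp
      ultimately show ?thesis using L0 by linarith
    next
      case False
      have Rb: "B * R = b * r" by (simp add: R_def b_def)
      have "b * s > b * (2 * r)" using False Rb by simp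
      then have s2: "s > 2 * r" using b by simp
      have bs: "b * s * s + b * R * s \<le> 2 * b * R * s"
      proof -
        have "(b * s) * s \<le> (b * s) * R" using sR s2 b r by (intro mult_left_mono) auto
        then show ?thesis by (simp add: algebra_simps)
      qed
      have "norm (x - x1) \<le> 2 * R"
        using norm_triangle_ineq[of "x - x0" "x0 - x1"] nx r R by (simp add: norm_minus_commute)
      then have "(norm (x - x1))\<^sup>2 \<le> (2 * R)\<^sup>2" by (intro power_mono) auto
      then have q1: "B * (norm (x - x1))\<^sup>2 \<le> 4 * B * R\<^sup>2" using B by (simp add: power_mult_distrib)
      have "(norm (x1 - x0))\<^sup>2 \<le> R\<^sup>2" using r R by (intro power_mono) auto
      then have q2: "B * (norm (x1 - x0))\<^sup>2 \<le> B * R\<^sup>2" using B by simp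
      have "e \<bullet> (x - x1) = s - e \<bullet> (x1 - x0)" by (simp add: s_def algebra_simps)
      moreover have "e \<bullet> (x1 - x0) \<le> r" using Cauchy_Schwarz_ineq2[of e "x1 - x0"] e1 r by simp
      ultimately have ge: "e \<bullet> (x - x1) \<ge> s - r" by simp
      have "(2 * b * R) * s \<le> (2 * b * R) * (2 * (s - r))"
        using s2 b R by (intro mult_left_mono) auto
      also have "\<dots> = (4 * b * R) * (s - r)" by simp
      also have "\<dots> \<le> P * (s - r)" using P s2 r by (intro mult_right_mono) auto
      also have "\<dots> \<le> P * (e \<bullet> (x - x1))" using ge P0 by simp
      also have "\<dots> = (p1 - p0) \<bullet> (x - x1)" using pe by simp
      finally have c: "2 * b * R * s \<le> (p1 - p0) \<bullet> (x - x1)" .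
      have d: "p1 \<bullet> (x - x1) + p0 \<bullet> (x1 - x0) = (p1 - p0) \<bullet> (x - x1) + p0 \<bullet> (x - x0)"
        by (simp add: inner_diff_left inner_diff_right)
      have "B * R\<^sup>2 > 0" using B R by simp
      then show ?thesis
        using t1[OF xr] t0[OF x1] q1 q2 c d bs by linarith
    qed
    moreover have "(p0 + (b * R) *\<^sub>R e) \<bullet> (x - x0) = p0 \<bullet> (x - x0) + b * R * s"
      by (simp add: s_def inner_add_left)
    moreover have "b * s\<^sup>2 = b * s * s" by (simp add: power2_eq_square)
    ultimately show "u x0 + (p0 + (b * R) *\<^sub>R e) \<bullet> (x - x0) + b * (e \<bullet> (x - x0))\<^sup>2
        - 6 * B * (norm (x - x0))\<^sup>2 < u x"
      unfolding nx s_def[symmetric] by linarith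
  next
    fix x assume "x \<in> cball x0 R"
    then have nx: "norm (x - x0) \<le> R" by (simp add: dist_norm norm_minus_commute)
    have sR: "\<bar>e \<bullet> (x - x0)\<bar> \<le> R" using Cauchy_Schwarz_ineq2[of e "x - x0"] nx by (simp add: e1)
    let ?w = "(b * R) *\<^sub>R e + (2 * b * (e \<bullet> (x - x0))) *\<^sub>R e - (2 * (6 * B)) *\<^sub>R (x - x0)"
    have "norm ?w \<le> norm ((b * R) *\<^sub>R e) + norm ((2 * b * (e \<bullet> (x - x0))) *\<^sub>R e) + norm ((2 * (6 * B)) *\<^sub>R (x - x0))"
      by (rule order_trans[OF norm_triangle_ineq4]) (intro add_right_mono norm_triangle_ineq)
    also have "\<dots> = b * R + 2 * b * \<bar>e \<bullet> (x - x0)\<bar> + 12 * B * norm (x - x0)"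
      using b B R e1 by (simp add: abs_mult)
    also have "\<dots> \<le> b * R + 2 * b * R + 12 * B * R"
      using b B sR nx by (intro add_mono mult_left_mono) auto
    also have "\<dots> = R * (B * (3 * \<beta> + 12))" by (simp add: b_def algebra_simps)
    also have "\<dots> \<le> norm p0 / 2" using r(4) by (simp add: R_def algebra_simps)
    finally have "norm ?w \<le> norm p0 / 2" .
    then have "norm (p0 + ?w) \<ge> norm p0 / 2" 
      using norm_triangle_ineq4[of "p0 + ?w" ?w] by simp
    then show "\<gamma> \<le> norm (p0 + (b * R) *\<^sub>R e + (2 * b * (e \<bullet> (x - x0))) *\<^sub>R e - (2 * (6 * B)) *\<^sub>R (x - x0))"
      using p0 by (simp add: add_diff_eq add.assoc)
  qed (use B b in auto)
  moreover have "l * b = (6 * D + 2) * B + l * B" using l by (simp add: b_def beta field_simps)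
  moreover have "l * B > 0" using l B by simp
  ultimately show False using B by (simp add: algebra_simps)
qed

text \<open>The same estimate with the sharp radius \<open>r = norm (x1 - x0)\<close>, which may vanish: in that case it says
that the slope at a contact point is unique.\<close>
lemma two_touch_local:
  fixes u :: "'a::euclidean_space \<Rightarrow> real"
  assumes l: "0 < l" and D: "0 \<le> D" and beta: "\<beta> = (6 * D + 2) / l + 1"
    and sup: "supersol l D \<gamma> \<kappa> S u" and u: "continuous_on (cball x0 \<rho>) u"
    and S: "cball x0 \<rho> \<subseteq> S" and rho: "0 < \<rho>"
    and B: "0 < B" "\<kappa> \<le> B" and p0: "2 * \<gamma> \<le> norm p0" "p0 \<noteq> 0"
    and t0: "\<And>x. x \<in> cball x0 \<rho> \<Longrightarrow> u x0 + p0 \<bullet> (x - x0) - B * (norm (x - x0))\<^sup>2 \<le> u x"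
  obtains \<delta> where "0 < \<delta>"
    "\<And>x1 p1. norm (x1 - x0) < \<delta> \<Longrightarrow>
      (\<And>x. x \<in> cball x0 \<rho> \<Longrightarrow> u x1 + p1 \<bullet> (x - x1) - B * (norm (x - x1))\<^sup>2 \<le> u x) \<Longrightarrow>
      norm (p1 - p0) \<le> 4 * \<beta>\<^sup>2 * B * norm (x1 - x0)"
proof
  have b1: "\<beta> \<ge> 1" using beta l D by simp
  define M where "M = 2 * B * (3 * \<beta> + 12)"
  have M: "0 < M" using B b1 by (auto simp: M_def)
  define \<delta> where "\<delta> = min (\<rho> / \<beta>) (norm p0 / (\<beta> * M))"
  show "0 < \<delta>" using rho b1 p0 M by (auto simp: \<delta>_def)
  fix x1 p1
  assume x1: "norm (x1 - x0) < \<delta>"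
    and t1: "\<And>x. x \<in> cball x0 \<rho> \<Longrightarrow> u x1 + p1 \<bullet> (x - x1) - B * (norm (x - x1))\<^sup>2 \<le> u x"
  have c: "0 < 4 * \<beta>\<^sup>2 * B" using b1 B by simp
  show "norm (p1 - p0) \<le> 4 * \<beta>\<^sup>2 * B * norm (x1 - x0)"
  proof (rule ccontr)
    assume "\<not> ?thesis"
    then have "norm (x1 - x0) < norm (p1 - p0) / (4 * \<beta>\<^sup>2 * B)"
      using c by (simp add: pos_less_divide_eq mult.commute)
    with x1 have "norm (x1 - x0) < min \<delta> (norm (p1 - p0) / (4 * \<beta>\<^sup>2 * B))" by simp
    \<comment> \<open>The radius in the estimate must be positive; the assumed failure is strict, so it persists for some
      \<open>r\<close> strictly above the distance.\<close>
    from dense[OF this] obtain r where r: "norm (x1 - x0) < r" "r < \<delta>" "r < norm (p1 - p0) / (4 * \<beta>\<^sup>2 * B)"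
      by auto
    have r0: "0 < r" using r(1) norm_ge_zero[of "x1 - x0"] by linarith
    have "r \<le> \<rho> / \<beta>" "r \<le> norm p0 / (\<beta> * M)" using r(2) by (auto simp: \<delta>_def)
    then have rr: "\<beta> * r \<le> \<rho>" "\<beta> * r * M \<le> norm p0"
      using b1 M by (auto simp: pos_le_divide_eq mult_ac)
    have "norm (p1 - p0) \<le> 4 * \<beta>\<^sup>2 * B * r"
      by (rule two_touch[OF l D beta sup u S B p0 t0 t1 _ r0 rr(1) rr(2)[unfolded M_def]])
        (use r(1) in auto)
    with r(3) c show False by (simp add: pos_less_divide_eq mult.commute)
  qed
qed

section \<open>Volume of Lipschitz images\<close>

abbreviation vol :: "'a::euclidean_space set \<Rightarrow> real" where "vol \<equiv> measure lebesgue"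

lemma vol_ball: "0 \<le> r \<Longrightarrow> vol (ball x r :: 'a::euclidean_space set) = vol (ball 0 1 :: 'a set) * r ^ DIM('a)"
  by (simp add: content_ball)

lemma vol_cball: "0 \<le> r \<Longrightarrow> vol (cball x r :: 'a::euclidean_space set) = vol (ball 0 1 :: 'a set) * r ^ DIM('a)"
  by (simp add: content_ball content_cball)

lemma vol_unit_pos: "0 < vol (ball 0 1 :: 'a::euclidean_space set)"
  by (simp add: content_ball)

text \<open>The counting step that follows every application of the Vitali covering lemma: the sets \<open>A i\<close> are
the enlarged pieces, the \<open>B i\<close> the disjoint ones packed in \<open>U\<close>.\<close>
lemma vol_UN_le_of_disjoint:
  fixes A B :: "'i \<Rightarrow> 'a::euclidean_space set"
  assumes C: "countable C" and c: "0 \<le> c"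
    and disj: "pairwise (\<lambda>i j. disjnt (B i) (B j)) C"
    and B: "\<And>i. i \<in> C \<Longrightarrow> B i \<in> lmeasurable \<and> B i \<subseteq> U" and U: "U \<in> lmeasurable"
    and A: "\<And>i. i \<in> C \<Longrightarrow> A i \<in> lmeasurable \<and> vol (A i) \<le> c * vol (B i)"
  shows "(\<Union>i\<in>C. A i) \<in> lmeasurable" "vol (\<Union>i\<in>C. A i) \<le> c * vol U"
proof -
  have bd0: "(\<Sum>i\<in>I. vol (A i)) \<le> c * vol U" if I: "I \<subseteq> C" "finite I" for I
  proof -
    have "(\<Sum>i\<in>I. vol (A i)) \<le> (\<Sum>i\<in>I. c * vol (B i))"
      using A I by (intro sum_mono) auto
    also have "\<dots> = c * (\<Sum>i\<in>I. vol (B i))" by (simp add: sum_distrib_left)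
    also have "(\<Sum>i\<in>I. vol (B i)) = vol (\<Union>i\<in>I. B i)"
      by (rule measure_UNION'[symmetric]) (use I B disj in \<open>auto intro: pairwise_subset\<close>)
    also have "vol (\<Union>i\<in>I. B i) \<le> vol U"
      using I B U by (intro measure_mono_fmeasurable) (auto intro!: fmeasurableD fmeasurable.finite_UN)
    finally show ?thesis using c by (simp add: mult_left_mono)
  qed
  have bd: "vol (\<Union>i\<in>I. A i) \<le> c * vol U" if I: "I \<subseteq> C" "finite I" for I
    by (rule order_trans[OF measure_UNION_le bd0[OF I]]) (use A I in \<open>auto intro: fmeasurableD\<close>)
  show "(\<Union>i\<in>C. A i) \<in> lmeasurable" 
    by (rule fmeasurable_UN_bound[OF C _ bd]) (use A in auto)
  show "vol (\<Union>i\<in>C. A i) \<le> c * vol U"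
    by (rule measure_UN_bound[OF C _ bd]) (use A in auto)
qed

text \<open>A crude area formula for relations. The set \<open>P\<close> is the graph of a
relation that is Lipschitz at every point, with one constant but with a neighbourhood that may
shrink from point to point; a Vitali cover by balls that are small compared with these
neighbourhoods and stay in a tight open superset of \<open>fst ` P\<close> gives the bound.\<close>
lemma vol_image_le_of_pointwise_lipschitz:
  fixes P :: "('a::euclidean_space \<times> 'a) set"
  assumes T: "fst ` P \<in> lmeasurable" and Y: "snd ` P \<in> lmeasurable" and L: "0 \<le> L"
    and lip: "\<And>x y. (x, y) \<in> P \<Longrightarrow>
      \<exists>\<delta>>0. \<forall>(x', y') \<in> P. norm (x' - x) < \<delta> \<longrightarrow> norm (y' - y) \<le> L * norm (x' - x)"
  shows "vol (snd ` P) \<le> (5 * L) ^ DIM('a) * vol (fst ` P)"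
proof -
  have "vol (snd ` P) \<le> (5 * L) ^ DIM('a) * vol (fst ` P) + \<epsilon>" if \<epsilon>: "\<epsilon> > 0" for \<epsilon>
  proof -
    define e where "e = \<epsilon> / ((5 * L) ^ DIM('a) + 1)"
    have cL: "(5 * L) ^ DIM('a) \<ge> 0" using L by simp
    have e: "e > 0" using \<epsilon> cL by (simp add: e_def add_nonneg_pos)
    obtain U where U: "open U" "fst ` P \<subseteq> U" "U - fst ` P \<in> lmeasurable"
        "emeasure lebesgue (U - fst ` P) < ennreal e"
      using sets_lebesgue_outer_open[OF fmeasurableD[OF T] e] by metis
    have Um: "U \<in> lmeasurable"
      using fmeasurable.Un[OF U(3) T] U(2) by (simp add: Un_absorb2)
    have "vol U = vol (fst ` P) + vol (U - fst ` P)"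
      using measurable_measure_Diff[OF Um fmeasurableD[OF T] U(2)] by simp
    moreover have "vol (U - fst ` P) < e"
      using U(3,4) e by (simp add: emeasure_eq_measure2 ennreal_less_iff)
    ultimately have vU: "vol U \<le> vol (fst ` P) + e" by simp
    have "\<forall>z\<in>P. \<exists>r. 0 < r \<and> r \<le> 1 \<and> ball (fst z) r \<subseteq> U \<and>
        (\<forall>(x', y') \<in> P. norm (x' - fst z) < 5 * r \<longrightarrow> norm (y' - snd z) \<le> L * norm (x' - fst z))"
    proof
      fix z assume z: "z \<in> P"
      obtain d where d: "d > 0" "\<forall>(x', y') \<in> P. norm (x' - fst z) < d \<longrightarrow> norm (y' - snd z) \<le> L * norm (x' - fst z)"
        using lip[of "fst z" "snd z"] z by auto
      obtain d' where d': "d' > 0" "ball (fst z) d' \<subseteq> U"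
        using U(1,2) z open_contains_ball by (metis imageI subsetD)
      show "\<exists>r. 0 < r \<and> r \<le> 1 \<and> ball (fst z) r \<subseteq> U \<and>
        (\<forall>(x', y') \<in> P. norm (x' - fst z) < 5 * r \<longrightarrow> norm (y' - snd z) \<le> L * norm (x' - fst z))"
        by (rule exI[of _ "min 1 (min d' (d / 5))"]) (use d d' in auto)
    qed
    from bchoice[OF this] obtain r where r0: "\<forall>z\<in>P. 0 < r z \<and> r z \<le> 1 \<and> ball (fst z) (r z) \<subseteq> U \<and>
        (\<forall>(x', y') \<in> P. norm (x' - fst z) < 5 * r z \<longrightarrow> norm (y' - snd z) \<le> L * norm (x' - fst z))"
      by blast
    have r: "\<And>z. z \<in> P \<Longrightarrow> 0 < r z" "\<And>z. z \<in> P \<Longrightarrow> r z \<le> 1"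
        "\<And>z. z \<in> P \<Longrightarrow> ball (fst z) (r z) \<subseteq> U"
        "\<And>z x' y'. z \<in> P \<Longrightarrow> (x', y') \<in> P \<Longrightarrow> norm (x' - fst z) < 5 * r z \<Longrightarrow>
          norm (y' - snd z) \<le> L * norm (x' - fst z)"
      using r0 by auto
    have cov0: "fst ` P \<subseteq> (\<Union>z\<in>P. ball (fst z) (r z))"
    proof
      fix x assume "x \<in> fst ` P"
      then obtain z where "z \<in> P" "x = fst z" by blast
      with r(1)[of z] show "x \<in> (\<Union>z\<in>P. ball (fst z) (r z))" by (intro UN_I[of z]) auto
    qed
    have r01: "\<And>z. z \<in> P \<Longrightarrow> 0 < r z \<and> r z \<le> 1" using r by blast
    obtain C where C: "countable C" "C \<subseteq> P"
        "pairwise (\<lambda>i j. disjnt (ball (fst i) (r i)) (ball (fst j) (r j))) C"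
        "fst ` P \<subseteq> (\<Union>z\<in>C. ball (fst z) (5 * r z))"
      by (rule Vitali_covering_lemma_balls[OF cov0 r01])
    have cov: "snd ` P \<subseteq> (\<Union>z\<in>C. cball (snd z) (5 * L * r z))"
    proof (clarsimp)
      fix x y assume xy: "(x, y) \<in> P"
      then have "x \<in> fst ` P" by force
      then obtain z where z: "z \<in> C" "x \<in> ball (fst z) (5 * r z)"
        using C(4) by blast
      have nx: "norm (x - fst z) < 5 * r z" using z by (simp add: dist_norm norm_minus_commute)
      have "norm (y - snd z) \<le> L * norm (x - fst z)"
        using r(4)[OF _ xy nx] z C by auto
      also have "\<dots> \<le> L * (5 * r z)" using nx L by (intro mult_left_mono) auto
      finally show "\<exists>z\<in>C. dist (snd z) y \<le> 5 * L * r z"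
        using z(1) by (intro bexI[of _ z]) (simp_all add: dist_norm norm_minus_commute)
    qed
    have "vol (snd ` P) \<le> vol (\<Union>z\<in>C. cball (snd z) (5 * L * r z))"
      and "vol (\<Union>z\<in>C. cball (snd z) (5 * L * r z)) \<le> (5 * L) ^ DIM('a) * vol U"
    proof -
      have *: "vol (cball (snd z) (5 * L * r z)) \<le> (5 * L) ^ DIM('a) * vol (ball (fst z) (r z))"
        if "z \<in> C" for z
      proof -
        have "0 < r z" using r(1)[of z] C(2) that by blast
        then show ?thesis
          using L
          by (simp add: vol_ball[of "r z"] vol_cball[of "5 * L * r z"] power_mult_distrib del: measure_completion)
      qed
      have BB: "ball (fst z) (r z) \<in> lmeasurable \<and> ball (fst z) (r z) \<subseteq> U" if "z \<in> C" for z
        using r(3)[of z] C(2) that by (intro conjI lmeasurable_ball) blast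
      have AA: "cball (snd z) (5 * L * r z) \<in> lmeasurable \<and>
          vol (cball (snd z) (5 * L * r z)) \<le> (5 * L) ^ DIM('a) * vol (ball (fst z) (r z))"
        if "z \<in> C" for z
        using *[OF that] lmeasurable_cball by blast
      note ** = vol_UN_le_of_disjoint[OF C(1) cL C(3) BB Um AA]
      show "vol (\<Union>z\<in>C. cball (snd z) (5 * L * r z)) \<le> (5 * L) ^ DIM('a) * vol U"
        by (rule **(2))
      show "vol (snd ` P) \<le> vol (\<Union>z\<in>C. cball (snd z) (5 * L * r z))"
        by (rule measure_mono_fmeasurable[OF cov fmeasurableD[OF Y] **(1)])
    qed
    then have "vol (snd ` P) \<le> (5 * L) ^ DIM('a) * vol U" by linarith
    also have "\<dots> \<le> (5 * L) ^ DIM('a) * (vol (fst ` P) + e)" using vU cL by (intro mult_left_mono)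
    also have "\<dots> = (5 * L) ^ DIM('a) * vol (fst ` P) + (5 * L) ^ DIM('a) * e" by (rule distrib_left)
    also have "(5 * L) ^ DIM('a) * e \<le> \<epsilon>"
      using cL \<epsilon> by (simp add: e_def field_simps add_nonneg_pos)
    finally show ?thesis by simp
  qed
  then show ?thesis by (rule field_le_epsilon)
qed

section \<open>Sliding cusps\<close>

text \<open>The square root of the norm is a concave function of the squared norm, namely its fourth root, and the right-hand
side is the tangent of that concave function at \<open>z0\<close>. So the inequality is global, and a cusp
\<open>- sqrt (norm z)\<close> may be replaced by a concave paraboloid at each point other than its vertex.\<close>
lemma sqrt_norm_le_quadratic:
  fixes z z0 :: "'a::euclidean_space"
  assumes s: "s = sqrt (norm z0)" and z0: "z0 \<noteq> 0"
  shows "sqrt (norm z) \<le> s + (1 / (2 * s ^ 3)) * (z0 \<bullet> (z - z0)) + (1 / (4 * s ^ 3)) * (norm (z - z0))\<^sup>2"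
proof -
  define t where "t = sqrt (norm z)"
  have s0: "s > 0" using s z0 by simp
  have t0: "t \<ge> 0" by (simp add: t_def)
  have "t ^ 4 = (norm z)\<^sup>2" "s ^ 4 = (norm z0)\<^sup>2"
    by (simp_all add: t_def s power4_eq_xxxx power2_eq_square mult.assoc)
  then have e: "t ^ 4 - s ^ 4 = 2 * (z0 \<bullet> (z - z0)) + (norm (z - z0))\<^sup>2"
    by (simp add: power2_norm_eq_inner inner_diff_left inner_diff_right inner_commute)
  have "t ^ 4 - s ^ 4 - 4 * s ^ 3 * (t - s) = (t - s)\<^sup>2 * (t\<^sup>2 + 2 * t * s + 3 * s\<^sup>2)"
    by (simp add: algebra_simps power2_eq_square power3_eq_cube power4_eq_xxxx)
  also have "\<dots> \<ge> 0" using s0 t0 by simp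
  finally have "4 * s ^ 3 * (t - s) \<le> t ^ 4 - s ^ 4" by simp
  then have "t - s \<le> (t ^ 4 - s ^ 4) / (4 * s ^ 3)" using s0 by (simp add: field_simps)
  also have "\<dots> = (1 / (2 * s ^ 3)) * (z0 \<bullet> (z - z0)) + (1 / (4 * s ^ 3)) * (norm (z - z0))\<^sup>2"
    unfolding e by (simp add: add_divide_distrib)
  finally show ?thesis by (simp add: t_def)
qed

text \<open>The cusp with vertex \<open>y\<close> and amplitude 3, raised until it meets the graph of \<open>u\<close> over the closed unit
ball, touches it at \<open>x\<close>. Cusps are used instead of paraboloids because on a bounded set their
gradient is bounded away from zero, so that the equation can be used at every contact point except
the vertex itself. With the exponent 1/2, the slope \<open>p\<close> determines the vertex, and the curvature at
distance \<open>\<sigma>\<^sup>2\<close> is of the order \<open>\<sigma>\<^sup>-\<^sup>3\<close>, which balances the factor \<open>\<sigma>\<^sup>3\<close> in the vertex formula.\<close>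
definition cusp_contact :: "('a::euclidean_space \<Rightarrow> real) \<Rightarrow> 'a \<Rightarrow> 'a \<Rightarrow> bool" where
  "cusp_contact u x y \<longleftrightarrow>
     (\<forall>x'\<in>cball 0 1. u x + 3 * sqrt (norm (x - y)) \<le> u x' + 3 * sqrt (norm (x' - y)))"

text \<open>Away from its vertex the touching cusp is exchanged for a touching paraboloid with slope \<open>p\<close>, from
which the vertex can be recovered.\<close>
lemma cusp_contact_quadratic:
  fixes u :: "'a::euclidean_space \<Rightarrow> real"
  assumes c: "cusp_contact u x y" and s: "s = sqrt (norm (x - y))" and ne: "x \<noteq> y"
    and p: "p = (- 3 / (2 * s ^ 3)) *\<^sub>R (x - y)"
  shows "norm p = 3 / (2 * s)" "y = x + (2 * s ^ 3 / 3) *\<^sub>R p"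
    "\<And>x'. 3 / (4 * s ^ 3) \<le> B \<Longrightarrow> x' \<in> cball 0 1 \<Longrightarrow> u x + p \<bullet> (x' - x) - B * (norm (x' - x))\<^sup>2 \<le> u x'"
proof -
  have s0: "s > 0" using s ne by simp
  have ss: "norm (x - y) = s * s" using s by simp
  show "norm p = 3 / (2 * s)" using s0 by (simp add: p ss power3_eq_cube)
  show "y = x + (2 * s ^ 3 / 3) *\<^sub>R p" using s0 by (simp add: p)
  fix x' :: 'a assume B: "3 / (4 * s ^ 3) \<le> B" and x': "x' \<in> cball 0 1"
  have "sqrt (norm (x' - y)) \<le> s + (1 / (2 * s ^ 3)) * ((x - y) \<bullet> (x' - x)) + (1 / (4 * s ^ 3)) * (norm (x' - x))\<^sup>2"
    using sqrt_norm_le_quadratic[OF s, of "x' - y"] ne by simp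
  moreover have "u x + 3 * s \<le> u x' + 3 * sqrt (norm (x' - y))"
    using c x' s unfolding cusp_contact_def by blast
  ultimately have "u x - 3 * ((1 / (2 * s ^ 3)) * ((x - y) \<bullet> (x' - x))) - 3 * ((1 / (4 * s ^ 3)) * (norm (x' - x))\<^sup>2) \<le> u x'"
    by linarith
  moreover have "p \<bullet> (x' - x) = - 3 * ((1 / (2 * s ^ 3)) * ((x - y) \<bullet> (x' - x)))" by (simp add: p)
  moreover have "3 * ((1 / (4 * s ^ 3)) * (norm (x' - x))\<^sup>2) \<le> B * (norm (x' - x))\<^sup>2"
    using mult_right_mono[OF B, of "(norm (x' - x))\<^sup>2"] by simp
  ultimately show "u x + p \<bullet> (x' - x) - B * (norm (x' - x))\<^sup>2 \<le> u x'" by linarith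
qed

text \<open>The map from (contact point, slope) to the vertex is \<open>x + (2 \<sigma>\<^sup>3 / 3) p\<close> with \<open>\<sigma> = 3 / (2 norm p)\<close>.
If slopes vary with Lipschitz constant \<open>K / \<sigma>\<^sup>3\<close>, the powers of \<open>\<sigma>\<close> cancel and vertices vary with a
Lipschitz constant that does not see how close the contact point is to its vertex.\<close>
lemma vertex_lipschitz:
  fixes x0 x1 p0 p1 :: "'a::euclidean_space"
  assumes s: "0 < s0" "0 < s1" and n0: "norm p0 = 3 / (2 * s0)" and n1: "norm p1 = 3 / (2 * s1)"
    and close: "norm (p1 - p0) \<le> norm p0 / 4"
    and lip: "norm (p1 - p0) \<le> K / s0 ^ 3 * norm (x1 - x0)"
  shows "norm ((x1 + (2 * s1 ^ 3 / 3) *\<^sub>R p1) - (x0 + (2 * s0 ^ 3 / 3) *\<^sub>R p0)) \<le> (1 + 7 * K) * norm (x1 - x0)"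
proof -
  define d where "d = norm (p1 - p0)"
  have "norm p1 \<ge> norm p0 - d" using norm_triangle_ineq2[of p0 p1] by (simp add: d_def norm_minus_commute)
  then have "norm p1 \<ge> 3 / 4 * norm p0" using close by (simp add: d_def)
  then have s10: "s1 \<le> 4 / 3 * s0" using s by (simp add: n0 n1 field_simps)
  have s1c: "s1 ^ 3 \<le> 3 * s0 ^ 3"
  proof -
    have "s1 ^ 3 \<le> (4 / 3 * s0) ^ 3" using s s10 by (intro power_mono) auto
    also have "\<dots> = 64 / 27 * s0 ^ 3" by (simp add: power_mult_distrib power3_eq_cube)
    also have "\<dots> \<le> 3 * s0 ^ 3" using s by (intro mult_right_mono) auto
    finally show ?thesis .
  qed
  have "\<bar>norm p0 - norm p1\<bar> \<le> d"
    using norm_triangle_ineq3[of p0 p1] by (simp add: d_def norm_minus_commute)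
  moreover have e: "s1 - s0 = (2 / 3) * (s0 * s1) * (norm p0 - norm p1)"
    using s by (simp add: n0 n1 field_simps)
  moreover have "\<bar>s1 - s0\<bar> = (2 / 3) * (s0 * s1) * \<bar>norm p0 - norm p1\<bar>"
    unfolding e using s by (simp add: abs_mult)
  ultimately have "\<bar>s1 - s0\<bar> \<le> (2 / 3) * (s0 * s1) * d"
    using s by (simp add: mult_left_mono)
  also have "\<dots> \<le> (2 / 3) * (s0 * (4 / 3 * s0)) * d"
    using s s10 by (intro mult_right_mono mult_left_mono) (auto simp: d_def)
  also have "\<dots> \<le> s0\<^sup>2 * d" using s by (simp add: d_def power2_eq_square)
  finally have ds: "\<bar>s1 - s0\<bar> \<le> s0\<^sup>2 * d" .
  have "s1\<^sup>2 + s1 * s0 + s0\<^sup>2 \<le> 5 * s0\<^sup>2"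
  proof -
    have "s1 * s1 \<le> (4 / 3 * s0) * (4 / 3 * s0)" using s s10 by (intro mult_mono) auto
    moreover have "s1 * s0 \<le> (4 / 3 * s0) * s0" using s s10 by (intro mult_right_mono) auto
    moreover have "s0 * s0 > 0" using s by simp
    ultimately show ?thesis unfolding power2_eq_square by linarith
  qed
  then have "\<bar>s1 - s0\<bar> * (s1\<^sup>2 + s1 * s0 + s0\<^sup>2) \<le> (s0\<^sup>2 * d) * (5 * s0\<^sup>2)"
    using s ds by (intro mult_mono) (auto simp: d_def)
  moreover have "s1 ^ 3 - s0 ^ 3 = (s1 - s0) * (s1\<^sup>2 + s1 * s0 + s0\<^sup>2)"
    by (simp add: algebra_simps power2_eq_square power3_eq_cube)
  moreover have "\<bar>s1\<^sup>2 + s1 * s0 + s0\<^sup>2\<bar> = s1\<^sup>2 + s1 * s0 + s0\<^sup>2" using s by (intro abs_of_nonneg) auto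
  ultimately have dc: "\<bar>s1 ^ 3 - s0 ^ 3\<bar> \<le> 5 * s0 ^ 4 * d"
    by (simp add: abs_mult power2_eq_square power4_eq_xxxx mult_ac)
  have v: "(x1 + (2 * s1 ^ 3 / 3) *\<^sub>R p1) - (x0 + (2 * s0 ^ 3 / 3) *\<^sub>R p0) =
      (x1 - x0) + ((2 * s1 ^ 3 / 3) *\<^sub>R (p1 - p0) + ((2 / 3) * (s1 ^ 3 - s0 ^ 3)) *\<^sub>R p0)"
    by (simp add: algebra_simps)
  have t1: "norm ((2 * s1 ^ 3 / 3) *\<^sub>R (p1 - p0)) \<le> 2 * s0 ^ 3 * d"
    using s s1c mult_right_mono[of "2 * s1 ^ 3 / 3" "2 * s0 ^ 3" d] by (simp add: d_def)
  have "norm (((2 / 3) * (s1 ^ 3 - s0 ^ 3)) *\<^sub>R p0) = (2 / 3) * \<bar>s1 ^ 3 - s0 ^ 3\<bar> * (3 / (2 * s0))"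
    unfolding norm_scaleR n0 abs_mult by simp
  also have "\<dots> \<le> (2 / 3) * (5 * s0 ^ 4 * d) * (3 / (2 * s0))"
    using s dc by (intro mult_right_mono mult_left_mono) auto
  also have "\<dots> = 5 * s0 ^ 3 * d" using s by (simp add: power3_eq_cube power4_eq_xxxx)
  finally have t2: "norm (((2 / 3) * (s1 ^ 3 - s0 ^ 3)) *\<^sub>R p0) \<le> 5 * s0 ^ 3 * d" .
  have "s0 ^ 3 * d \<le> s0 ^ 3 * (K / s0 ^ 3 * norm (x1 - x0))"
    using s lip by (intro mult_left_mono) (auto simp: d_def)
  also have "\<dots> = K * norm (x1 - x0)" using s by simp
  finally have "7 * (s0 ^ 3 * d) \<le> 7 * (K * norm (x1 - x0))" by simp
  moreover have "norm ((x1 - x0) + ((2 * s1 ^ 3 / 3) *\<^sub>R (p1 - p0) + ((2 / 3) * (s1 ^ 3 - s0 ^ 3)) *\<^sub>R p0))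
     \<le> norm (x1 - x0) + (2 * s0 ^ 3 * d + 5 * s0 ^ 3 * d)"
    by (intro order_trans[OF norm_triangle_ineq] add_mono order_refl t1 t2)
  ultimately show ?thesis unfolding v by (simp add: algebra_simps)
qed

text \<open>The slope estimate is applied twice. With the crude opening \<open>B1\<close>, admissible for all contacts at
distance at least \<open>m\<close> from their vertex, it gives only that slopes depend continuously on the
contact point. Then nearby contacts have comparable distances to their vertices, so the
opening \<open>2 B0\<close> dictated by \<open>x0\<close> alone is admissible, and the second application has a constant
independent of \<open>m\<close>.\<close>
lemma cusp_contact_lipschitz:
  fixes u :: "'a::euclidean_space \<Rightarrow> real"
  assumes l: "0 < l" and D: "0 \<le> D" and beta: "\<beta> = (6 * D + 2) / l + 1"
    and sup: "supersol l D \<gamma> \<kappa> S u" and g: "\<gamma> \<le> 1 / 2" and k: "\<kappa> \<le> 1 / 2"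
    and u: "continuous_on (cball 0 1) u" and S: "cball 0 1 \<subseteq> S"
    and c0: "cusp_contact u x0 y0" and x0: "x0 \<in> ball 0 1" and ne: "x0 \<noteq> y0"
    and near: "norm (x0 - y0) \<le> 9 / 8" and m: "0 < m" "m \<le> norm (x0 - y0)"
  shows "\<exists>\<delta>>0. \<forall>x1 y1. cusp_contact u x1 y1 \<longrightarrow> m \<le> norm (x1 - y1) \<longrightarrow> norm (x1 - x0) < \<delta>
      \<longrightarrow> norm (y1 - y0) \<le> (1 + 42 * \<beta>\<^sup>2) * norm (x1 - x0)"
proof -
  define \<sigma> where "\<sigma> x y = sqrt (norm (x - y))" for x y :: 'a
  define P where "P x y = (- 3 / (2 * \<sigma> x y ^ 3)) *\<^sub>R (x - y)" for x y
  define s0 where "s0 = \<sigma> x0 y0"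
  define p0 where "p0 = P x0 y0"
  note q = cusp_contact_quadratic[OF _ \<sigma>_def _ P_def]
  have s0: "0 < s0" using ne by (simp add: s0_def \<sigma>_def)
  have n0: "norm p0 = 3 / (2 * s0)" unfolding p0_def s0_def by (rule q(1)[OF c0 ne])
  have s0b: "s0 \<le> 11 / 10"
  proof -
    have "s0 \<le> sqrt (9 / 8)" unfolding s0_def \<sigma>_def using near by (rule real_sqrt_le_mono)
    also have "\<dots> \<le> 11 / 10" by (rule real_le_lsqrt) (auto simp: power2_eq_square)
    finally show ?thesis .
  qed
  have p0: "2 * \<gamma> \<le> norm p0" "p0 \<noteq> 0"
  proof -
    have "1 \<le> 3 / (2 * s0)" using s0 s0b by (simp add: field_simps)
    then show "2 * \<gamma> \<le> norm p0" "p0 \<noteq> 0" using g n0 by auto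
  qed
  define B0 where "B0 = 3 / (4 * s0 ^ 3)"
  have B0: "1 / 2 \<le> B0"
  proof -
    have "s0 ^ 3 \<le> (11 / 10) ^ 3" using s0 s0b by (intro power_mono) auto
    also have "\<dots> \<le> (3 / 2 :: real)" by (simp add: power3_eq_cube)
    finally show ?thesis using s0 by (simp add: B0_def field_simps)
  qed
  \<comment> \<open>\<open>B0\<close> is the opening at \<open>x0\<close>, and \<open>B1\<close> bounds the opening of every competing contact.\<close>
  define B1 where "B1 = 3 / (4 * sqrt m ^ 3)"
  have curv: "3 / (4 * \<sigma> x y ^ 3) \<le> B1" if "m \<le> norm (x - y)" for x y
  proof -
    have "sqrt m ^ 3 \<le> \<sigma> x y ^ 3" unfolding \<sigma>_def using that m by (intro power_mono real_sqrt_le_mono) auto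
    moreover have "0 < \<sigma> x y" using less_le_trans[OF m(1) that] by (simp add: \<sigma>_def)
    ultimately show ?thesis unfolding B1_def using m by (intro divide_left_mono mult_left_mono mult_pos_pos) auto
  qed
  have "B0 \<le> B1" using curv[OF m(2)] by (simp add: B0_def s0_def)
  define \<rho> where "\<rho> = 1 - norm x0"
  have rho: "0 < \<rho>" using x0 by (simp add: \<rho>_def)
  have sub: "cball x0 \<rho> \<subseteq> cball 0 1"
  proof
    fix x assume "x \<in> cball x0 \<rho>"
    then show "x \<in> cball 0 1"
      using norm_triangle_ineq[of x0 "x - x0"] by (simp add: dist_norm norm_minus_commute \<rho>_def)
  qed
  have uc: "continuous_on (cball x0 \<rho>) u" using u sub by (rule continuous_on_subset)
  have t0: "u x0 + p0 \<bullet> (x - x0) - B * (norm (x - x0))\<^sup>2 \<le> u x"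
    if "B0 \<le> B" "x \<in> cball x0 \<rho>" for B x
    unfolding p0_def by (rule q(3)[OF c0 ne]) (use that sub in \<open>auto simp: B0_def s0_def\<close>)
  have S': "cball x0 \<rho> \<subseteq> S" using sub S by blast
  obtain d1 where d1: "0 < d1"
    "\<And>x1 p1. norm (x1 - x0) < d1 \<Longrightarrow>
      (\<And>x. x \<in> cball x0 \<rho> \<Longrightarrow> u x1 + p1 \<bullet> (x - x1) - B1 * (norm (x - x1))\<^sup>2 \<le> u x) \<Longrightarrow>
      norm (p1 - p0) \<le> 4 * \<beta>\<^sup>2 * B1 * norm (x1 - x0)"
    by (rule two_touch_local[OF l D beta sup uc S' rho _ _ p0 t0[OF \<open>B0 \<le> B1\<close>]])
       (use B0 k \<open>B0 \<le> B1\<close> in auto)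
  obtain d2 where d2: "0 < d2"
    "\<And>x1 p1. norm (x1 - x0) < d2 \<Longrightarrow>
      (\<And>x. x \<in> cball x0 \<rho> \<Longrightarrow> u x1 + p1 \<bullet> (x - x1) - (2 * B0) * (norm (x - x1))\<^sup>2 \<le> u x) \<Longrightarrow>
      norm (p1 - p0) \<le> 4 * \<beta>\<^sup>2 * (2 * B0) * norm (x1 - x0)"
    by (rule two_touch_local[OF l D beta sup uc S' rho _ _ p0 t0, of "2 * B0" thesis])
       (use B0 k in auto)
  have b1: "\<beta> \<ge> 1" using beta l D by simp
  have c1: "4 * \<beta>\<^sup>2 * B1 > 0" using b1 B0 \<open>B0 \<le> B1\<close> by simp
  define \<delta> where "\<delta> = min (min d1 d2) (norm p0 / 4 / (4 * \<beta>\<^sup>2 * B1))"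
  have "0 < \<delta>" using d1 d2 c1 p0 by (simp add: \<delta>_def)
  moreover have "norm (y1 - y0) \<le> (1 + 42 * \<beta>\<^sup>2) * norm (x1 - x0)"
    if c: "cusp_contact u x1 y1" and m1: "m \<le> norm (x1 - y1)" and d: "norm (x1 - x0) < \<delta>" for x1 y1
  proof -
    have ne1: "x1 \<noteq> y1" using m m1 by auto
    define p1 where "p1 = P x1 y1"
    define s1 where "s1 = \<sigma> x1 y1"
    have s1: "0 < s1" using ne1 by (simp add: s1_def \<sigma>_def)
    have n1: "norm p1 = 3 / (2 * s1)" unfolding p1_def s1_def by (rule q(1)[OF c ne1])
    have "norm (p1 - p0) \<le> 4 * \<beta>\<^sup>2 * B1 * norm (x1 - x0)"
      by (rule d1(2)) (use d sub curv[OF m1] in \<open>auto simp: \<delta>_def p1_def intro!: q(3)[OF c ne1]\<close>)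
    also have "\<dots> \<le> 4 * \<beta>\<^sup>2 * B1 * \<delta>" using d c1 by (intro mult_left_mono) auto
    also have "\<dots> \<le> 4 * \<beta>\<^sup>2 * B1 * (norm p0 / 4 / (4 * \<beta>\<^sup>2 * B1))"
      using c1 by (intro mult_left_mono) (auto simp: \<delta>_def)
    also have "\<dots> = norm p0 / 4"
    proof -
      have "4 * \<beta>\<^sup>2 * B1 \<noteq> 0" using c1 by linarith
      from nonzero_mult_div_cancel_left[OF this, of "norm p0 / 4"] show ?thesis
        by (simp only: times_divide_eq_right)
    qed
    finally have close: "norm (p1 - p0) \<le> norm p0 / 4" .
    have "norm p1 \<le> norm p0 + norm p0 / 4"
      using close norm_triangle_ineq[of p0 "p1 - p0"] by simp
    then have s01: "s0 \<le> 5 / 4 * s1" using s0 s1 by (simp add: n0 n1 field_simps)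
    have "3 / (4 * s1 ^ 3) \<le> 2 * B0"
    proof -
      have "s0 ^ 3 \<le> (5 / 4 * s1) ^ 3" using s0 s01 by (intro power_mono) auto
      also have "\<dots> = 125 / 64 * s1 ^ 3" by (simp add: power_mult_distrib power3_eq_cube)
      also have "\<dots> \<le> 2 * s1 ^ 3" using s1 by (intro mult_right_mono) auto
      finally show ?thesis using s0 s1 by (simp add: B0_def field_simps)
    qed
    then have "norm (p1 - p0) \<le> 4 * \<beta>\<^sup>2 * (2 * B0) * norm (x1 - x0)"
      by (intro d2(2)) (use d sub in \<open>auto simp: \<delta>_def p1_def s1_def intro!: q(3)[OF c ne1]\<close>)
    also have "\<dots> = 6 * \<beta>\<^sup>2 / s0 ^ 3 * norm (x1 - x0)" by (simp add: B0_def)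
    finally have lip: "norm (p1 - p0) \<le> 6 * \<beta>\<^sup>2 / s0 ^ 3 * norm (x1 - x0)" .
    have y: "y1 = x1 + (2 * s1 ^ 3 / 3) *\<^sub>R p1" "y0 = x0 + (2 * s0 ^ 3 / 3) *\<^sub>R p0"
      unfolding p0_def p1_def s0_def s1_def by (rule q(2)[OF c ne1], rule q(2)[OF c0 ne])
    show ?thesis
      using vertex_lipschitz[OF s0 s1 n0 n1 close lip] unfolding y by simp
  qed
  ultimately show ?thesis by blast
qed

text \<open>The basic measure estimate. For every vertex in the ball of radius 1/8 the raised cusp touches \<open>u\<close> at
an interior point with \<open>u \<le> 5 / 2\<close>: amplitude 3 makes the cusp drop below 0 at the unit sphere. Either
the contact is at the vertex, and then the vertex itself lies in the sublevel set, or the vertex is a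
Lipschitz image of the contact point. Hence the vertices, which fill a ball, are controlled by the
measure of the sublevel set. The distance to the vertex is exhausted by the compact
pieces \<open>P n\<close>.\<close>
lemma vol_sublevel_ge:
  fixes u :: "'a::euclidean_space \<Rightarrow> real"
  assumes l: "0 < l" and D: "0 \<le> D" and beta: "\<beta> = (6 * D + 2) / l + 1"
    and sup: "supersol l D \<gamma> \<kappa> S u" and g: "\<gamma> \<le> 1 / 2" and k: "\<kappa> \<le> 1 / 2"
    and u: "continuous_on (cball 0 1) u" and S: "cball 0 1 \<subseteq> S"
    and pos: "\<And>x. x \<in> cball 0 1 \<Longrightarrow> 0 \<le> u x" and z: "z \<in> cball 0 (1 / 8)" "u z \<le> 1"
  shows "vol (ball 0 1 :: 'a set) * (1 / 8) ^ DIM('a) \<le>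
    (1 + (5 * (1 + 42 * \<beta>\<^sup>2)) ^ DIM('a)) * vol {x \<in> ball 0 1. u x \<le> 5 / 2}"
proof -
  let ?W = "{x \<in> ball 0 1. u x \<le> 5 / 2}"
  let ?Y = "cball 0 (1 / 8) :: 'a set"
  let ?c = "(5 * (1 + 42 * \<beta>\<^sup>2)) ^ DIM('a)"
  have W: "?W \<in> lmeasurable"
  proof -
    have "closed {x \<in> cball 0 1. u x \<le> 5 / 2}"
      using u by (intro continuous_on_closed_Collect_le) auto
    moreover have "bounded {x \<in> cball 0 1. u x \<le> 5 / 2}"
      by (rule bounded_subset[OF bounded_cball[of 0 1]]) auto
    ultimately have "{x \<in> cball 0 1. u x \<le> 5 / 2} \<in> lmeasurable"
      by (intro lmeasurable_compact) (simp add: compact_eq_bounded_closed)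
    then have "{x \<in> cball 0 1. u x \<le> 5 / 2} \<inter> ball 0 1 \<in> lmeasurable"
      by (rule fmeasurable_Int_fmeasurable) auto
    moreover have "{x \<in> cball 0 1. u x \<le> 5 / 2} \<inter> ball 0 1 = ?W" by auto
    ultimately show ?thesis by simp
  qed
  have inW: "x \<in> ?W" if x: "x \<in> cball 0 1" and y: "y \<in> ?Y" and c: "cusp_contact u x y" for x y
  proof -
    have "norm (z - y) \<le> 1 / 4" using norm_triangle_ineq4[of z y] z y by simp
    then have "sqrt (norm (z - y)) \<le> 1 / 2" by (intro real_le_lsqrt) (auto simp: power2_eq_square)
    moreover have "u x + 3 * sqrt (norm (x - y)) \<le> u z + 3 * sqrt (norm (z - y))"
      using c z unfolding cusp_contact_def by auto
    ultimately have *: "u x + 3 * sqrt (norm (x - y)) \<le> 5 / 2" using z by linarith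
    have "u x \<le> 5 / 2" using * real_sqrt_ge_zero[of "norm (x - y)"] norm_ge_zero[of "x - y"] by linarith
    moreover have "norm x \<noteq> 1"
    proof
      assume "norm x = 1"
      then have "7 / 8 \<le> norm (x - y)" using norm_triangle_ineq2[of x y] y by simp
      then have "sqrt (7 / 8) \<le> sqrt (norm (x - y))" by (rule real_sqrt_le_mono)
      moreover have "5 / 6 < sqrt (7 / 8)" by (rule real_less_rsqrt) (simp add: power2_eq_square)
      ultimately show False using * pos[OF x] by linarith
    qed
    ultimately show ?thesis using x by simp
  qed
  have ex: "\<exists>x\<in>cball 0 1. cusp_contact u x y" for y
  proof -
    have "continuous_on (cball 0 1) (\<lambda>x. u x + 3 * sqrt (norm (x - y)))"
      by (intro continuous_intros u)
    then show ?thesis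
      using continuous_attains_inf[of "cball 0 1" "\<lambda>x. u x + 3 * sqrt (norm (x - y))"]
      unfolding cusp_contact_def by auto
  qed
  define P where "P n = {z \<in> cball 0 1 \<times> ?Y. 1 / real (Suc n) \<le> norm (fst z - snd z) \<and> cusp_contact u (fst z) (snd z)}" for n
  have Pc: "compact (P n)" for n
  proof -
    have cu: "continuous_on (cball 0 1 \<times> ?Y) (\<lambda>z. u (fst z))"
      by (rule continuous_on_compose2[OF u]) (auto intro: continuous_intros)
    have "closed {z \<in> cball 0 1 \<times> ?Y. 1 / real (Suc n) \<le> norm (fst z - snd z)}"
      by (intro continuous_on_closed_Collect_le continuous_intros closed_Times) auto
    moreover have "closed {z \<in> cball 0 1 \<times> ?Y. u (fst z) + 3 * sqrt (norm (fst z - snd z)) \<le> u x' + 3 * sqrt (norm (x' - snd z))}" for x'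
      by (intro continuous_on_closed_Collect_le continuous_intros closed_Times cu) auto
    moreover have "P n = {z \<in> cball 0 1 \<times> ?Y. 1 / real (Suc n) \<le> norm (fst z - snd z)} \<inter>
       (\<Inter>x'\<in>cball 0 1. {z \<in> cball 0 1 \<times> ?Y. u (fst z) + 3 * sqrt (norm (fst z - snd z)) \<le> u x' + 3 * sqrt (norm (x' - snd z))})"
      unfolding P_def cusp_contact_def by fastforce
    ultimately have "closed (P n)" by auto
    moreover have "bounded (P n)"
      by (rule bounded_subset[of "cball 0 1 \<times> ?Y"]) (auto simp: P_def intro: bounded_Times)
    ultimately show ?thesis by (simp add: compact_eq_bounded_closed)
  qed
  have m1: "fst ` P n \<in> lmeasurable" for n
    by (intro lmeasurable_compact compact_continuous_image Pc continuous_intros)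
  have m2: "snd ` P n \<in> lmeasurable" for n
    by (intro lmeasurable_compact compact_continuous_image Pc continuous_intros)
  have sW: "fst ` P n \<subseteq> ?W" for n using inW by (fastforce simp: P_def)
  have c0: "0 \<le> ?c" by simp
  have v: "vol (snd ` P n) \<le> ?c * vol ?W" for n
  proof -
    have "vol (snd ` P n) \<le> ?c * vol (fst ` P n)"
    proof (rule vol_image_le_of_pointwise_lipschitz[OF m1 m2])
      fix x y assume xy: "(x, y) \<in> P n"
      then have c: "cusp_contact u x y" and x': "x \<in> cball 0 1" and y: "y \<in> ?Y"
        and m: "1 / real (Suc n) \<le> norm (x - y)"
        by (auto simp: P_def)
      have x: "x \<in> ball 0 1" using inW[OF x' y c] by blast
      have pos: "0 < 1 / real (Suc n)" by simp
      have "x \<noteq> y" using m pos by (metis diff_self norm_zero not_less)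
      have "norm (x - y) \<le> 9 / 8" using norm_triangle_ineq4[of x y] x y by simp
      from cusp_contact_lipschitz[OF l D beta sup g k u S c x \<open>x \<noteq> y\<close> this pos m]
      obtain \<delta> where "\<delta> > 0" and \<delta>: "\<And>x1 y1. cusp_contact u x1 y1 \<Longrightarrow> 1 / real (Suc n) \<le> norm (x1 - y1) \<Longrightarrow> norm (x1 - x) < \<delta>
          \<Longrightarrow> norm (y1 - y) \<le> (1 + 42 * \<beta>\<^sup>2) * norm (x1 - x)" by blast
      then show "\<exists>\<delta>>0. \<forall>(x', y')\<in>P n. norm (x' - x) < \<delta> \<longrightarrow> norm (y' - y) \<le> (1 + 42 * \<beta>\<^sup>2) * norm (x' - x)"
        by (intro exI[of _ \<delta>]) (auto simp: P_def)
    qed simp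
    also have "\<dots> \<le> ?c * vol ?W"
      by (intro mult_left_mono[OF _ c0] measure_mono_fmeasurable sW W fmeasurableD m1)
    finally show ?thesis .
  qed
  have mono: "P i \<subseteq> P j" if "i \<le> j" for i j
  proof -
    have "1 / real (Suc j) \<le> 1 / real (Suc i)" using that by (intro divide_left_mono) auto
    then show ?thesis unfolding P_def by auto
  qed
  have vn: "vol (\<Union>i\<le>n. snd ` P i) \<le> ?c * vol ?W" for n
  proof -
    have "(\<Union>i\<le>n. snd ` P i) = snd ` P n" using mono by blast
    then show ?thesis using v by simp
  qed
  define Y0 where "Y0 = {y \<in> ?Y. cusp_contact u y y}"
  have "compact Y0"
  proof -
    have uy: "continuous_on ?Y u" using u by (rule continuous_on_subset) auto
    have "closed {y \<in> ?Y. u y + 3 * sqrt (norm (y - y)) \<le> u x' + 3 * sqrt (norm (x' - y))}" for x'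
      by (intro continuous_on_closed_Collect_le continuous_intros uy) auto
    moreover have "Y0 = ?Y \<inter> (\<Inter>x'\<in>cball 0 1. {y \<in> ?Y. u y + 3 * sqrt (norm (y - y)) \<le> u x' + 3 * sqrt (norm (x' - y))})"
      unfolding Y0_def cusp_contact_def by fastforce
    ultimately have "closed Y0" by auto
    moreover have "bounded Y0" by (rule bounded_subset[of ?Y]) (auto simp: Y0_def)
    ultimately show ?thesis by (simp add: compact_eq_bounded_closed)
  qed
  then have Y0m: "Y0 \<in> lmeasurable" by (rule lmeasurable_compact)
  have "Y0 \<subseteq> ?W" using inW by (fastforce simp: Y0_def)
  then have vY0: "vol Y0 \<le> vol ?W" by (intro measure_mono_fmeasurable W fmeasurableD Y0m)
  have Um: "(\<Union>n. snd ` P n) \<in> lmeasurable" by (rule fmeasurable_countable_Union[OF m2 vn])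
  have Uv: "vol (\<Union>n. snd ` P n) \<le> ?c * vol ?W" by (rule measure_countable_Union_le[OF m2 vn])
  have cover: "?Y \<subseteq> Y0 \<union> (\<Union>n. snd ` P n)"
  proof
    fix y assume y: "y \<in> ?Y"
    obtain x where x: "x \<in> cball 0 1" "cusp_contact u x y" using ex by blast
    show "y \<in> Y0 \<union> (\<Union>n. snd ` P n)"
    proof (cases "x = y")
      case True
      then show ?thesis using x y by (simp add: Y0_def)
    next
      case False
      then obtain n where "inverse (real (Suc n)) < norm (x - y)"
        using reals_Archimedean[of "norm (x - y)"] by auto
      then have "(x, y) \<in> P n" using x y by (simp add: P_def inverse_eq_divide)
      then have "y \<in> snd ` P n" by force
      then show ?thesis by blast
    qed
  qed
  have "vol (ball 0 1 :: 'a set) * (1 / 8) ^ DIM('a) = vol ?Y" by (rule vol_cball[symmetric]) simp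
  also have "\<dots> \<le> vol (Y0 \<union> (\<Union>n. snd ` P n))"
    by (rule measure_mono_fmeasurable[OF cover]) (use Y0m Um in \<open>auto intro: fmeasurable.Un\<close>)
  also have "\<dots> \<le> vol Y0 + vol (\<Union>n. snd ` P n)"
    by (rule measure_Un_le) (use Y0m Um in \<open>auto intro: fmeasurableD\<close>)
  also have "\<dots> \<le> vol ?W + ?c * vol ?W" using vY0 Uv by (rule add_mono)
  finally show ?thesis by (simp add: algebra_simps)
qed

section \<open>A Gaussian barrier\<close>

lemma exp_ge_quadratic:
  fixes x :: real assumes "- 2 \<le> x" shows "1 + x + x\<^sup>2 / 4 \<le> exp x"
proof -
  have "1 + x / 2 \<le> exp (x / 2)" by (rule exp_ge_add_one_self)
  then have "(1 + x / 2)\<^sup>2 \<le> (exp (x / 2))\<^sup>2" using assms by (intro power_mono) auto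
  also have "(exp (x / 2))\<^sup>2 = exp x" by (simp add: power2_eq_square exp_add[symmetric])
  finally show ?thesis by (simp add: power2_eq_square algebra_simps)
qed

text \<open>The quadratic has a quarter of the radial convexity of the Gaussian; in the direction of \<open>x\<close> the
convexity grows like \<open>s\<^sup>2\<close>, the concave part only like \<open>s\<close>.\<close>
lemma gaussian_ge_quadratic:
  fixes x :: "'a::euclidean_space"
  assumes s: "0 < s"
  shows "\<forall>\<^sub>F y in nhds x. exp (- s * (norm x)\<^sup>2) *
      (1 - 2 * s * (x \<bullet> (y - x)) + s\<^sup>2 / 2 * (x \<bullet> (y - x))\<^sup>2 - 2 * s * (norm (y - x))\<^sup>2)
      \<le> exp (- s * (norm y)\<^sup>2)"
proof -
  let ?\<tau> = "\<lambda>y. 2 * (x \<bullet> (y - x)) + (norm (y - x))\<^sup>2"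
  have "open {y. s * ?\<tau> y < 2 \<and> s * (norm (y - x))\<^sup>2 < 4}"
    by (intro open_Collect_conj open_Collect_less continuous_intros)
  then have "\<forall>\<^sub>F y in nhds x. y \<in> {y. s * ?\<tau> y < 2 \<and> s * (norm (y - x))\<^sup>2 < 4}"
    by (rule eventually_nhds_in_open) simp
  then show ?thesis
  proof (rule eventually_mono)
    fix y assume "y \<in> {y. s * ?\<tau> y < 2 \<and> s * (norm (y - x))\<^sup>2 < 4}"
    then have y: "s * ?\<tau> y < 2" "s * (norm (y - x))\<^sup>2 < 4" by auto
    define P where "P = x \<bullet> (y - x)"
    define n where "n = (norm (y - x))\<^sup>2"
    have n0: "0 \<le> n" by (simp add: n_def)
    have t: "(norm y)\<^sup>2 = (norm x)\<^sup>2 + (2 * P + n)"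
      by (simp add: P_def n_def power2_norm_eq_inner inner_diff_left inner_diff_right inner_commute)
    \<comment> \<open>Half of the square of the linear increment survives; the quartic remainder is absorbed locally.\<close>
    have "(2 * P)\<^sup>2 / 2 - n\<^sup>2 \<le> (2 * P + n)\<^sup>2"
    proof -
      have "0 \<le> (2 * P + 2 * n)\<^sup>2" by simp
      then show ?thesis by (simp add: power2_eq_square algebra_simps)
    qed
    then have "s\<^sup>2 / 4 * (2 * P\<^sup>2 - n\<^sup>2) \<le> s\<^sup>2 / 4 * (2 * P + n)\<^sup>2"
      by (intro mult_left_mono) (auto simp: power2_eq_square)
    moreover have "s\<^sup>2 / 4 * n\<^sup>2 \<le> s * n"
    proof -
      have "(s * n) * (s * n) \<le> 4 * (s * n)" using y(2) s n0 by (intro mult_right_mono) (auto simp: n_def)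
      then show ?thesis by (simp add: power2_eq_square algebra_simps)
    qed
    moreover have "s\<^sup>2 / 4 * (2 * P\<^sup>2 - n\<^sup>2) = s\<^sup>2 / 2 * P\<^sup>2 - s\<^sup>2 / 4 * n\<^sup>2"
      by (simp add: algebra_simps)
    moreover have "1 - s * (2 * P + n) + s\<^sup>2 / 4 * (2 * P + n)\<^sup>2 \<le> exp (- s * (2 * P + n))"
      using exp_ge_quadratic[of "- s * (2 * P + n)"] y(1) by (simp add: P_def n_def power_mult_distrib)
    ultimately have "1 - 2 * s * P + s\<^sup>2 / 2 * P\<^sup>2 - 2 * s * n \<le> exp (- s * (2 * P + n))"
      by (simp add: algebra_simps)
    then have "exp (- s * (norm x)\<^sup>2) * (1 - 2 * s * P + s\<^sup>2 / 2 * P\<^sup>2 - 2 * s * n)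
       \<le> exp (- s * (norm x)\<^sup>2) * exp (- s * (2 * P + n))" by (intro mult_left_mono) auto
    also have "\<dots> = exp (- s * (norm y)\<^sup>2)" unfolding t exp_add[symmetric] by (simp add: algebra_simps)
    finally show "exp (- s * (norm x)\<^sup>2) *
      (1 - 2 * s * (x \<bullet> (y - x)) + s\<^sup>2 / 2 * (x \<bullet> (y - x))\<^sup>2 - 2 * s * (norm (y - x))\<^sup>2)
      \<le> exp (- s * (norm y)\<^sup>2)" by (simp add: P_def n_def)
  qed
qed

text \<open>If \<open>u\<close> were above \<open>M\<close> on the ball of radius 1/8, a multiple of \<open>exp (- s |x|\<^sup>2) - exp (- 4 s)\<close>, which for large \<open>s\<close>
is a strict subsolution with gradient bounded below in the annulus between the radii 1/8 and 2,
would push \<open>u\<close> above 1 on the unit ball.\<close>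
lemma barrier:
  assumes l: "0 < l" and D: "0 \<le> (D::real)"
  obtains M \<gamma>0 \<kappa>0 where "1 \<le> M" "0 < \<gamma>0" "0 < \<kappa>0"
    "\<And>(u :: 'a::euclidean_space \<Rightarrow> real) S. supersol l D \<gamma>0 \<kappa>0 S u \<Longrightarrow> cball 0 2 \<subseteq> S \<Longrightarrow>
       continuous_on (cball 0 2) u \<Longrightarrow> (\<And>x. x \<in> cball 0 2 \<Longrightarrow> 0 \<le> u x) \<Longrightarrow>
       (\<exists>x\<in>cball 0 1. u x \<le> 1) \<Longrightarrow> \<exists>x\<in>cball 0 (1 / 8). u x \<le> M"
proof
  \<comment> \<open>On \<open>|x| \<ge> 1 / 8\<close> the convex part contributes \<open>l s\<^sup>2 / 128\<close> and the concave part \<open>2 D s\<close>; this \<open>s\<close> makes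
    the difference equal to \<open>s\<close>.\<close>
  define s where "s = 128 * (2 * D + 1) / l"
  have s: "0 < s" using l D by (simp add: s_def)
  have gap: "0 < exp (- s) - exp (- 4 * s)" using s by simp
  \<comment> \<open>Normalization: the barrier is at least 2 on the unit ball, and vanishes at radius 2.\<close>
  define A where "A = 2 / (exp (- s) - exp (- 4 * s))"
  have "exp (- s) - exp (- 4 * s) \<le> 1" using s by (smt (verit) exp_gt_zero exp_le_one_iff)
  then have A1: "1 \<le> A" using gap by (simp add: A_def field_simps)
  show "1 \<le> A" by (rule A1)
  show "0 < 2 * s * A * exp (- 4 * s) / 8" "0 < A * exp (- 4 * s) * s / 2" using s A1 by auto
  fix u :: "'a \<Rightarrow> real" and S
  assume sup: "supersol l D (2 * s * A * exp (- 4 * s) / 8) (A * exp (- 4 * s) * s / 2) S u"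
    and S: "cball 0 2 \<subseteq> S" and u: "continuous_on (cball 0 2) u"
    and pos: "\<And>x. x \<in> cball 0 2 \<Longrightarrow> 0 \<le> u x" and ex: "\<exists>x\<in>cball 0 1. u x \<le> 1"
  define w where "w x = A * (exp (- s * (norm x)\<^sup>2) - exp (- 4 * s))" for x :: 'a
  show "\<exists>x\<in>cball 0 (1 / 8). u x \<le> A"
  proof (rule ccontr)
    assume no: "\<not> ?thesis"
    have "continuous_on (cball 0 2) (\<lambda>x. u x - w x)" unfolding w_def by (intro continuous_intros u)
    then obtain x where x: "x \<in> cball 0 2" "\<And>y. y \<in> cball 0 2 \<Longrightarrow> u x - w x \<le> u y - w y"
      using continuous_attains_inf[of "cball 0 2" "\<lambda>x. u x - w x"] by auto
    obtain x1 where x1: "x1 \<in> cball 0 1" "u x1 \<le> 1" using ex by blast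
    have "exp (- s) \<le> exp (- s * (norm x1)\<^sup>2)"
      using x1(1) s power_le_one[of "norm x1" 2] by simp
    then have "A * (exp (- s) - exp (- 4 * s)) \<le> w x1" unfolding w_def using A1 by (intro mult_left_mono) auto
    moreover have "A * (exp (- s) - exp (- 4 * s)) = 2"
      unfolding A_def using gap by (intro nonzero_eq_divide_eq[THEN iffD1]) auto
    ultimately have "2 \<le> w x1" by simp
    then have neg: "u x < w x" using x(2)[of x1] x1 by auto
    have "norm x \<noteq> 2"
    proof
      assume "norm x = 2"
      then have "w x = 0" by (simp add: w_def)
      then show False using neg pos[OF x(1)] by simp
    qed
    then have x2: "norm x < 2" using x(1) by simp
    have wA: "w x \<le> A"
    proof -
      have "exp (- s * (norm x)\<^sup>2) \<le> 1" using s by simp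
      then have "exp (- s * (norm x)\<^sup>2) - exp (- 4 * s) \<le> 1" using exp_gt_zero[of "- 4 * s"] by linarith
      then have "A * (exp (- s * (norm x)\<^sup>2) - exp (- 4 * s)) \<le> A * 1" using A1 by (intro mult_left_mono) auto
      then show ?thesis by (simp add: w_def)
    qed
    have x8: "1 / 8 < norm x"
    proof (rule ccontr)
      assume "\<not> ?thesis"
      then have "x \<in> cball 0 (1 / 8)" by simp
      then have "A < u x" using no by (meson not_le)
      with neg wA show False by simp
    qed
    define E where "E = A * exp (- s * (norm x)\<^sup>2)"
    have E: "A * exp (- 4 * s) \<le> E"
    proof -
      have "(norm x)\<^sup>2 \<le> 2\<^sup>2" using x2 by (intro power_mono) auto
      then have "s * (norm x)\<^sup>2 \<le> s * 4" using s by (intro mult_left_mono) auto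
      then show ?thesis using A1 by (simp add: E_def)
    qed
    have E0: "0 < E" using A1 by (simp add: E_def)
    define v where "v = (1 / norm x) *\<^sub>R x"
    define p where "p = (- 2 * s * E) *\<^sub>R x"
    define b where "b = E * s\<^sup>2 / 2 * (norm x)\<^sup>2"
    define a where "a = 2 * s * E"
    have xp: "norm x > 0" using x8 by linarith
    have "\<forall>\<^sub>F y in nhds x. y \<in> ball 0 2" by (rule eventually_nhds_in_open) (use x2 in auto)
    then have "\<forall>\<^sub>F y in nhds x. u x + p \<bullet> (y - x) + b * (v \<bullet> (y - x))\<^sup>2 - a * (norm (y - x))\<^sup>2 \<le> u y"
      using gaussian_ge_quadratic[OF s, of x]
    proof eventually_elim
      case (elim y)
      have "E * (1 - 2 * s * (x \<bullet> (y - x)) + s\<^sup>2 / 2 * (x \<bullet> (y - x))\<^sup>2 - 2 * s * (norm (y - x))\<^sup>2)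
        \<le> A * exp (- s * (norm y)\<^sup>2)"
        unfolding E_def mult.assoc[of A] using elim(2) A1 by (intro mult_left_mono) auto
      then have "E - E * (2 * s * (x \<bullet> (y - x))) + E * (s\<^sup>2 / 2 * (x \<bullet> (y - x))\<^sup>2)
          - E * (2 * s * (norm (y - x))\<^sup>2) \<le> A * exp (- s * (norm y)\<^sup>2)"
        by (simp only: right_diff_distrib distrib_left mult_1_right)
      moreover have "w x = E - A * exp (- 4 * s)" "w y = A * exp (- s * (norm y)\<^sup>2) - A * exp (- 4 * s)"
        by (simp_all add: w_def E_def right_diff_distrib)
      moreover have "b * (v \<bullet> (y - x))\<^sup>2 = E * (s\<^sup>2 / 2 * (x \<bullet> (y - x))\<^sup>2)"
        using xp by (simp add: b_def v_def power_divide)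
      moreover have "p \<bullet> (y - x) = - (E * (2 * s * (x \<bullet> (y - x))))" by (simp add: p_def)
      moreover have "a * (norm (y - x))\<^sup>2 = E * (2 * s * (norm (y - x))\<^sup>2)" by (simp add: a_def)
      ultimately have "w x + p \<bullet> (y - x) + b * (v \<bullet> (y - x))\<^sup>2 - a * (norm (y - x))\<^sup>2 \<le> w y"
        by linarith
      moreover have "u x - w x \<le> u y - w y" using x(2)[of y] elim(1) by simp
      ultimately show ?case by linarith
    qed
    then have "l * b - D * a \<le> A * exp (- 4 * s) * s / 2"
    proof (intro supersolD[OF sup, where p = p and v = v])
      show "x \<in> S" using x(1) S by blast
      show "norm v = 1" using xp by (simp add: v_def)
      show "0 \<le> a" "0 \<le> b" using s E0 by (auto simp: a_def b_def)
      have "(2 * s * (A * exp (- 4 * s))) * (1 / 8) \<le> (2 * s * E) * norm x"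
        using s E x8 E0 A1 by (intro mult_mono) auto
      then show "2 * s * A * exp (- 4 * s) / 8 \<le> norm p" using s E0 by (simp add: p_def mult.assoc)
    qed
    moreover have "E * s \<le> l * b - D * a"
    proof -
      have "(1 / 8)\<^sup>2 \<le> (norm x)\<^sup>2" using x8 by (intro power_mono) auto
      then have "1 / 64 \<le> (norm x)\<^sup>2" by (simp add: power2_eq_square)
      then have "(l * E * s\<^sup>2 / 2) * (1 / 64) \<le> (l * E * s\<^sup>2 / 2) * (norm x)\<^sup>2"
        using l E0 by (intro mult_left_mono) auto
      moreover have "(l * E * s\<^sup>2 / 2) * (1 / 64) = E * s * (l * s / 128)" by (simp add: power2_eq_square)
      moreover have "l * s / 128 = 2 * D + 1" using l by (simp add: s_def)
      ultimately show ?thesis by (simp add: b_def a_def algebra_simps)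
    qed
    moreover have "A * exp (- 4 * s) * s / 2 < E * s"
    proof -
      have "A * exp (- 4 * s) * s \<le> E * s" using E s by (intro mult_right_mono) auto
      moreover have "0 < E * s" using E0 s by simp
      ultimately show ?thesis by linarith
    qed
    ultimately show False by linarith
  qed
qed

text \<open>A point of the unit ball where \<open>u\<close> is small produces, by the barrier, a point in the ball of
radius 1/8 where \<open>u\<close> is bounded, and the cusps turn that point into a set of positive measure.\<close>
lemma point_to_measure:
  assumes l: "0 < l" and D: "0 \<le> (D::real)"
  obtains M \<mu> \<gamma>0 \<kappa>0 where "1 < M" "0 < \<mu>" "\<mu> < 1" "0 < \<gamma>0" "0 < \<kappa>0"
    "\<And>(u :: 'a::euclidean_space \<Rightarrow> real) S. supersol l D \<gamma>0 \<kappa>0 S u \<Longrightarrow> cball 0 2 \<subseteq> S \<Longrightarrow>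
       continuous_on (cball 0 2) u \<Longrightarrow> (\<And>x. x \<in> cball 0 2 \<Longrightarrow> 0 \<le> u x) \<Longrightarrow>
       (\<exists>x\<in>cball 0 1. u x \<le> 1) \<Longrightarrow>
       \<mu> * vol (ball 0 1 :: 'a set) \<le> vol {x \<in> ball 0 1. u x \<le> M}"
proof -
  obtain M1 \<gamma>1 \<kappa>1 where b: "1 \<le> M1" "0 < \<gamma>1" "0 < \<kappa>1"
    "\<And>(u :: 'a::euclidean_space \<Rightarrow> real) S. supersol l D \<gamma>1 \<kappa>1 S u \<Longrightarrow> cball 0 2 \<subseteq> S \<Longrightarrow>
       continuous_on (cball 0 2) u \<Longrightarrow> (\<And>x. x \<in> cball 0 2 \<Longrightarrow> 0 \<le> u x) \<Longrightarrow>
       (\<exists>x\<in>cball 0 1. u x \<le> 1) \<Longrightarrow> \<exists>x\<in>cball 0 (1 / 8). u x \<le> M1"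
    by (rule barrier[OF l D, where 'a = 'a]) blast
  define \<beta> where "\<beta> = (6 * D + 2) / l + 1"
  define c where "c = 1 + (5 * (1 + 42 * \<beta>\<^sup>2)) ^ DIM('a)"
  have c: "1 \<le> c" by (simp add: c_def)
  define \<mu> where "\<mu> = (1 / 8) ^ DIM('a) / c"
  define \<gamma>0 where "\<gamma>0 = min \<gamma>1 (1 / 2)"
  define \<kappa>0 where "\<kappa>0 = min \<kappa>1 (1 / 2)"
  have gk: "0 < \<gamma>0" "0 < \<kappa>0" using b by (auto simp: \<gamma>0_def \<kappa>0_def)
  show thesis
  proof (rule that[of "5 / 2 * M1" \<mu> \<gamma>0 \<kappa>0])
    show "1 < 5 / 2 * M1" using b by simp
    show "0 < \<mu>" using c by (simp add: \<mu>_def)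
    have "(1 / 8 :: real) ^ DIM('a) < 1" by (intro power_Suc_less_one[of "1/8", THEN less_le_trans] power_less_one_iff[THEN iffD2]) auto
    then show "\<mu> < 1" using c by (simp add: \<mu>_def)
    show "0 < \<gamma>0" "0 < \<kappa>0" by fact+
    fix u :: "'a \<Rightarrow> real" and S
    assume sup: "supersol l D \<gamma>0 \<kappa>0 S u" and S: "cball 0 2 \<subseteq> S" and u: "continuous_on (cball 0 2) u"
      and pos: "\<And>x. x \<in> cball 0 2 \<Longrightarrow> 0 \<le> u x" and ex: "\<exists>x\<in>cball 0 1. u x \<le> 1"
    have "supersol l D \<gamma>1 \<kappa>1 S u" by (rule supersol_mono[OF sup]) (auto simp: \<gamma>0_def \<kappa>0_def)
    from b(4)[OF this S u pos ex] obtain z where z: "z \<in> cball 0 (1 / 8)" "u z \<le> M1" by blast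
    have "supersol l D (\<gamma>0 * 1 / M1) (\<kappa>0 * 1\<^sup>2 / M1) {x. 0 + 1 *\<^sub>R x \<in> S} (\<lambda>x. (u (0 + 1 *\<^sub>R x) + 0) / M1)"
      by (rule supersol_rescale[OF sup]) (use b in auto)
    then have sup': "supersol l D (\<gamma>0 / M1) (\<kappa>0 / M1) S (\<lambda>x. u x / M1)" by simp
    have "\<gamma>0 / M1 \<le> \<gamma>0" "\<kappa>0 / M1 \<le> \<kappa>0"
      using b gk mult_left_mono[of 1 M1 \<gamma>0] mult_left_mono[of 1 M1 \<kappa>0] by (auto simp: field_simps)
    then have le: "\<gamma>0 / M1 \<le> 1 / 2" "\<kappa>0 / M1 \<le> 1 / 2"
      by (auto simp: \<gamma>0_def \<kappa>0_def)
    have "vol (ball 0 1 :: 'a set) * (1 / 8) ^ DIM('a) \<le> c * vol {x \<in> ball 0 1. u x / M1 \<le> 5 / 2}"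
      unfolding c_def
    proof (rule vol_sublevel_ge[OF l D \<beta>_def sup' le])
      show "continuous_on (cball 0 1) (\<lambda>x. u x / M1)"
        using b by (intro continuous_intros continuous_on_subset[OF u]) auto
      show "cball 0 1 \<subseteq> S" using S by (auto simp: subset_eq)
    qed (use pos b z in auto)
    moreover have "{x \<in> ball 0 1. u x / M1 \<le> 5 / 2} = {x \<in> ball 0 1. u x \<le> 5 / 2 * M1}"
      using b by (auto simp: field_simps)
    ultimately show "\<mu> * vol (ball 0 1 :: 'a set) \<le> vol {x \<in> ball 0 1. u x \<le> 5 / 2 * M1}"
      using c by (simp add: \<mu>_def field_simps)
  qed
qed

section \<open>Growing ink spots\<close>

lemma continuous_on_dominated_variation:
  fixes g h :: "real \<Rightarrow> real"
  assumes h: "continuous_on S h" and le: "\<And>s t. s \<in> S \<Longrightarrow> t \<in> S \<Longrightarrow> s \<le> t \<Longrightarrow> \<bar>g t - g s\<bar> \<le> h t - h s"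
  shows "continuous_on S g"
  unfolding continuous_on_iff
proof (intro ballI allI impI)
  fix x e :: real assume x: "x \<in> S" and e: "0 < e"
  obtain d where d: "d > 0" "\<And>y. y \<in> S \<Longrightarrow> dist y x < d \<Longrightarrow> dist (h y) (h x) < e"
    using h x e unfolding continuous_on_iff by blast
  have "dist (g y) (g x) < e" if "y \<in> S" "dist y x < d" for y
  proof -
    have "\<bar>g y - g x\<bar> \<le> \<bar>h y - h x\<bar>"
      using le[OF x that(1)] le[OF that(1) x] by (cases "x \<le> y") auto
    then show ?thesis using d(2)[OF that] by (simp add: dist_real_def)
  qed
  then show "\<exists>d>0. \<forall>x'\<in>S. dist x' x < d \<longrightarrow> dist (g x') (g x) < e" using d(1) by blast
qed

text \<open>Near \<open>x\<close> the open set \<open>E\<close> has density 1, in the unit ball it has density at most \<open>1 - \<mu>\<close>. The balls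
\<open>B t\<close> interpolate between a small ball at \<open>x\<close> and the unit ball and stay in it, so some
intermediate ball has density exactly \<open>1 - \<mu>\<close>.\<close>
lemma ball_with_density:
  fixes E :: "'a::euclidean_space set"
  assumes E: "E \<in> lmeasurable" "E \<subseteq> ball 0 1" "open E" and x: "x \<in> E"
    and \<mu>: "0 < \<mu>" and small: "vol E \<le> (1 - \<mu>) * vol (ball 0 1 :: 'a set)"
  shows "\<exists>c r. 0 < r \<and> r \<le> 1 \<and> ball c r \<subseteq> ball 0 1 \<and> x \<in> ball c r \<and>
     vol (E \<inter> ball c r) = (1 - \<mu>) * vol (ball c r)"
proof -
  obtain e where e: "0 < e" "ball x e \<subseteq> E" using E(3) x open_contains_ball by metis
  have xe: "norm x + e \<le> 1"
  proof -
    have "ball x e \<subseteq> ball 0 1" using e E by blast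
    then show ?thesis using e(1) by (simp add: ball_subset_ball_iff)
  qed
  define c where "c t = (1 - t) *\<^sub>R x" for t :: real
  define r where "r t = (1 - t) * e + t" for t :: real
  define B where "B t = ball (c t) (r t)" for t
  have r0: "0 < r t" if "t \<in> {0..1}" for t
    using that e unfolding r_def by (cases "t = 0") (auto intro: add_nonneg_pos)
  have nested: "B s \<subseteq> B t" if "s \<in> {0..1}" "t \<in> {0..1}" "s \<le> t" for s t
  proof -
    have "norm (c s - c t) = (t - s) * norm x"
      using that by (simp add: c_def scaleR_left_diff_distrib[symmetric])
    also have "\<dots> \<le> (t - s) * (1 - e)" using that xe by (intro mult_left_mono) auto
    also have "\<dots> = r t - r s" by (simp add: r_def algebra_simps)
    finally show ?thesis
      unfolding B_def by (simp add: ball_subset_ball_iff dist_norm)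
  qed
  define h where "h t = vol (B t)" for t
  define g where "g t = vol (E \<inter> B t)" for t
  have h: "h t = vol (ball 0 1 :: 'a set) * r t ^ DIM('a)" if "t \<in> {0..1}" for t
    using vol_ball[of "r t" "c t"] r0[OF that] by (simp add: h_def B_def)
  have ch: "continuous_on {0..1} h"
    by (rule continuous_on_eq[of _ "\<lambda>t. vol (ball 0 1 :: 'a set) * r t ^ DIM('a)"])
       (auto simp: h r_def intro!: continuous_intros)
  have Bm: "B t \<in> lmeasurable" for t by (simp add: B_def)
  have "continuous_on {0..1} g"
  proof (rule continuous_on_dominated_variation[OF ch])
    fix s t :: real assume st: "s \<in> {0..1}" "t \<in> {0..1}" "s \<le> t"
    have m: "E \<inter> B t \<in> lmeasurable" for t by (intro fmeasurable_Int_fmeasurable E(1) fmeasurableD Bm)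
    have ms: "E \<inter> B t \<in> sets lebesgue" "B t \<in> sets lebesgue" for t using m Bm by (auto intro: fmeasurableD)
    have "g s \<le> g t" unfolding g_def
      using nested[OF st] by (intro measure_mono_fmeasurable ms m) auto
    moreover have "g t - g s = vol (E \<inter> B t - E \<inter> B s)" unfolding g_def
      using nested[OF st] by (intro measurable_measure_Diff[symmetric] m ms) auto
    moreover have "h t - h s = vol (B t - B s)" unfolding h_def
      by (intro measurable_measure_Diff[symmetric] Bm ms nested[OF st])
    moreover have "vol (E \<inter> B t - E \<inter> B s) \<le> vol (B t - B s)"
      by (intro measure_mono_fmeasurable) (auto intro: ms sets.Diff fmeasurable_Diff Bm)
    ultimately show "\<bar>g t - g s\<bar> \<le> h t - h s" by simp
  qed
  then have "continuous_on {0..1} (\<lambda>t. g t - (1 - \<mu>) * h t)" by (intro continuous_intros ch)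
  moreover have "g 1 - (1 - \<mu>) * h 1 \<le> 0"
  proof -
    have "B 1 = ball 0 1" by (simp add: B_def c_def r_def)
    then show ?thesis using small E(2) by (simp add: g_def h_def Int_absorb2 del: measure_completion)
  qed
  moreover have "0 \<le> g 0 - (1 - \<mu>) * h 0"
  proof -
    have "E \<inter> B 0 = B 0" using e by (auto simp: B_def c_def r_def)
    then have "g 0 - (1 - \<mu>) * h 0 = \<mu> * h 0" by (simp add: g_def h_def algebra_simps del: measure_completion)
    then show ?thesis using \<mu> by (simp add: h_def)
  qed
  ultimately obtain t where t: "0 \<le> t" "t \<le> 1" "g t - (1 - \<mu>) * h t = 0"
    using IVT2'[of "\<lambda>t. g t - (1 - \<mu>) * h t" 1 0 0] by auto
  show ?thesis
  proof (intro exI conjI)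
    show "0 < r t" using r0 t by simp
    show "r t \<le> 1"
    proof -
      have "(1 - t) * e \<le> (1 - t) * 1" using t xe norm_ge_zero[of x] by (intro mult_left_mono) linarith+
      then show ?thesis by (simp add: r_def)
    qed
    have "B t \<subseteq> B 1" using t by (intro nested) auto
    then show "ball (c t) (r t) \<subseteq> ball 0 1" by (simp add: B_def c_def r_def)
    have "x \<in> B 0" using e by (simp add: B_def c_def r_def)
    moreover have "B 0 \<subseteq> B t" using t by (intro nested) auto
    ultimately show "x \<in> ball (c t) (r t)" by (auto simp: B_def)
    show "vol (E \<inter> ball (c t) (r t)) = (1 - \<mu>) * vol (ball (c t) (r t))"
      using t(3) unfolding g_def h_def B_def by linarith
  qed
qed

text \<open>In each ball of critical density the part outside \<open>E\<close> fills the fraction \<open>\<mu>\<close> and belongs to \<open>F\<close>.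
Summing over a disjoint Vitali subfamily shows that \<open>F\<close> is larger than \<open>E\<close> by a definite factor.\<close>
lemma growing_ink_spots:
  fixes E F :: "'a::euclidean_space set"
  assumes E: "E \<in> lmeasurable" "E \<subseteq> ball 0 1" "open E" and F: "F \<in> lmeasurable"
    and \<mu>: "0 < \<mu>" and small: "vol E \<le> (1 - \<mu>) * vol (ball 0 1 :: 'a set)"
    and grow: "\<And>c r. 0 < r \<Longrightarrow> r \<le> 1 \<Longrightarrow> ball c r \<subseteq> ball 0 1 \<Longrightarrow>
        vol (E \<inter> ball c r) = (1 - \<mu>) * vol (ball c r) \<Longrightarrow> ball c r \<subseteq> F"
  shows "vol E \<le> vol F / (1 + \<mu> / 5 ^ DIM('a))"
proof -
  let ?N = "DIM('a)"
  define K where "K = {z :: 'a \<times> real. 0 < snd z \<and> snd z \<le> 1 \<and> ball (fst z) (snd z) \<subseteq> ball 0 1 \<and>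
      vol (E \<inter> ball (fst z) (snd z)) = (1 - \<mu>) * vol (ball (fst z) (snd z))}"
  have cov: "E \<subseteq> (\<Union>z\<in>K. ball (fst z) (snd z))"
  proof
    fix x assume "x \<in> E"
    from ball_with_density[OF E this \<mu> small] obtain c r where
      "0 < r \<and> r \<le> 1 \<and> ball c r \<subseteq> ball 0 1 \<and> x \<in> ball c r \<and> vol (E \<inter> ball c r) = (1 - \<mu>) * vol (ball c r)"
      by blast
    then show "x \<in> (\<Union>z\<in>K. ball (fst z) (snd z))" by (intro UN_I[of "(c, r)"]) (auto simp: K_def)
  qed
  have rK: "0 < snd z \<and> snd z \<le> 1" if "z \<in> K" for z using that by (simp add: K_def)
  have FK: "ball (fst z) (snd z) \<subseteq> F" if "z \<in> K" for z
    by (rule grow) (use that in \<open>auto simp: K_def\<close>)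
  obtain C where C: "countable C" "C \<subseteq> K"
      "pairwise (\<lambda>i j. disjnt (ball (fst i) (snd i)) (ball (fst j) (snd j))) C"
      "E \<subseteq> (\<Union>z\<in>C. ball (fst z) (5 * snd z))"
    by (rule Vitali_covering_lemma_balls[OF cov rK])
  have EF: "E \<subseteq> F" using cov FK by blast
  define B where "B z = ball (fst z) (snd z) - E" for z :: "'a \<times> real"
  have disj: "pairwise (\<lambda>i j. disjnt (B i) (B j)) C"
    using C(3) unfolding pairwise_def disjnt_def B_def by blast
  have BB: "B z \<in> lmeasurable \<and> B z \<subseteq> F - E" if "z \<in> C" for z
    using FK[of z] that C(2) E(1) by (auto simp: B_def intro!: fmeasurable_Diff fmeasurableD)
  have U: "F - E \<in> lmeasurable" using F E(1) by (intro fmeasurable_Diff fmeasurableD)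
  have AA: "ball (fst z) (5 * snd z) \<in> lmeasurable \<and>
      vol (ball (fst z) (5 * snd z)) \<le> (5 ^ ?N / \<mu>) * vol (B z)" if "z \<in> C" for z
  proof
    have z: "z \<in> K" using that C(2) by blast
    have "vol (ball (fst z) (snd z)) - vol (E \<inter> ball (fst z) (snd z)) = vol (ball (fst z) (snd z) - E \<inter> ball (fst z) (snd z))"
      using E(1) by (intro measurable_measure_Diff[symmetric]) (auto intro: fmeasurableD)
    moreover have "ball (fst z) (snd z) - E \<inter> ball (fst z) (snd z) = B z" by (auto simp: B_def)
    ultimately have "vol (B z) = \<mu> * vol (ball (fst z) (snd z))"
      using z by (simp add: K_def algebra_simps)
    moreover have "vol (ball (fst z) (5 * snd z)) = 5 ^ ?N * vol (ball (fst z) (snd z))"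
      using rK[OF z] by (simp add: vol_ball[of "snd z"] vol_ball[of "5 * snd z"] power_mult_distrib del: measure_completion)
    ultimately show "vol (ball (fst z) (5 * snd z)) \<le> (5 ^ ?N / \<mu>) * vol (B z)"
      using \<mu> by simp
  qed simp
  have "vol E \<le> vol (\<Union>z\<in>C. ball (fst z) (5 * snd z))"
    by (rule measure_mono_fmeasurable[OF C(4) fmeasurableD[OF E(1)]],
        rule vol_UN_le_of_disjoint(1)[OF C(1) _ disj BB U AA]) (use \<mu> in auto)
  also have "\<dots> \<le> (5 ^ ?N / \<mu>) * vol (F - E)"
    by (rule vol_UN_le_of_disjoint(2)[OF C(1) _ disj BB U AA]) (use \<mu> in auto)
  also have "vol (F - E) = vol F - vol E"
    by (rule measurable_measure_Diff[OF F fmeasurableD[OF E(1)] EF])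
  finally have "\<mu> / 5 ^ ?N * vol E \<le> vol F - vol E" using \<mu> by (simp add: field_simps)
  moreover have "0 < 1 + \<mu> / 5 ^ ?N" using \<mu> by (simp add: add_pos_pos)
  ultimately show ?thesis by (simp add: pos_le_divide_eq distrib_left mult.commute)
qed

section \<open>Decay of oscillation and the Hoelder estimate\<close>

text \<open>The superlevel sets of the powers of \<open>M\<close> shrink geometrically: in a ball where the next superlevel
set is too dense, the rescaled point-to-measure estimate forbids values below the previous
level. Only finitely many steps are taken, up to half of the unit ball.\<close>
lemma superlevel_set_small:
  assumes l: "0 < l" and D: "0 \<le> (D::real)"
  obtains M \<gamma>0 \<kappa>0 where "1 < M" "0 < \<gamma>0" "0 < \<kappa>0"
    "\<And>(u :: 'a::euclidean_space \<Rightarrow> real). supersol l D \<gamma>0 \<kappa>0 (ball 0 3) u \<Longrightarrow>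
       continuous_on (ball 0 3) u \<Longrightarrow> (\<And>x. x \<in> ball 0 3 \<Longrightarrow> 0 \<le> u x) \<Longrightarrow>
       (\<exists>x\<in>ball 0 1. u x \<le> 1) \<Longrightarrow> vol {x \<in> ball 0 1. M < u x} < vol (ball 0 1 :: 'a set) / 2"
proof -
  obtain M \<mu> \<gamma>0 \<kappa>0 where M: "1 < M" and \<mu>: "0 < \<mu>" "\<mu> < 1" and g: "0 < \<gamma>0" "0 < \<kappa>0"
    and pm: "\<And>(u :: 'a::euclidean_space \<Rightarrow> real) S. supersol l D \<gamma>0 \<kappa>0 S u \<Longrightarrow> cball 0 2 \<subseteq> S \<Longrightarrow>
       continuous_on (cball 0 2) u \<Longrightarrow> (\<And>x. x \<in> cball 0 2 \<Longrightarrow> 0 \<le> u x) \<Longrightarrow>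
       (\<exists>x\<in>cball 0 1. u x \<le> 1) \<Longrightarrow>
       \<mu> * vol (ball 0 1 :: 'a set) \<le> vol {x \<in> ball 0 1. u x \<le> M}"
    by (rule point_to_measure[OF l D, where 'a = 'a]) blast
  define q where "q = 1 / (1 + \<mu> / 2 / 5 ^ DIM('a))"
  have q: "0 < q" "q < 1" using \<mu> by (auto simp: q_def add_pos_pos)
  then obtain k0 where k0: "q ^ k0 < 1 / 2" using real_arch_pow_inv[of "1 / 2" q] by auto
  show thesis
  proof (rule that[of "M ^ Suc k0" \<gamma>0 \<kappa>0])
    show "1 < M ^ Suc k0" using M by (rule one_less_power) simp
    show "0 < \<gamma>0" "0 < \<kappa>0" by fact+
    fix u :: "'a \<Rightarrow> real"
    assume sup: "supersol l D \<gamma>0 \<kappa>0 (ball 0 3) u" and u: "continuous_on (ball 0 3) u"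
      and pos: "\<And>x. x \<in> ball 0 3 \<Longrightarrow> 0 \<le> u x" and ex: "\<exists>x\<in>ball 0 1. u x \<le> 1"
    define E where "E k = {x \<in> ball 0 1. M ^ k < u x}" for k
    have u1: "continuous_on (ball 0 1) u" by (rule continuous_on_subset[OF u]) auto
    have oE: "open (E k)" for k
    proof -
      have "open (ball 0 1 \<inter> u -` {M ^ k<..})" by (rule continuous_open_preimage[OF u1]) auto
      moreover have "ball 0 1 \<inter> u -` {M ^ k<..} = E k" by (auto simp: E_def)
      ultimately show ?thesis by simp
    qed
    have Eb: "E k \<subseteq> ball 0 1" for k by (auto simp: E_def)
    have mE: "E k \<in> lmeasurable" for k
      by (rule lmeasurable_open[OF bounded_subset[OF bounded_ball Eb] oE])
    have mono: "E k \<subseteq> E j" if "j \<le> k" for j k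
    proof -
      have "M ^ j \<le> M ^ k" using M that by (intro power_increasing) auto
      then show ?thesis by (auto simp: E_def)
    qed
    \<comment> \<open>The point-to-measure estimate for \<open>u / M ^ k\<close>, transplanted to a smaller ball.\<close>
    have key: "\<mu> * vol (ball c r) \<le> vol (ball c r) - vol (E (Suc k) \<inter> ball c r)"
      if r: "0 < r" "r \<le> 1" and B: "ball c r \<subseteq> ball 0 1" and x: "x \<in> ball c r" "u x \<le> M ^ k" for c r x k
    proof -
      have cr: "norm c + r \<le> 1" using B r by (simp add: ball_subset_ball_iff)
      define t where "t = M ^ k"
      have t: "1 \<le> t" using M by (simp add: t_def)
      define v where "v z = u (c + r *\<^sub>R z) / t" for z
      have S: "c + r *\<^sub>R z \<in> ball 0 3" if "z \<in> cball 0 2" for z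
      proof -
        have "norm (c + r *\<^sub>R z) \<le> norm c + r * norm z" using norm_triangle_ineq[of c "r *\<^sub>R z"] r by simp
        also have "\<dots> \<le> norm c + r * 2" using that r by (intro add_left_mono mult_left_mono) auto
        finally show ?thesis using cr r by simp
      qed
      have s0: "supersol l D (\<gamma>0 * r / t) (\<kappa>0 * r\<^sup>2 / t) {z. c + r *\<^sub>R z \<in> ball 0 3} v"
        using supersol_rescale[OF sup r(1), of t c 0] t by (simp add: v_def[abs_def])
      have "\<gamma>0 * r / t \<le> \<gamma>0 * 1 / 1" using g r t by (intro frac_le mult_left_mono) auto
      moreover have "\<kappa>0 * r\<^sup>2 / t \<le> \<kappa>0 * 1 / 1"
        using g r t by (intro frac_le mult_left_mono) (auto simp: power_le_one)
      ultimately have sv: "supersol l D \<gamma>0 \<kappa>0 {z. c + r *\<^sub>R z \<in> ball 0 3} v"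
        by (intro supersol_mono[OF s0]) auto
      have "\<mu> * vol (ball 0 1 :: 'a set) \<le> vol {z \<in> ball 0 1. v z \<le> M}"
      proof (rule pm[OF sv])
        show "cball 0 2 \<subseteq> {z. c + r *\<^sub>R z \<in> ball 0 3}" using S by blast
        show "continuous_on (cball 0 2) v"
          unfolding v_def using S t by (intro continuous_intros continuous_on_compose2[OF u]) auto
        show "0 \<le> v z" if "z \<in> cball 0 2" for z using pos[OF S[OF that]] t by (simp add: v_def)
        show "\<exists>z\<in>cball 0 1. v z \<le> 1"
        proof (rule bexI[of _ "(1 / r) *\<^sub>R (x - c)"])
          show "v ((1 / r) *\<^sub>R (x - c)) \<le> 1" using r x(2) t by (simp add: v_def t_def)
          have "norm (x - c) \<le> r" using x(1) by (simp add: dist_norm norm_minus_commute)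
          then have "norm ((1 / r) *\<^sub>R (x - c)) \<le> 1" unfolding norm_scaleR using r by (simp add: field_simps)
          then show "(1 / r) *\<^sub>R (x - c) \<in> cball 0 1" by simp
        qed
      qed
      then have "r ^ DIM('a) * (\<mu> * vol (ball 0 1 :: 'a set)) \<le> r ^ DIM('a) * vol {z \<in> ball 0 1. v z \<le> M}"
        using r by (intro mult_left_mono) auto
      also have "\<dots> = vol ((\<lambda>z. r *\<^sub>R z + c) ` {z \<in> ball 0 1. v z \<le> M})"
        using r by (subst measure_lebesgue_affine) simp
      also have "(\<lambda>z. r *\<^sub>R z + c) ` {z \<in> ball 0 1. v z \<le> M} = ball c r - E (Suc k) \<inter> ball c r"
      proof (intro equalityI subsetI)
        fix y assume "y \<in> (\<lambda>z. r *\<^sub>R z + c) ` {z \<in> ball 0 1. v z \<le> M}"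
        then obtain z where z: "norm z < 1" "v z \<le> M" "y = c + r *\<^sub>R z" by (auto simp: add.commute)
        have "u y \<le> M ^ Suc k" using z t by (simp add: v_def t_def field_simps)
        moreover have "y \<in> ball c r" using z r by (simp add: dist_norm)
        ultimately show "y \<in> ball c r - E (Suc k) \<inter> ball c r" by (auto simp: E_def)
      next
        fix y assume "y \<in> ball c r - E (Suc k) \<inter> ball c r"
        then have y: "y \<in> ball c r" "u y \<le> M ^ Suc k" using B by (auto simp: E_def)
        show "y \<in> (\<lambda>z. r *\<^sub>R z + c) ` {z \<in> ball 0 1. v z \<le> M}"
        proof (rule image_eqI[of _ _ "(1 / r) *\<^sub>R (y - c)"])
          show "y = r *\<^sub>R (1 / r) *\<^sub>R (y - c) + c" using r by simp
          have "norm (y - c) < r" using y(1) by (simp add: dist_norm norm_minus_commute)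
          then have "norm ((1 / r) *\<^sub>R (y - c)) < 1" unfolding norm_scaleR using r by (simp add: field_simps)
          moreover have "v ((1 / r) *\<^sub>R (y - c)) \<le> M" using r y(2) t by (simp add: v_def t_def field_simps)
          ultimately show "(1 / r) *\<^sub>R (y - c) \<in> {z \<in> ball 0 1. v z \<le> M}" by simp
        qed
      qed
      also have "vol (ball c r - E (Suc k) \<inter> ball c r) = vol (ball c r) - vol (E (Suc k) \<inter> ball c r)"
        by (rule measurable_measure_Diff) (auto intro!: fmeasurableD fmeasurable_Int_fmeasurable mE)
      finally show ?thesis using r by (simp add: vol_ball[of r] mult_ac del: measure_completion)
    qed
    have small: "vol (E (Suc k)) \<le> (1 - \<mu>) * vol (ball 0 1 :: 'a set)" for k
    proof -
      obtain x where x: "x \<in> ball 0 1" "u x \<le> 1" using ex by blast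
      have "1 \<le> M ^ k" using M by simp
      then have "u x \<le> M ^ k" using x(2) by linarith
      with key[of 1 0 x k] x(1) Eb show ?thesis by (simp add: Int_absorb2 algebra_simps del: measure_completion)
    qed
    have step: "vol (E (Suc k)) \<le> vol (E k) * q" for k
    proof -
      have "vol (E (Suc k)) \<le> vol (E k) / (1 + \<mu> / 2 / 5 ^ DIM('a))"
      proof (rule growing_ink_spots[OF mE Eb oE mE])
        show "0 < \<mu> / 2" using \<mu> by simp
        have "(1 - \<mu>) * vol (ball 0 1 :: 'a set) \<le> (1 - \<mu> / 2) * vol (ball 0 1 :: 'a set)"
          using \<mu> by (intro mult_right_mono) auto
        then show "vol (E (Suc k)) \<le> (1 - \<mu> / 2) * vol (ball 0 1 :: 'a set)" using small[of k] by linarith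
        fix c :: 'a and r :: real
        assume r: "0 < r" "r \<le> 1" and B: "ball c r \<subseteq> ball 0 1"
          and eq: "vol (E (Suc k) \<inter> ball c r) = (1 - \<mu> / 2) * vol (ball c r)"
        have vp: "0 < vol (ball c r)" using r by simp
        show "ball c r \<subseteq> E k"
        proof (rule ccontr)
          assume "\<not> ?thesis"
          then obtain x where xE: "x \<in> ball c r" "x \<notin> E k" by blast
          then have x: "x \<in> ball c r" "u x \<le> M ^ k" using B by (auto simp: E_def)
          have "\<mu> * vol (ball c r) \<le> \<mu> / 2 * vol (ball c r)"
            using key[OF r B x] unfolding eq by (simp add: algebra_simps del: measure_completion)
          moreover have "0 < \<mu> * vol (ball c r)" using \<mu> vp by simp
          ultimately show False by linarith
        qed
      qed
      then show ?thesis by (simp add: q_def del: measure_completion)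
    qed
    have "vol (E (Suc k)) \<le> q ^ k * vol (ball 0 1 :: 'a set)" for k
    proof (induction k)
      case 0
      have "(1 - \<mu>) * vol (ball 0 1 :: 'a set) \<le> 1 * vol (ball 0 1 :: 'a set)"
        using \<mu> by (intro mult_right_mono) auto
      with small[of 0] have "vol (E (Suc 0)) \<le> 1 * vol (ball 0 1 :: 'a set)" by (rule order_trans)
      then show ?case by simp
    next
      case (Suc k)
      have "vol (E (Suc (Suc k))) \<le> vol (E (Suc k)) * q" by (rule step)
      also have "\<dots> \<le> (q ^ k * vol (ball 0 1 :: 'a set)) * q" using Suc q by (intro mult_right_mono) auto
      finally show ?case by (simp add: mult_ac)
    qed
    from this[of k0] have "vol (E (Suc k0)) \<le> q ^ k0 * vol (ball 0 1 :: 'a set)" .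
    also have "\<dots> < 1 / 2 * vol (ball 0 1 :: 'a set)"
      using k0 vol_unit_pos by (rule mult_strict_right_mono)
    finally show "vol {x \<in> ball 0 1. M ^ Suc k0 < u x} < vol (ball 0 1 :: 'a set) / 2"
      by (simp add: E_def)
  qed
qed

text \<open>With \<open>m\<close> the infimum, one of \<open>u - m\<close> and \<open>m + 1 - u\<close> exceeds 1/3 on at least half of the unit ball, since
their sum is 1; that one cannot come close to 0 anywhere in the unit ball.\<close>
lemma oscillation_decay:
  assumes l: "0 < l" and D: "0 \<le> (D::real)"
  obtains \<theta> \<gamma>0 \<kappa>0 where "0 < \<theta>" "\<theta> \<le> 1 / 3" "0 < \<gamma>0" "0 < \<kappa>0"
    "\<And>(u :: 'a::euclidean_space \<Rightarrow> real) x y. supersol l D \<gamma>0 \<kappa>0 (ball 0 3) u \<Longrightarrow>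
       supersol l D \<gamma>0 \<kappa>0 (ball 0 3) (\<lambda>x. - u x) \<Longrightarrow> continuous_on (ball 0 3) u \<Longrightarrow>
       (\<And>x y. x \<in> ball 0 3 \<Longrightarrow> y \<in> ball 0 3 \<Longrightarrow> u x - u y \<le> 1) \<Longrightarrow>
       x \<in> ball 0 1 \<Longrightarrow> y \<in> ball 0 1 \<Longrightarrow> u x - u y \<le> 1 - \<theta>"
proof -
  obtain M \<gamma>1 \<kappa>1 where M: "1 < M" and g1: "0 < \<gamma>1" "0 < \<kappa>1" and small:
    "\<And>(u :: 'a::euclidean_space \<Rightarrow> real). supersol l D \<gamma>1 \<kappa>1 (ball 0 3) u \<Longrightarrow>
       continuous_on (ball 0 3) u \<Longrightarrow> (\<And>x. x \<in> ball 0 3 \<Longrightarrow> 0 \<le> u x) \<Longrightarrow>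
       (\<exists>x\<in>ball 0 1. u x \<le> 1) \<Longrightarrow> vol {x \<in> ball 0 1. M < u x} < vol (ball 0 1 :: 'a set) / 2"
    by (rule superlevel_set_small[OF l D, where 'a = 'a]) blast
  define \<theta> where "\<theta> = 1 / (3 * M)"
  have th: "0 < \<theta>" "\<theta> \<le> 1 / 3" using M by (auto simp: \<theta>_def field_simps)
  show thesis
  proof (rule that[of \<theta> "\<gamma>1 * \<theta>" "\<kappa>1 * \<theta>"])
    show "0 < \<theta>" "\<theta> \<le> 1 / 3" "0 < \<gamma>1 * \<theta>" "0 < \<kappa>1 * \<theta>" using th g1 by auto
    have one: "\<theta> < w x + m"
      if sup: "supersol l D (\<gamma>1 * \<theta>) (\<kappa>1 * \<theta>) (ball 0 3) w" and w: "continuous_on (ball 0 3) w"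
      and pos: "\<And>x. x \<in> ball 0 3 \<Longrightarrow> 0 \<le> w x + m"
      and big: "vol (ball 0 1 :: 'a set) / 2 \<le> vol {x \<in> ball 0 1. 1 / 3 < w x + m}" and x: "x \<in> ball 0 1"
      for w :: "'a \<Rightarrow> real" and m x
    proof (rule ccontr)
      assume "\<not> ?thesis"
      then have le: "w x + m \<le> \<theta>" by simp
      have "supersol l D (\<gamma>1 * \<theta> * 1 / \<theta>) (\<kappa>1 * \<theta> * 1\<^sup>2 / \<theta>) {x. 0 + 1 *\<^sub>R x \<in> ball 0 3} (\<lambda>x. (w (0 + 1 *\<^sub>R x) + m) / \<theta>)"
        by (rule supersol_rescale[OF sup]) (use th in auto)
      moreover have "{x. 0 + 1 *\<^sub>R x \<in> ball 0 3} = (ball 0 3 :: 'a set)" by auto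
      ultimately have s: "supersol l D \<gamma>1 \<kappa>1 (ball 0 3) (\<lambda>x. (w x + m) / \<theta>)" using th by simp
      have "vol {x \<in> ball 0 1. M < (w x + m) / \<theta>} < vol (ball 0 1 :: 'a set) / 2"
      proof (rule small[OF s])
        show "continuous_on (ball 0 3) (\<lambda>x. (w x + m) / \<theta>)" using th by (intro continuous_intros w) auto
      qed (use pos th le x in \<open>auto intro!: divide_nonneg_pos bexI[of _ x]\<close>)
      moreover have "(M < (w x + m) / \<theta>) = (1 / 3 < w x + m)" for x
        using M mult_less_cancel_left_pos[of M 1 "3 * (w x + m)"] by (simp add: \<theta>_def mult_ac)
      ultimately show False using big by simp
    qed
    fix u :: "'a \<Rightarrow> real" and x y :: 'a
    assume sup: "supersol l D (\<gamma>1 * \<theta>) (\<kappa>1 * \<theta>) (ball 0 3) u"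
      and sup': "supersol l D (\<gamma>1 * \<theta>) (\<kappa>1 * \<theta>) (ball 0 3) (\<lambda>x. - u x)"
      and u: "continuous_on (ball 0 3) u"
      and osc: "\<And>x y. x \<in> ball 0 3 \<Longrightarrow> y \<in> ball 0 3 \<Longrightarrow> u x - u y \<le> 1"
      and x: "x \<in> ball 0 1" and y: "y \<in> ball 0 1"
    define m where "m = Inf (u ` ball 0 3)"
    have bdd: "bdd_below (u ` ball 0 3)"
      by (rule bdd_belowI2[of _ "u 0 - 1"]) (use osc[of 0] in force)
    have lo: "m \<le> u z" if "z \<in> ball 0 3" for z
      unfolding m_def using that by (intro cInf_lower bdd) auto
    have hi: "u z - 1 \<le> m" if "z \<in> ball 0 3" for z
      unfolding m_def using osc[OF that] by (intro cInf_greatest) (auto simp: algebra_simps)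
    \<comment> \<open>The two superlevel sets cover the unit ball.\<close>
    let ?A = "{x \<in> ball 0 1. 1 / 3 < u x + - m}"
    let ?B = "{x \<in> ball 0 1. 1 / 3 < - u x + (m + 1)}"
    have u1: "continuous_on (ball 0 1) u" by (rule continuous_on_subset[OF u]) auto
    have "open (ball 0 1 \<inter> u -` {m + 1 / 3<..})" by (rule continuous_open_preimage[OF u1]) auto
    moreover have "open (ball 0 1 \<inter> u -` {..<m + 2 / 3})" by (rule continuous_open_preimage[OF u1]) auto
    moreover have "ball 0 1 \<inter> u -` {m + 1 / 3<..} = ?A" "ball 0 1 \<inter> u -` {..<m + 2 / 3} = ?B" by auto
    ultimately have op: "open ?A" "open ?B" by auto
    have ms: "?A \<in> lmeasurable" "?B \<in> lmeasurable"
      by (intro lmeasurable_open op bounded_subset[OF bounded_ball[of 0 1]]; auto)+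
    have "vol (ball 0 1 :: 'a set) \<le> vol (?A \<union> ?B)"
      by (rule measure_mono_fmeasurable) (use ms in \<open>auto intro: fmeasurable.Un\<close>)
    also have "\<dots> \<le> vol ?A + vol ?B" using ms by (intro measure_Un_le fmeasurableD)
    finally have "vol (ball 0 1 :: 'a set) / 2 \<le> vol ?A \<or> vol (ball 0 1 :: 'a set) / 2 \<le> vol ?B" by linarith
    then show "u x - u y \<le> 1 - \<theta>"
    proof
      assume A: "vol (ball 0 1 :: 'a set) / 2 \<le> vol ?A"
      have "\<theta> < u y + - m" by (rule one[OF sup u _ A y]) (use lo in auto)
      moreover have "u x - 1 \<le> m" using x by (intro hi) auto
      ultimately show ?thesis by linarith
    next
      assume B: "vol (ball 0 1 :: 'a set) / 2 \<le> vol ?B"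
      have "\<theta> < - u x + (m + 1)"
      proof (rule one[OF sup' _ _ B x])
        show "continuous_on (ball 0 3) (\<lambda>x. - u x)" by (intro continuous_intros u)
        show "0 \<le> - u z + (m + 1)" if "z \<in> ball 0 3" for z using hi[OF that] by simp
      qed
      moreover have "m \<le> u y" using y by (intro lo) auto
      ultimately show ?thesis by linarith
    qed
  qed
qed

text \<open>Iteration of the decay on balls shrinking by the factor 3. Because \<open>3 (1 - \<theta>) \<ge> 1\<close>, zooming in and
renormalizing the oscillation to 1 does not raise the gradient threshold.\<close>
lemma holder_estimate_normalized:
  assumes l: "0 < l" and D: "0 \<le> (D::real)"
  obtains \<alpha> \<gamma>0 \<kappa>0 where "0 < \<alpha>" "\<alpha> < 1" "0 < \<gamma>0" "0 < \<kappa>0"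
    "\<And>(u :: 'a::euclidean_space \<Rightarrow> real) x. supersol l D \<gamma>0 \<kappa>0 (ball 0 3) u \<Longrightarrow>
       supersol l D \<gamma>0 \<kappa>0 (ball 0 3) (\<lambda>x. - u x) \<Longrightarrow> continuous_on (ball 0 3) u \<Longrightarrow>
       (\<And>x y. x \<in> ball 0 3 \<Longrightarrow> y \<in> ball 0 3 \<Longrightarrow> u x - u y \<le> 1) \<Longrightarrow>
       x \<in> ball 0 3 \<Longrightarrow> \<bar>u x - u 0\<bar> \<le> 2 * (norm x / 3) powr \<alpha>"
proof -
  obtain \<theta> \<gamma>0 \<kappa>0 where th: "0 < \<theta>" "\<theta> \<le> 1 / 3" and g: "0 < \<gamma>0" "0 < \<kappa>0" and decay:
    "\<And>(u :: 'a::euclidean_space \<Rightarrow> real) x y. supersol l D \<gamma>0 \<kappa>0 (ball 0 3) u \<Longrightarrow>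
       supersol l D \<gamma>0 \<kappa>0 (ball 0 3) (\<lambda>x. - u x) \<Longrightarrow> continuous_on (ball 0 3) u \<Longrightarrow>
       (\<And>x y. x \<in> ball 0 3 \<Longrightarrow> y \<in> ball 0 3 \<Longrightarrow> u x - u y \<le> 1) \<Longrightarrow>
       x \<in> ball 0 1 \<Longrightarrow> y \<in> ball 0 1 \<Longrightarrow> u x - u y \<le> 1 - \<theta>"
    by (rule oscillation_decay[OF l D, where 'a = 'a]) blast
  define t where "t = 1 - \<theta>"
  have t: "2 / 3 \<le> t" "t < 1" using th by (auto simp: t_def)
  define \<alpha> where "\<alpha> = log (1 / 3) t"
  have al: "(1 / 3) powr \<alpha> = t" using t by (simp add: \<alpha>_def)
  show thesis
  proof (rule that[of \<alpha> \<gamma>0 \<kappa>0])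
    have "log (1 / 3) t = ln t / ln (1 / 3)" by (simp add: log_def)
    moreover have "ln t < 0" "ln (1 / 3) < (0 :: real)" "ln (1 / 3) < ln t" using t by (auto intro: ln_less_zero)
    ultimately show "0 < \<alpha>" "\<alpha> < 1" unfolding \<alpha>_def by (auto simp: divide_neg_neg neg_divide_less_eq)
    show "0 < \<gamma>0" "0 < \<kappa>0" by fact+
    fix u :: "'a \<Rightarrow> real" and x :: 'a
    assume sup: "supersol l D \<gamma>0 \<kappa>0 (ball 0 3) u"
      and sup': "supersol l D \<gamma>0 \<kappa>0 (ball 0 3) (\<lambda>x. - u x)"
      and u: "continuous_on (ball 0 3) u"
      and osc: "\<And>x y. x \<in> ball 0 3 \<Longrightarrow> y \<in> ball 0 3 \<Longrightarrow> u x - u y \<le> 1"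
      and x: "x \<in> ball 0 3"
    have it: "u y - u z \<le> t ^ k" if "y \<in> ball 0 (3 * (1 / 3) ^ k)" "z \<in> ball 0 (3 * (1 / 3) ^ k)" for k y z
      using that
    proof (induction k arbitrary: y z)
      case 0
      then show ?case using osc by simp
    next
      case (Suc k)
      define r where "r = (1 / 3 :: real) ^ k"
      define c where "c = t ^ k"
      have r: "0 < r" "r \<le> 1" by (auto simp: r_def power_le_one)
      have c: "0 < c" using t by (simp add: c_def)
      have rc: "r \<le> c" unfolding r_def c_def using t by (intro power_mono) auto
      define v where "v x = u (r *\<^sub>R x) / c" for x
      have v_eq: "(\<lambda>x. (u (0 + r *\<^sub>R x) + 0) / c) = v" "(\<lambda>x. (- u (0 + r *\<^sub>R x) + 0) / c) = (\<lambda>x. - v x)"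
        by (auto simp: v_def)
      have S: "r *\<^sub>R x \<in> ball 0 (3 * r)" if "x \<in> ball 0 3" for x :: 'a using that r by simp
      have S3: "r *\<^sub>R x \<in> ball 0 3" if "x \<in> ball 0 3" for x :: 'a
        using that r mult_mono[of r 1 "norm x" "norm x"] by simp
      have le: "\<gamma>0 * r / c \<le> \<gamma>0" "\<kappa>0 * r\<^sup>2 / c \<le> \<kappa>0"
      proof -
        show "\<gamma>0 * r / c \<le> \<gamma>0" using rc c g by (simp add: field_simps)
        have "r\<^sup>2 \<le> r" using r by (simp add: power2_eq_square mult_left_le)
        then have "r\<^sup>2 \<le> c" using rc by simp
        then show "\<kappa>0 * r\<^sup>2 / c \<le> \<kappa>0" using c g by (simp add: field_simps)
      qed
      have sv: "supersol l D \<gamma>0 \<kappa>0 (ball 0 3) v"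
        by (rule supersol_mono[OF supersol_rescale[OF sup r(1) c, of 0 0, unfolded v_eq(1)]]) (use le S3 in auto)
      have sv': "supersol l D \<gamma>0 \<kappa>0 (ball 0 3) (\<lambda>x. - v x)"
        by (rule supersol_mono[OF supersol_rescale[OF sup' r(1) c, of 0 0, unfolded v_eq(2)]]) (use le S3 in auto)
      have "v ((1 / r) *\<^sub>R y) - v ((1 / r) *\<^sub>R z) \<le> 1 - \<theta>"
      proof (rule decay[OF sv sv'])
        show "continuous_on (ball 0 3) v"
          unfolding v_def using c S3 by (intro continuous_intros continuous_on_compose2[OF u]) auto
        show "v a - v b \<le> 1" if "a \<in> ball 0 3" "b \<in> ball 0 3" for a b
          using Suc.IH[of "r *\<^sub>R a" "r *\<^sub>R b"] S[OF that(1)] S[OF that(2)] c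
          unfolding v_def diff_divide_distrib[symmetric] by (simp add: r_def c_def)
        show "(1 / r) *\<^sub>R y \<in> ball 0 1" "(1 / r) *\<^sub>R z \<in> ball 0 1"
          using Suc.prems r by (auto simp: r_def divide_less_eq)
      qed
      then show ?case using r c by (simp add: v_def diff_divide_distrib[symmetric] divide_le_eq t_def[symmetric] c_def)
    qed
    show "\<bar>u x - u 0\<bar> \<le> 2 * (norm x / 3) powr \<alpha>"
    proof (cases "x = 0")
      case False
      define y where "y = norm x / 3"
      have y: "0 < y" "y < 1" using x False by (auto simp: y_def)
      obtain n0 where n0: "(1 / 3) ^ n0 < y" using real_arch_pow_inv[of y "1 / 3"] y by auto
      \<comment> \<open>\<open>k\<close> is the last generation whose ball still contains \<open>x\<close>; \<open>n = k + 1\<close> is the first whose radius is at most \<open>norm x\<close>.\<close>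
      define n where "n = (LEAST n. (1 / 3) ^ n \<le> y)"
      have n: "(1 / 3) ^ n \<le> y" unfolding n_def by (rule LeastI[of _ n0]) (use n0 in simp)
      have "n \<noteq> 0" using n y by (cases n) auto
      then obtain k where k: "n = Suc k" by (cases n) auto
      have "\<not> (1 / 3) ^ k \<le> y"
        by (rule not_less_Least[of k "\<lambda>n. (1 / 3) ^ n \<le> y"]) (use k n_def in auto)
      then have xk: "x \<in> ball 0 (3 * (1 / 3) ^ k)" by (simp add: y_def)
      have "(0 :: 'a) \<in> ball 0 (3 * (1 / 3) ^ k)" by simp
      with it[OF xk this] it[OF this xk] have "\<bar>u x - u 0\<bar> \<le> t ^ k" by simp
      also have "\<dots> \<le> 2 * t ^ n" using t by (simp add: k)
      also have "t ^ n = ((1 / 3) ^ n) powr \<alpha>"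
        by (simp add: al[symmetric] powr_realpow[symmetric] powr_powr mult.commute)
      also have "\<dots> \<le> y powr \<alpha>"
        using n \<open>0 < \<alpha>\<close> by (intro powr_mono2) auto
      finally show ?thesis by (simp add: y_def)
    qed simp
  qed
qed

text \<open>The scaled form. The two smallness conditions say that, in the units in which the radius
and the oscillation bound \<open>s\<close> are normalized, the gradient threshold and the right-hand side are small;
both can be achieved by enlarging \<open>s\<close>.\<close>
lemma holder_estimate_ball:
  assumes l: "0 < l" and D: "0 \<le> (D::real)"
  obtains \<alpha> \<gamma>0 \<kappa>0 where "0 < \<alpha>" "\<alpha> < 1" "0 < \<gamma>0" "0 < \<kappa>0"
    "\<And>(u :: 'a::euclidean_space \<Rightarrow> real) x z \<rho> s g k. 0 < \<rho> \<Longrightarrow> 0 < s \<Longrightarrow> g * \<rho> \<le> \<gamma>0 * s \<Longrightarrow> k * \<rho>\<^sup>2 \<le> \<kappa>0 * s \<Longrightarrow>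
       supersol l D g k (ball z \<rho>) u \<Longrightarrow> supersol l D g k (ball z \<rho>) (\<lambda>x. - u x) \<Longrightarrow>
       continuous_on (ball z \<rho>) u \<Longrightarrow>
       (\<And>x y. x \<in> ball z \<rho> \<Longrightarrow> y \<in> ball z \<rho> \<Longrightarrow> u x - u y \<le> s) \<Longrightarrow>
       x \<in> ball z \<rho> \<Longrightarrow> \<bar>u x - u z\<bar> \<le> 2 * s * (norm (x - z) / \<rho>) powr \<alpha>"
proof -
  obtain \<alpha> \<gamma>0 \<kappa>0 where al: "0 < \<alpha>" "\<alpha> < 1" and g0: "0 < \<gamma>0" "0 < \<kappa>0" and est:
    "\<And>(u :: 'a::euclidean_space \<Rightarrow> real) x. supersol l D \<gamma>0 \<kappa>0 (ball 0 3) u \<Longrightarrow>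
       supersol l D \<gamma>0 \<kappa>0 (ball 0 3) (\<lambda>x. - u x) \<Longrightarrow> continuous_on (ball 0 3) u \<Longrightarrow>
       (\<And>x y. x \<in> ball 0 3 \<Longrightarrow> y \<in> ball 0 3 \<Longrightarrow> u x - u y \<le> 1) \<Longrightarrow>
       x \<in> ball 0 3 \<Longrightarrow> \<bar>u x - u 0\<bar> \<le> 2 * (norm x / 3) powr \<alpha>"
    by (rule holder_estimate_normalized[OF l D, where 'a = 'a]) blast
  show thesis
  proof (rule that[of \<alpha> "3 * \<gamma>0" "9 * \<kappa>0"])
    show "0 < \<alpha>" "\<alpha> < 1" "0 < 3 * \<gamma>0" "0 < 9 * \<kappa>0" using al g0 by auto
    fix u :: "'a \<Rightarrow> real" and x z :: 'a and \<rho> s g k :: real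
    assume \<rho>: "0 < \<rho>" and s: "0 < s" and gs: "g * \<rho> \<le> 3 * \<gamma>0 * s" and ks: "k * \<rho>\<^sup>2 \<le> 9 * \<kappa>0 * s"
      and sup: "supersol l D g k (ball z \<rho>) u" and sup': "supersol l D g k (ball z \<rho>) (\<lambda>x. - u x)"
      and u: "continuous_on (ball z \<rho>) u"
      and osc: "\<And>x y. x \<in> ball z \<rho> \<Longrightarrow> y \<in> ball z \<rho> \<Longrightarrow> u x - u y \<le> s"
      and x: "x \<in> ball z \<rho>"
    define r where "r = \<rho> / 3"
    have r: "0 < r" using \<rho> by (simp add: r_def)
    define v where "v y = u (z + r *\<^sub>R y) / s" for y
    have v_eq: "(\<lambda>x. (u (z + r *\<^sub>R x) + 0) / s) = v" "(\<lambda>x. (- u (z + r *\<^sub>R x) + 0) / s) = (\<lambda>x. - v x)"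
      by (auto simp: v_def)
    have S: "z + r *\<^sub>R y \<in> ball z \<rho>" if "y \<in> ball 0 3" for y
      using that \<rho> by (simp add: dist_norm r_def)
    have le: "g * r / s \<le> \<gamma>0" "k * r\<^sup>2 / s \<le> \<kappa>0"
      using gs ks s by (simp_all add: r_def power_divide field_simps)
    have sv: "supersol l D \<gamma>0 \<kappa>0 (ball 0 3) v"
      by (rule supersol_mono[OF supersol_rescale[OF sup r s, of z 0, unfolded v_eq(1)]]) (use le S in auto)
    have sv': "supersol l D \<gamma>0 \<kappa>0 (ball 0 3) (\<lambda>x. - v x)"
      by (rule supersol_mono[OF supersol_rescale[OF sup' r s, of z 0, unfolded v_eq(2)]]) (use le S in auto)
    define y where "y = (1 / r) *\<^sub>R (x - z)"
    have xy: "x = z + r *\<^sub>R y" using r by (simp add: y_def)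
    have ny: "norm y = norm (x - z) / r" using r by (simp add: y_def)
    have "\<bar>v y - v 0\<bar> \<le> 2 * (norm y / 3) powr \<alpha>"
    proof (rule est[OF sv sv'])
      show "continuous_on (ball 0 3) v"
        unfolding v_def using s S by (intro continuous_intros continuous_on_compose2[OF u]) auto
      show "v a - v b \<le> 1" if "a \<in> ball 0 3" "b \<in> ball 0 3" for a b
        using osc[OF S[OF that(1)] S[OF that(2)]] s
        unfolding v_def diff_divide_distrib[symmetric] by simp
      show "y \<in> ball 0 3" using x \<rho> unfolding mem_ball dist_0_norm ny
        by (simp add: r_def field_simps dist_norm norm_minus_commute)
    qed
    moreover have "v y - v 0 = (u x - u z) / s" by (simp add: v_def xy diff_divide_distrib)
    moreover have "norm y / 3 = norm (x - z) / \<rho>" by (simp add: ny r_def)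
    ultimately show "\<bar>u x - u z\<bar> \<le> 2 * s * (norm (x - z) / \<rho>) powr \<alpha>"
      using s by (simp add: field_simps)
  qed
qed

section \<open>Quadratic test functions for the degenerate equation\<close>

definition rank1 :: "real \<Rightarrow> real ^ 'n \<Rightarrow> real ^ 'n ^ 'n" where
  "rank1 b v = (\<chi> i j. b * v $ i * v $ j)"

lemma rank1_mult: "rank1 b v *v x = (b * (v \<bullet> x)) *\<^sub>R v"
  by (simp add: rank1_def matrix_vector_mult_def vec_eq_iff inner_vec_def sum_distrib_left sum_distrib_right mult_ac)

lemma mat_mult: "(mat c :: real ^ 'n ^ 'n) *v x = c *\<^sub>R x"
  by (simp add: matrix_vector_mult_def mat_def vec_eq_iff if_distrib[of "\<lambda>a. a * _"] cong: if_cong)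

lemma Sym_rank1: "rank1 b v \<in> Sym"
  by (simp add: Sym_def rank1_def transpose_def vec_eq_iff mult_ac)

lemma Sym_mat: "mat c \<in> Sym"
  by (simp add: Sym_def)

lemma Sym_add: "X \<in> Sym \<Longrightarrow> Y \<in> Sym \<Longrightarrow> X + Y \<in> Sym"
  by (simp add: Sym_def transpose_def vec_eq_iff)

text \<open>The only two eigenvalue computations that the test functions require: multiples of the identity and
matrices of rank one.\<close>
lemma pucci_min_mat:
  assumes c: "c \<le> 0"
  shows "pucci_min lam Lam (mat c :: real ^ 'n ^ 'n) = Lam * (real CARD('n) * c)"
proof -
  have eig: "eigenspace (mat c :: real ^ 'n ^ 'n) e = (if e = c then UNIV else {0})" for e
    by (auto simp: eigenspace_def mat_mult)
  have ev: "eigenvalues (mat c :: real ^ 'n ^ 'n) = {c}"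
  proof -
    have "\<exists>v. v \<noteq> (0 :: real ^ 'n)" by (rule exI[of _ "axis undefined 1"]) (simp add: axis_eq_0_iff)
    then show ?thesis by (auto simp: eigenvalues_def eig split: if_splits)
  qed
  have pos: "{e \<in> {c}. e > 0} = {}" using c by auto
  have neg: "(\<Sum>e\<in>{e \<in> {c}. e < 0}. real (dim (eigenspace (mat c :: real ^ 'n ^ 'n) e)) * e) = real CARD('n) * c"
  proof (cases "c = 0")
    case False
    then have "{e \<in> {c}. e < 0} = {c}" using c by auto
    then show ?thesis by (simp add: eig)
  next
    case True
    then have "{e \<in> {c}. e < 0} = {}" by auto
    then show ?thesis by (simp only: sum.empty) (simp add: True)
  qed
  show ?thesis
    unfolding pucci_min_def pos_eigenvalue_sum_def neg_eigenvalue_sum_def ev pos neg by simp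
qed

lemma pucci_min_rank1:
  fixes v :: "real ^ 'n"
  assumes b: "0 \<le> b" and v: "norm v = 1"
  shows "pucci_min lam Lam (rank1 b v) = lam * b"
proof (cases "b = 0")
  case True
  then have "rank1 b v = mat 0" by (simp add: rank1_def mat_def vec_eq_iff)
  then show ?thesis using pucci_min_mat[of 0 lam Lam] True by simp
next
  case False
  then have b: "0 < b" using b by simp
  have vv: "v \<bullet> v = 1" using v by (simp add: norm_eq_1)
  have key: "e = b \<and> x \<in> span {v}" if x: "x \<in> eigenspace (rank1 b v) e" "x \<noteq> 0" "e \<noteq> 0" for e x
  proof -
    have eq: "(b * (v \<bullet> x)) *\<^sub>R v = e *\<^sub>R x" using x(1) by (simp add: eigenspace_def rank1_mult)
    have xv: "x = (b * (v \<bullet> x) / e) *\<^sub>R v"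
    proof -
      have "x = (1 / e) *\<^sub>R (e *\<^sub>R x)" using x(3) by simp
      then show ?thesis unfolding eq[symmetric] by simp
    qed
    have "v \<bullet> ((b * (v \<bullet> x)) *\<^sub>R v) = v \<bullet> (e *\<^sub>R x)" using eq by simp
    then have "b * (v \<bullet> x) = e * (v \<bullet> x)" using vv by simp
    moreover have "v \<bullet> x \<noteq> 0" using xv x(2) by auto
    ultimately have "e = b" by simp
    moreover have "x \<in> span {v}" by (subst xv) (auto intro: span_mul span_base)
    ultimately show ?thesis by simp
  qed
  have vb: "v \<in> eigenspace (rank1 b v) b" by (simp add: eigenspace_def rank1_mult vv)
  have v0: "v \<noteq> 0" using v by auto
  have "eigenspace (rank1 b v) b = span {v}"
  proof
    show "eigenspace (rank1 b v) b \<subseteq> span {v}"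
      using key[of _ b] b span_zero by (metis less_irrefl subsetI)
    show "span {v} \<subseteq> eigenspace (rank1 b v) b"
      by (auto simp: span_singleton eigenspace_def rank1_mult vv)
  qed
  then have d: "dim (eigenspace (rank1 b v) b) = 1"
    using v0 by (simp add: dim_span dim_singleton)
  have "{e \<in> eigenvalues (rank1 b v). 0 < e} = {b}"
    using key vb v0 b by (fastforce simp: eigenvalues_def)
  moreover have "{e \<in> eigenvalues (rank1 b v). e < 0} = {}"
    using key b by (fastforce simp: eigenvalues_def)
  ultimately show ?thesis
    unfolding pucci_min_def pos_eigenvalue_sum_def neg_eigenvalue_sum_def by (simp only: d sum.empty) (simp add: d)
qed

lemma quadratic_test_function:
  fixes p v x0 :: "real ^ 'n"  and b c :: real
  defines "P \<equiv> \<lambda>y. p \<bullet> (y - x0) + b * (v \<bullet> (y - x0))\<^sup>2 - c * (norm (y - x0))\<^sup>2"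
  shows "grad P y = p + (2 * b * (v \<bullet> (y - x0))) *\<^sub>R v - (2 * c) *\<^sub>R (y - x0)"
    and "hessian P y = rank1 (2 * b) v + mat (- 2 * c)"
    and "C2_on S P"
proof -
  define G where "G y = p + (2 * b * (v \<bullet> (y - x0))) *\<^sub>R v - (2 * c) *\<^sub>R (y - x0)" for y
  have dP: "(P has_derivative (\<lambda>h. G y \<bullet> h)) (at y)" for y
    unfolding P_def power2_norm_eq_inner unfolding power2_eq_square
    by (auto intro!: derivative_eq_intros simp: G_def fun_eq_iff inner_diff_left inner_diff_right
          inner_add_left inner_commute algebra_simps)
  have gP: "grad P y = G y" for y
    unfolding grad_def frechet_derivative_at[OF dP, symmetric]
    by (simp add: vec_eq_iff inner_axis)
  then have gP': "grad P = G" by auto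
  have dG: "(G has_derivative (\<lambda>h. (rank1 (2 * b) v + mat (- 2 * c)) *v h)) (at y)" for y
    unfolding G_def
    by (rule derivative_eq_intros refl | simp)+
       (simp add: fun_eq_iff matrix_vector_mult_add_rdistrib rank1_mult mat_mult)
  have hP: "hessian P y = rank1 (2 * b) v + mat (- 2 * c)" for y
    unfolding hessian_def gP' jacobian_def frechet_derivative_at[OF dG, symmetric] by simp
  show "grad P y = p + (2 * b * (v \<bullet> (y - x0))) *\<^sub>R v - (2 * c) *\<^sub>R (y - x0)"
    using gP by (simp add: G_def)
  show "hessian P y = rank1 (2 * b) v + mat (- 2 * c)" by (rule hP)
  show "C2_on S P"
    unfolding C2_on_def gP' hP[abs_def] using dP dG by (auto simp: differentiable_def)
qed

text \<open>Superadditivity in disguise: the ellipticity condition is applied once to remove the rank-one part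
and once to remove the multiple of the identity.\<close>
lemma elliptic_lower_bound:
  fixes F :: "real ^ 'n \<Rightarrow> real ^ 'n ^ 'n \<Rightarrow> real"
  assumes F: "elliptic_assumptions lam Lam \<omega> C\<^sub>F F" and x: "x \<in> B1"
    and v: "norm v = 1" and b: "0 \<le> b" and c: "0 \<le> c"
  shows "2 * (lam * b - real CARD('n) * Lam * c) \<le> F x (rank1 (2 * b) v + mat (- 2 * c))"
    and "F x (rank1 (2 * - b) v + mat (- 2 * - c)) \<le> - (2 * (lam * b - real CARD('n) * Lam * c))"
proof -
  have ell: "pucci_min lam Lam (X - Y) \<le> F x X - F x Y" if "X \<in> Sym" "Y \<in> Sym" for X Y
    using F x that unfolding elliptic_assumptions_def by blast
  have F0: "F x 0 = 0" using F x unfolding elliptic_assumptions_def by blast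
  have S0: "(0 :: real ^ 'n ^ 'n) \<in> Sym" using Sym_mat[of 0] by (simp add: mat_0)
  have r: "pucci_min lam Lam (rank1 (2 * b) v) = lam * (2 * b)" using b v by (intro pucci_min_rank1) auto
  have m: "pucci_min lam Lam (mat (- 2 * c) :: real ^ 'n ^ 'n) = Lam * (real CARD('n) * (- 2 * c))"
    using c by (intro pucci_min_mat) auto
  have neg: "0 - rank1 (2 * - b) v = rank1 (2 * b) v"
    "rank1 (2 * - b) v - (rank1 (2 * - b) v + mat (- 2 * - c)) = mat (- 2 * c)"
    by (simp_all add: rank1_def mat_def vec_eq_iff)
  have "pucci_min lam Lam ((rank1 (2 * b) v + mat (- 2 * c)) - mat (- 2 * c))
      \<le> F x (rank1 (2 * b) v + mat (- 2 * c)) - F x (mat (- 2 * c))"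
    by (intro ell Sym_add Sym_rank1 Sym_mat)
  moreover have "pucci_min lam Lam ((mat (- 2 * c) :: real ^ 'n ^ 'n) - 0) \<le> F x (mat (- 2 * c)) - F x 0"
    by (intro ell S0 Sym_mat)
  ultimately show "2 * (lam * b - real CARD('n) * Lam * c) \<le> F x (rank1 (2 * b) v + mat (- 2 * c))"
    unfolding add_diff_cancel_right' diff_zero r m F0 by (simp add: algebra_simps)
  have "pucci_min lam Lam (0 - rank1 (2 * - b) v) \<le> F x 0 - F x (rank1 (2 * - b) v)"
    by (intro ell S0 Sym_rank1)
  moreover have "pucci_min lam Lam (rank1 (2 * - b) v - (rank1 (2 * - b) v + mat (- 2 * - c)))
      \<le> F x (rank1 (2 * - b) v) - F x (rank1 (2 * - b) v + mat (- 2 * - c))"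
    by (intro ell Sym_add Sym_rank1 Sym_mat)
  ultimately show "F x (rank1 (2 * - b) v + mat (- 2 * - c)) \<le> - (2 * (lam * b - real CARD('n) * Lam * c))"
    unfolding neg r m F0 by (simp add: algebra_simps)
qed

text \<open>Where the gradient is at least \<open>g\<close>, the lower bound on \<open>H\<close> contains the factor \<open>1 + a x\<close>, which
cancels against the weight in the bound for \<open>f\<close>. This is why only \<open>f / (1 + a)\<close> enters the estimate.\<close>
lemma degeneracy_bound:
  assumes H: "degeneracy_assumptions p q L\<^sub>1 L\<^sub>2 a H" and x: "x \<in> B1" and a: "0 \<le> a x"
    and p: "0 < p" "p \<le> q" and L: "0 < L\<^sub>1" and g: "0 < g" "g \<le> norm \<xi>"
    and T: "0 < T" and HT: "H x \<xi> * (2 * T) \<le> \<Phi> * (1 + a x)"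
  shows "T \<le> \<Phi> / (L\<^sub>1 * min (g powr p) (g powr q))"
proof -
  define m where "m = min (g powr p) (g powr q)"
  have m: "0 < m" using g by (simp add: m_def)
  have "m \<le> norm \<xi> powr p" "m \<le> norm \<xi> powr q"
    using g p powr_mono2[of p g "norm \<xi>"] powr_mono2[of q g "norm \<xi>"] by (auto simp: m_def min_def)
  then have "m + a x * m \<le> norm \<xi> powr p + a x * norm \<xi> powr q"
    using a by (intro add_mono mult_left_mono)
  then have "L\<^sub>1 * (m + a x * m) \<le> L\<^sub>1 * (norm \<xi> powr p + a x * norm \<xi> powr q)"
    using L by (intro mult_left_mono) auto
  also have "\<dots> \<le> H x \<xi>" using H x unfolding degeneracy_assumptions_def by blast
  finally have h: "L\<^sub>1 * m * (1 + a x) \<le> H x \<xi>" by (simp add: algebra_simps)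
  have "L\<^sub>1 * m * (1 + a x) * T \<le> H x \<xi> * T" using h T by (intro mult_right_mono) auto
  also have "\<dots> \<le> H x \<xi> * (2 * T)"
    using h T L m a by (intro mult_left_mono) (auto intro: order_trans[OF _ h])
  also note HT
  finally have "(L\<^sub>1 * m * T) * (1 + a x) \<le> \<Phi> * (1 + a x)" by (simp add: mult_ac)
  then have "L\<^sub>1 * m * T \<le> \<Phi>" using a by (simp add: mult_le_cancel_right)
  then show ?thesis using L m unfolding m_def[symmetric] by (simp add: pos_le_divide_eq mult_ac)
qed

text \<open>Dividing the equation by \<open>H\<close> where the gradient is not small. The solution \<open>u\<close> and its negative are
both in the class, because touching \<open>- u\<close> from below by a quadratic is touching \<open>u\<close> from above by
its negative.\<close>
lemma viscosity_solution_imp_supersol: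
  fixes u :: "real ^ 'n \<Rightarrow> real"
  assumes F: "elliptic_assumptions lam Lam \<omega> C\<^sub>F F"
    and H: "degeneracy_assumptions p q L\<^sub>1 L\<^sub>2 a H" and a: "\<And>x. x \<in> B1 \<Longrightarrow> 0 \<le> a x"
    and p: "0 < p" "p \<le> q" and L: "0 < L\<^sub>1" and g: "0 < g"
    and f: "\<And>x. x \<in> B1 \<Longrightarrow> \<bar>f x\<bar> \<le> \<Phi> * (1 + a x)"
    and sol: "viscosity_solution H F f u"
  defines "k \<equiv> \<Phi> / (L\<^sub>1 * min (g powr p) (g powr q))"
  shows "supersol lam (real CARD('n) * Lam) g k B1 u"
    and "supersol lam (real CARD('n) * Lam) g k B1 (\<lambda>x. - u x)"
proof -
  have \<Phi>: "0 \<le> \<Phi>" using f[of 0] a[of 0] by (smt (verit) centre_in_ball mult_nonneg_nonneg zero_le_mult_iff)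
  have k: "0 \<le> k" using \<Phi> L g by (auto simp: k_def min_def)
  have Hpos: "0 \<le> H x \<xi>" if "x \<in> B1" for x \<xi>
    using H that unfolding degeneracy_assumptions_def by blast
  show "supersol lam (real CARD('n) * Lam) g k B1 u"
    unfolding supersol_def
  proof (intro ballI allI impI, elim conjE)
    fix x \<xi> v :: "real ^ 'n" and c b :: real
    assume x: "x \<in> B1" and v: "norm v = 1" and c: "0 \<le> c" and b: "0 \<le> b" and \<xi>: "g \<le> norm \<xi>"
      and ev: "\<forall>\<^sub>F y in nhds x. u x + \<xi> \<bullet> (y - x) + b * (v \<bullet> (y - x))\<^sup>2 - c * (norm (y - x))\<^sup>2 \<le> u y"
    define P where "P y = \<xi> \<bullet> (y - x) + b * (v \<bullet> (y - x))\<^sup>2 - c * (norm (y - x))\<^sup>2" for y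
    note test = quadratic_test_function[where p = \<xi> and ?x0.0 = x and b = b and v = v and c = c, folded P_def[abs_def]]
    have "local_min_at (\<lambda>y. u y - P y) x"
      unfolding local_min_at_def using ev by (rule eventually_mono) (simp add: P_def)
    then have "H x (grad P x) * F x (hessian P x) \<le> f x"
      using sol x test(3) unfolding viscosity_solution_def viscosity_supersolution_def by blast
    then have *: "H x \<xi> * F x (rank1 (2 * b) v + mat (- 2 * c)) \<le> f x"
      unfolding test(1,2) by simp
    show "lam * b - real CARD('n) * Lam * c \<le> k"
    proof (cases "0 < lam * b - real CARD('n) * Lam * c")
      case True
      have "H x \<xi> * (2 * (lam * b - real CARD('n) * Lam * c)) \<le> H x \<xi> * F x (rank1 (2 * b) v + mat (- 2 * c))"
        by (intro mult_left_mono elliptic_lower_bound[OF F x v b c] Hpos x)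
      also have "\<dots> \<le> \<Phi> * (1 + a x)" using * f[OF x] by linarith
      finally show ?thesis
        unfolding k_def by (rule degeneracy_bound[where a = a and x = x, OF H x a[OF x] p L g \<xi> True])
    qed (use k in linarith)
  qed
  show "supersol lam (real CARD('n) * Lam) g k B1 (\<lambda>x. - u x)"
    unfolding supersol_def
  proof (intro ballI allI impI, elim conjE)
    fix x \<xi> v :: "real ^ 'n" and c b :: real
    assume x: "x \<in> B1" and v: "norm v = 1" and c: "0 \<le> c" and b: "0 \<le> b" and \<xi>: "g \<le> norm \<xi>"
      and ev: "\<forall>\<^sub>F y in nhds x. - u x + \<xi> \<bullet> (y - x) + b * (v \<bullet> (y - x))\<^sup>2 - c * (norm (y - x))\<^sup>2 \<le> - u y"
    define P where "P y = (- \<xi>) \<bullet> (y - x) + (- b) * (v \<bullet> (y - x))\<^sup>2 - (- c) * (norm (y - x))\<^sup>2" for y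
    note test = quadratic_test_function[where p = "- \<xi>" and ?x0.0 = x and b = "- b" and v = v and c = "- c", folded P_def[abs_def]]
    have "local_max_at (\<lambda>y. u y - P y) x"
      unfolding local_max_at_def using ev by (rule eventually_mono) (simp add: P_def)
    then have "f x \<le> H x (grad P x) * F x (hessian P x)"
      using sol x test(3) unfolding viscosity_solution_def viscosity_subsolution_def by blast
    then have *: "f x \<le> H x (- \<xi>) * F x (rank1 (2 * - b) v + mat (- 2 * - c))"
      unfolding test(1,2) by simp
    have n\<xi>: "g \<le> norm (- \<xi>)" using \<xi> by simp
    show "lam * b - real CARD('n) * Lam * c \<le> k"
    proof (cases "0 < lam * b - real CARD('n) * Lam * c")
      case True
      have "H x (- \<xi>) * F x (rank1 (2 * - b) v + mat (- 2 * - c)) \<le>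
          H x (- \<xi>) * - (2 * (lam * b - real CARD('n) * Lam * c))"
        by (intro mult_left_mono elliptic_lower_bound[OF F x v b c] Hpos x)
      then have "H x (- \<xi>) * (2 * (lam * b - real CARD('n) * Lam * c)) \<le> \<Phi> * (1 + a x)"
        unfolding mult_minus_right[of "H x (- \<xi>)"] using * f[OF x] by linarith
      then show ?thesis
        unfolding k_def by (rule degeneracy_bound[where a = a and x = x, OF H x a[OF x] p L g n\<xi> True])
    qed (use k in linarith)
  qed
qed

section \<open>Norms, scales and interpolation\<close>

text \<open>For a continuous function on an open set, a value above the essential supremum would be exceeded on
a nonempty open set, which is not negligible.\<close>
lemma le_Linf_norm:
  fixes g :: "real ^ 'n \<Rightarrow> real"
  assumes g: "continuous_on B1 g" and x: "x \<in> B1"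
  shows "ennreal \<bar>g x\<bar> \<le> Linf_norm B1 g"
proof (rule ccontr)
  assume no: "\<not> ennreal \<bar>g x\<bar> \<le> Linf_norm B1 g"
  define V where "V = B1 \<inter> (\<lambda>y. ennreal \<bar>g y\<bar>) -` {Linf_norm B1 g <..}"
  have "open V" unfolding V_def
    by (rule continuous_open_preimage) (auto intro!: continuous_on_ennreal continuous_intros g)
  moreover have "V \<noteq> {}" using no x by (auto simp: V_def not_le)
  moreover have "negligible V"
  proof -
    have "AE y in lebesgue_on B1. ennreal \<bar>g y\<bar> \<le> Linf_norm B1 g"
      unfolding Linf_norm_def by (rule esssup_AE)
    then have "AE y in lebesgue. y \<in> B1 \<longrightarrow> ennreal \<bar>g y\<bar> \<le> Linf_norm B1 g"
      by (subst (asm) AE_restrict_space_iff) auto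
    then obtain N where N: "N \<in> null_sets lebesgue" "{y. \<not> (y \<in> B1 \<longrightarrow> ennreal \<bar>g y\<bar> \<le> Linf_norm B1 g)} \<subseteq> N"
      by (auto simp: eventually_ae_filter)
    then have "V \<subseteq> N" by (auto simp: V_def not_le)
    then show ?thesis using N(1) negligible_iff_null_sets negligible_subset by blast
  qed
  ultimately show False using open_not_negligible by blast
qed

lemma Linf_norm_le:
  fixes g :: "real ^ 'n \<Rightarrow> real"
  assumes g: "continuous_on B1 g" and b: "\<And>x. x \<in> B1 \<Longrightarrow> \<bar>g x\<bar> \<le> b"
  shows "Linf_norm B1 g \<le> ennreal b"
  unfolding Linf_norm_def
proof (rule esssup_I)
  show "(\<lambda>x. ennreal \<bar>g x\<bar>) \<in> borel_measurable (lebesgue_on B1)"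
    using continuous_imp_measurable_on_sets_lebesgue[OF g fmeasurableD[OF lmeasurable_ball]] by measurable
  show "AE x in lebesgue_on B1. ennreal \<bar>g x\<bar> \<le> ennreal b"
    by (rule AE_I2) (auto simp: space_restrict_space intro!: ennreal_leI b)
qed

text \<open>The choice of the scale \<open>s\<close>. For an equation with gradient power \<open>r\<close>, the natural size of a solution with
right-hand side of size \<open>K\<close> is \<open>K powr (1 / (r + 1))\<close>; a fixed multiple of it makes the rescaled
right-hand side as small as desired.\<close>
lemma powr_threshold:
  fixes r c s K A :: real
  assumes r: "0 < r" and c: "0 < c" and s: "0 < s" and K: "0 \<le> K" and A: "1 \<le> A" "B \<le> A * c powr r" "0 \<le> B"
    and sK: "A * K powr (1 / (r + 1)) \<le> s"
  shows "B * K \<le> s * (c * s) powr r"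
proof -
  have "A * K \<le> (A * K powr (1 / (r + 1))) powr (r + 1)"
  proof -
    have "A * K \<le> A powr (r + 1) * K"
      using A r K powr_mono[of 1 "r + 1" A] by (intro mult_right_mono) auto
    also have "\<dots> = (A * K powr (1 / (r + 1))) powr (r + 1)"
      using A r K by (simp add: powr_mult powr_powr)
    finally show ?thesis .
  qed
  also have "\<dots> \<le> s powr (r + 1)" using r K A sK by (intro powr_mono2) auto
  finally have "c powr r * (A * K) \<le> c powr r * s powr (r + 1)" by (intro mult_left_mono) auto
  moreover have "B * K \<le> c powr r * (A * K)"
    using mult_right_mono[OF A(2) K] by (simp add: mult_ac)
  moreover have "c powr r * s powr (r + 1) = s * (c * s) powr r"
    using c s by (simp add: powr_add powr_mult)
  ultimately show ?thesis by simp
qed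

text \<open>Lowering the exponent absorbs the constant: a large \<open>A\<close> becomes \<open>A powr t\<close>, which is at most 2 for
small \<open>t\<close>.\<close>
lemma holder_interpolate:
  fixes X d A \<alpha> :: real
  assumes X: "0 \<le> X" "X \<le> 1" "X \<le> A * d powr \<alpha>" and d: "0 < d" and t: "0 < t" "t \<le> 1" and A: "0 < A" "A powr t \<le> 2"
  shows "X \<le> 2 * d powr (\<alpha> * t)"
proof (cases "X = 0")
  case False
  then have "X = X powr 1" using X by simp
  also have "\<dots> \<le> X powr t" using X t by (intro powr_mono') auto
  also have "\<dots> \<le> (A * d powr \<alpha>) powr t" using X t by (intro powr_mono2) auto
  also have "\<dots> = A powr t * d powr (\<alpha> * t)" using A by (simp add: powr_mult powr_powr)
  also have "\<dots> \<le> 2 * d powr (\<alpha> * t)" using A by (intro mult_right_mono) auto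
  finally show ?thesis .
qed simp

lemma holder_seminorm_le:
  assumes "\<And>x y. x \<in> S \<Longrightarrow> y \<in> S \<Longrightarrow> x \<noteq> y \<Longrightarrow> \<bar>g x - g y\<bar> \<le> c * norm (x - y) powr \<alpha>"
  shows "holder_seminorm \<alpha> S g \<le> ennreal c"
  unfolding holder_seminorm_def
  by (rule SUP_least) (use assms in \<open>auto intro!: ennreal_leI simp: divide_le_eq powr_gt_zero\<close>)

lemma holder_norm_le:
  assumes "0 \<le> m" "0 \<le> c" "\<And>x. x \<in> S \<Longrightarrow> \<bar>g x\<bar> \<le> m"
    and "\<And>x y. x \<in> S \<Longrightarrow> y \<in> S \<Longrightarrow> x \<noteq> y \<Longrightarrow> \<bar>g x - g y\<bar> \<le> c * norm (x - y) powr \<alpha>"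
  shows "holder_norm \<alpha> S g \<le> ennreal (m + c)"
proof -
  have "(SUP x\<in>S. ennreal \<bar>g x\<bar>) \<le> ennreal m" by (rule SUP_least) (use assms(3) in \<open>auto intro: ennreal_leI\<close>)
  moreover have "holder_seminorm \<alpha> S g \<le> ennreal c" by (rule holder_seminorm_le[OF assms(4)])
  ultimately have "holder_norm \<alpha> S g \<le> ennreal m + ennreal c" unfolding holder_norm_def by (rule add_mono)
  then show ?thesis using assms by simp
qed

lemma subset_ball_margin:
  fixes K :: "'a::euclidean_space set"
  assumes "compact K" "K \<subseteq> ball 0 1"
  obtains \<rho> where "0 < \<rho>" "\<rho> < 1" "K \<subseteq> cball 0 (1 - 2 * \<rho>)"
proof (cases "K = {}")
  case True
  then show ?thesis using that[of "1 / 2"] by simp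
next
  case False
  obtain x where x: "x \<in> K" "\<And>y. y \<in> K \<Longrightarrow> norm y \<le> norm x"
    using continuous_attains_sup[OF assms(1) False, of norm] by (auto intro: continuous_intros)
  have "norm x < 1" using x assms by auto
  show ?thesis
  proof (rule that[of "(1 - norm x) / 2"])
    show "0 < (1 - norm x) / 2" using \<open>norm x < 1\<close> by simp
    have "- 1 < norm x" by (rule less_le_trans[OF _ norm_ge_zero]) simp
    then show "(1 - norm x) / 2 < 1" by (simp add: divide_less_eq)
    have eq: "1 - 2 * ((1 - norm x) / 2) = norm x" by (simp add: field_simps)
    show "K \<subseteq> cball 0 (1 - 2 * ((1 - norm x) / 2))" unfolding eq using x(2) by auto
  qed
qed

section \<open>The estimate for the degenerate equation\<close>

theorem theorem8p5:
  fixes lam Lam :: real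
  assumes "0 < lam" and "lam \<le> Lam"
  shows "\<exists>C > 0. \<forall>p q L\<^sub>1 L\<^sub>2 C\<^sub>F (a :: real ^ 'n \<Rightarrow> real) \<omega>.
    0 < p \<and> p \<le> q \<and> 0 < L\<^sub>1 \<and> L\<^sub>1 \<le> L\<^sub>2 \<and> 0 < C\<^sub>F \<and>
    continuous_on B1 a \<and> (\<forall>x \<in> B1. 0 \<le> a x) \<and> modulus_of_continuity \<omega> \<longrightarrow>
    (\<exists>\<alpha>. 0 < \<alpha> \<and> \<alpha> < 1 \<and>
      (\<forall>(F :: real ^ 'n \<Rightarrow> real ^ 'n ^ 'n \<Rightarrow> real) (H :: real ^ 'n \<Rightarrow> real ^ 'n \<Rightarrow> real) f u.
        elliptic_assumptions lam Lam \<omega> C\<^sub>F F \<and>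
        degeneracy_assumptions p q L\<^sub>1 L\<^sub>2 a H \<and>
        continuous_on B1 f \<and> bounded (f ` B1) \<and>
        viscosity_solution H F f u \<longrightarrow>
          holder_loc \<alpha> B1 u \<and>
          holder_norm \<alpha> (cball 0 (1 / 2)) u \<le>
            ennreal C * (Linf_norm B1 u +
              ennreal ((q + 1) powr (1 / (q + 1)) * Pi_const p q L\<^sub>1 f a))))"
proof (rule exI[of _ 5], intro conjI allI impI)
  show "(0::real) < 5" by simp
  fix p q L\<^sub>1 L\<^sub>2 C\<^sub>F :: real and a :: "real ^ 'n \<Rightarrow> real" and \<omega> :: "real \<Rightarrow> real"
  assume "0 < p \<and> p \<le> q \<and> 0 < L\<^sub>1 \<and> L\<^sub>1 \<le> L\<^sub>2 \<and> 0 < C\<^sub>F \<and>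
    continuous_on B1 a \<and> (\<forall>x \<in> B1. 0 \<le> a x) \<and> modulus_of_continuity \<omega>"
  then have p: "0 < p" "p \<le> q" and L: "0 < L\<^sub>1" and ac: "continuous_on B1 a" and a0: "\<And>x. x \<in> B1 \<Longrightarrow> 0 \<le> a x"
    by auto
  have q: "0 < q" using p by simp
  define D where "D = real CARD('n) * Lam"
  have D: "0 \<le> D" using assms by (simp add: D_def)
  obtain \<alpha>0 \<gamma>0 \<kappa>0 where al0: "0 < \<alpha>0" "\<alpha>0 < 1" and g0: "0 < \<gamma>0" "0 < \<kappa>0" and est:
    "\<And>(u :: real ^ 'n \<Rightarrow> real) x z \<rho> s g k. 0 < \<rho> \<Longrightarrow> 0 < s \<Longrightarrow> g * \<rho> \<le> \<gamma>0 * s \<Longrightarrow> k * \<rho>\<^sup>2 \<le> \<kappa>0 * s \<Longrightarrow>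
       supersol lam D g k (ball z \<rho>) u \<Longrightarrow> supersol lam D g k (ball z \<rho>) (\<lambda>x. - u x) \<Longrightarrow>
       continuous_on (ball z \<rho>) u \<Longrightarrow>
       (\<And>x y. x \<in> ball z \<rho> \<Longrightarrow> y \<in> ball z \<rho> \<Longrightarrow> u x - u y \<le> s) \<Longrightarrow>
       x \<in> ball z \<rho> \<Longrightarrow> \<bar>u x - u z\<bar> \<le> 2 * s * (norm (x - z) / \<rho>) powr \<alpha>0"
    by (rule holder_estimate_ball[OF assms(1) D, where 'a = "real ^ 'n"]) blast
  define V where "V = vol (B1 :: (real ^ 'n) set) powr (1 / real CARD('n))"
  have V: "0 < V" using vol_unit_pos[where 'a = "real ^ 'n"] by (simp add: V_def del: measure_completion)
  \<comment> \<open>On balls of radius \<open>\<rho>\<close> the oscillation is normalized by at least \<open>A \<rho>\<close> times the size of the data. The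
    two quotients are what the smallness condition asks for with the exponents \<open>p\<close> and \<open>q\<close>; the 2
    accounts for the oscillation being at most twice the supremum.\<close>
  define A where "A \<rho> = 2 + \<rho>\<^sup>2 / (V * \<kappa>0) / (\<gamma>0 / \<rho>) powr p + \<rho>\<^sup>2 / (V * \<kappa>0) / (\<gamma>0 / \<rho>) powr q" for \<rho>
  have A: "2 \<le> A \<rho>" "\<rho>\<^sup>2 / (V * \<kappa>0) \<le> A \<rho> * (\<gamma>0 / \<rho>) powr p" "\<rho>\<^sup>2 / (V * \<kappa>0) \<le> A \<rho> * (\<gamma>0 / \<rho>) powr q"
    if \<rho>: "0 < \<rho>" for \<rho>
  proof -
    have c: "0 < (\<gamma>0 / \<rho>) powr p" "0 < (\<gamma>0 / \<rho>) powr q" using g0 \<rho> by simp_all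
    have b: "0 < \<rho>\<^sup>2 / (V * \<kappa>0)" using V g0 \<rho> by simp
    have b': "0 < \<rho>\<^sup>2 / (V * \<kappa>0) / (\<gamma>0 / \<rho>) powr p" "0 < \<rho>\<^sup>2 / (V * \<kappa>0) / (\<gamma>0 / \<rho>) powr q"
      by (rule divide_pos_pos[OF b c(1)], rule divide_pos_pos[OF b c(2)])
    show "2 \<le> A \<rho>" using b' unfolding A_def by linarith
    have "\<rho>\<^sup>2 / (V * \<kappa>0) / (\<gamma>0 / \<rho>) powr p \<le> A \<rho>" "\<rho>\<^sup>2 / (V * \<kappa>0) / (\<gamma>0 / \<rho>) powr q \<le> A \<rho>"
      using b' unfolding A_def by linarith+
    then show "\<rho>\<^sup>2 / (V * \<kappa>0) \<le> A \<rho> * (\<gamma>0 / \<rho>) powr p" "\<rho>\<^sup>2 / (V * \<kappa>0) \<le> A \<rho> * (\<gamma>0 / \<rho>) powr q"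
      using c by (simp_all only: pos_divide_le_eq)
  qed
  \<comment> \<open>The estimate on balls of radius 1/4 has the constant \<open>A0\<close> and the exponent \<open>\<alpha>0\<close>; the factor \<open>t\<close> is
    chosen so that the interpolated constant is 2, whatever \<open>A0\<close> is.\<close>
  define A0 where "A0 = 4 * A (1 / 4)"
  have A0: "8 \<le> A0" using A(1)[of "1 / 4"] by (simp add: A0_def)
  define t where "t = ln 2 / ln A0"
  have lnA: "ln 2 \<le> ln A0" "0 < ln A0" using A0 by simp_all
  have t: "0 < t" "t \<le> 1"
    unfolding t_def using lnA by (simp_all add: divide_le_eq_1_pos)
  have At: "A0 powr t = 2" using A0 by (simp add: t_def powr_def)
  define \<alpha> where "\<alpha> = \<alpha>0 * t"
  have al: "0 < \<alpha>" "\<alpha> \<le> \<alpha>0" using al0 t by (auto simp: \<alpha>_def mult_left_le)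
  show "\<exists>\<alpha>. 0 < \<alpha> \<and> \<alpha> < 1 \<and>
      (\<forall>(F :: real ^ 'n \<Rightarrow> real ^ 'n ^ 'n \<Rightarrow> real) (H :: real ^ 'n \<Rightarrow> real ^ 'n \<Rightarrow> real) f u.
        elliptic_assumptions lam Lam \<omega> C\<^sub>F F \<and>
        degeneracy_assumptions p q L\<^sub>1 L\<^sub>2 a H \<and>
        continuous_on B1 f \<and> bounded (f ` B1) \<and>
        viscosity_solution H F f u \<longrightarrow>
          holder_loc \<alpha> B1 u \<and>
          holder_norm \<alpha> (cball 0 (1 / 2)) u \<le>
            ennreal 5 * (Linf_norm B1 u +
              ennreal ((q + 1) powr (1 / (q + 1)) * Pi_const p q L\<^sub>1 f a)))"
  proof (rule exI[of _ \<alpha>], intro conjI[OF al(1)] conjI[OF le_less_trans[OF al(2) al0(2)]] allI impI, elim conjE)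
    fix F :: "real ^ 'n \<Rightarrow> real ^ 'n ^ 'n \<Rightarrow> real" and H :: "real ^ 'n \<Rightarrow> real ^ 'n \<Rightarrow> real"
      and f u :: "real ^ 'n \<Rightarrow> real"
    assume F: "elliptic_assumptions lam Lam \<omega> C\<^sub>F F" and H: "degeneracy_assumptions p q L\<^sub>1 L\<^sub>2 a H"
      and fc: "continuous_on B1 f" and fb: "bounded (f ` B1)" and sol: "viscosity_solution H F f u"
    have u: "continuous_on B1 u"
      using sol unfolding viscosity_solution_def viscosity_subsolution_def by blast
    define \<Phi> where "\<Phi> = enn2real (Linf_norm B1 (\<lambda>x. f x / (1 + a x)))"
    have \<Phi>0: "0 \<le> \<Phi>" by (simp add: \<Phi>_def)
    have f\<Phi>: "\<bar>f x\<bar> \<le> \<Phi> * (1 + a x)" if x: "x \<in> B1" for x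
    proof -
      have hc: "continuous_on B1 (\<lambda>x. f x / (1 + a x))"
        using a0 by (intro continuous_intros fc ac) (smt (verit))
      obtain b where "\<forall>y\<in>f ` B1. norm y \<le> b" using fb unfolding bounded_iff by blast
      then have b: "\<bar>f x\<bar> \<le> b" if "x \<in> B1" for x using that by auto
      have "\<bar>f y / (1 + a y)\<bar> \<le> b" if "y \<in> B1" for y
      proof -
        have "\<bar>f y\<bar> / (1 + a y) \<le> b / 1" using a0[OF that] b[OF that] by (intro frac_le) auto
        then show ?thesis using a0[OF that] by (simp add: abs_divide)
      qed
      then have "Linf_norm B1 (\<lambda>x. f x / (1 + a x)) \<le> ennreal b" by (rule Linf_norm_le[OF hc])
      then have "Linf_norm B1 (\<lambda>x. f x / (1 + a x)) < \<infinity>" by (rule le_less_trans) simp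
      then have "Linf_norm B1 (\<lambda>x. f x / (1 + a x)) = ennreal \<Phi>" by (simp add: \<Phi>_def)
      then have "\<bar>f x / (1 + a x)\<bar> \<le> \<Phi>" using le_Linf_norm[OF hc x] \<Phi>0 by simp
      then show ?thesis using a0[OF x] by (simp add: abs_divide divide_le_eq)
    qed
    define K where "K = V * inverse L\<^sub>1 * \<Phi>"
    have K: "0 \<le> K" using V L \<Phi>0 by (simp add: K_def)
    have PiK: "Pi_const p q L\<^sub>1 f a = max (K powr (1 / (p + 1))) (K powr (1 / (q + 1)))"
      by (simp add: Pi_const_def Let_def K_def V_def \<Phi>_def)
    define Pc where "Pc = Pi_const p q L\<^sub>1 f a"
    have Pc0: "0 \<le> Pc" by (simp add: Pc_def PiK le_max_iff_disj)
    have loc: "\<bar>u x - u z\<bar> \<le> 2 * s * (norm (x - z) / \<rho>) powr \<alpha>0"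
      if \<rho>: "0 < \<rho>" and s: "0 < s" "A \<rho> * Pc \<le> s" "2 * m \<le> s" and B: "ball z \<rho> \<subseteq> B1"
        and m: "\<And>x. x \<in> ball z \<rho> \<Longrightarrow> \<bar>u x\<bar> \<le> m" and x: "x \<in> ball z \<rho>" for \<rho> s m z x
    proof -
      \<comment> \<open>The gradient threshold \<open>g\<close> is the largest one that the smallness condition tolerates at scale \<open>s\<close>.\<close>
      define c where "c = \<gamma>0 / \<rho>"
      define g where "g = c * s"
      have c: "0 < c" using g0 \<rho> by (simp add: c_def)
      have g: "0 < g" using c s by (simp add: g_def)
      define k where "k = \<Phi> / (L\<^sub>1 * min (g powr p) (g powr q))"
      have mm: "0 < min (g powr p) (g powr q)" using g by simp
      have thr: "\<rho>\<^sup>2 / (V * \<kappa>0) * K \<le> s * g powr r"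
        if r: "0 < r" "\<rho>\<^sup>2 / (V * \<kappa>0) \<le> A \<rho> * c powr r" "K powr (1 / (r + 1)) \<le> Pc" for r
        unfolding g_def
      proof (rule powr_threshold[OF r(1) c s(1) K _ r(2)])
        show "1 \<le> A \<rho>" using A(1)[OF \<rho>] by simp
        show "0 \<le> \<rho>\<^sup>2 / (V * \<kappa>0)" using V g0 by simp
        have "A \<rho> * K powr (1 / (r + 1)) \<le> A \<rho> * Pc" using r(3) A(1)[OF \<rho>] by (intro mult_left_mono) auto
        then show "A \<rho> * K powr (1 / (r + 1)) \<le> s" using s(2) by simp
      qed
      have "\<rho>\<^sup>2 / (V * \<kappa>0) * K \<le> s * min (g powr p) (g powr q)"
        using thr[of p] thr[of q] A(2,3)[OF \<rho>] p q by (auto simp: c_def Pc_def PiK min_def)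
      then have "\<rho>\<^sup>2 * \<Phi> \<le> \<kappa>0 * s * (L\<^sub>1 * min (g powr p) (g powr q))"
        using V g0 L by (simp add: K_def field_simps)
      then have k\<rho>: "k * \<rho>\<^sup>2 \<le> \<kappa>0 * s"
        using L mm unfolding k_def by (simp add: pos_divide_le_eq mult_ac)
      have g\<rho>: "g * \<rho> \<le> \<gamma>0 * s" using \<rho> by (simp add: g_def c_def)
      note ss = viscosity_solution_imp_supersol[OF F H a0 p L g f\<Phi> sol, folded k_def D_def]
      show ?thesis
      proof (rule est[OF \<rho> s(1) g\<rho> k\<rho> _ _ _ _ x])
        show "supersol lam D g k (ball z \<rho>) u" by (rule supersol_mono[OF ss(1) _ _ B]) auto
        show "supersol lam D g k (ball z \<rho>) (\<lambda>x. - u x)" by (rule supersol_mono[OF ss(2) _ _ B]) auto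
        show "continuous_on (ball z \<rho>) u" by (rule continuous_on_subset[OF u B])
        show "u x - u y \<le> s" if "x \<in> ball z \<rho>" "y \<in> ball z \<rho>" for x y
          using m[OF that(1)] m[OF that(2)] s(3) by linarith
      qed
    qed
    have glob: "\<bar>u x - u z\<bar> \<le> 2 * s * (norm (x - z) / \<rho>) powr \<alpha>0"
      if \<rho>: "0 < \<rho>" and s: "0 < s" "A \<rho> * Pc \<le> s" "2 * m \<le> s" and B: "ball z \<rho> \<subseteq> B1"
        and m: "\<And>x. x \<in> ball z \<rho> \<Longrightarrow> \<bar>u x\<bar> \<le> m" and x: "\<bar>u x\<bar> \<le> m" for \<rho> s m z x
    proof (cases "x \<in> ball z \<rho>")
      case True
      show ?thesis by (rule loc[OF \<rho> s B m True])
    next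
      case False
      then have "1 \<le> norm (x - z) / \<rho>" using \<rho> by (simp add: dist_norm norm_minus_commute)
      then have "1 \<le> (norm (x - z) / \<rho>) powr \<alpha>0" using al0 by (simp add: ge_one_powr_ge_zero)
      then have "s \<le> s * (norm (x - z) / \<rho>) powr \<alpha>0" using s by simp
      moreover have "\<bar>u x - u z\<bar> \<le> 2 * m" using x m[of z] \<rho> by simp
      ultimately show ?thesis using s by linarith
    qed
    \<comment> \<open>As \<open>u\<close> may be unbounded near the sphere, its bound is taken on a compact neighbourhood of \<open>K'\<close>.\<close>
    have "holder_norm \<alpha> K' u < \<infinity>" if K': "compact K'" "K' \<subseteq> B1" for K'
    proof -
      obtain \<rho> where \<rho>: "0 < \<rho>" "\<rho> < 1" "K' \<subseteq> cball 0 (1 - 2 * \<rho>)" by (rule subset_ball_margin[OF K'])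
      have inn: "ball z \<rho> \<subseteq> cball 0 (1 - \<rho>)" if "z \<in> K'" for z
      proof
        fix x assume "x \<in> ball z \<rho>"
        moreover have "norm z \<le> 1 - 2 * \<rho>" using \<rho>(3) that by auto
        ultimately show "x \<in> cball 0 (1 - \<rho>)"
          using norm_triangle_ineq[of z "x - z"] by (simp add: dist_norm norm_minus_commute)
      qed
      have sub: "cball 0 (1 - \<rho>) \<subseteq> (B1 :: (real ^ 'n) set)" using \<rho> by auto
      have "compact (u ` cball 0 (1 - \<rho>))"
        by (intro compact_continuous_image continuous_on_subset[OF u sub] compact_cball)
      then have "bounded (u ` cball 0 (1 - \<rho>))" by (rule compact_imp_bounded)
      then obtain m where "\<forall>y\<in>u ` cball 0 (1 - \<rho>). norm y \<le> m" unfolding bounded_iff by blast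
      then have m: "\<bar>u x\<bar> \<le> m" if "x \<in> cball 0 (1 - \<rho>)" for x using that by auto
      have m0: "0 \<le> m" using m[of 0] \<rho> by simp
      define s where "s = 1 + A \<rho> * Pc + 2 * m"
      have "0 \<le> A \<rho> * Pc" using A(1)[OF \<rho>(1)] Pc0 by simp
      then have s: "0 < s" "A \<rho> * Pc \<le> s" "2 * m \<le> s" using m0 by (auto simp: s_def)
      have mK: "\<bar>u x\<bar> \<le> m" if "x \<in> K'" for x
        by (rule m, rule subsetD[OF inn[OF that]]) (use \<rho>(1) in simp)
      have "holder_norm \<alpha> K' u \<le> ennreal (m + 4 * s / \<rho> powr \<alpha>0)"
      proof (rule holder_norm_le[OF m0])
        show "0 \<le> 4 * s / \<rho> powr \<alpha>0" using s by simp
        show "\<bar>u x\<bar> \<le> m" if "x \<in> K'" for x by (rule mK[OF that])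
        fix x z assume x: "x \<in> K'" and z: "z \<in> K'" and "x \<noteq> z"
        have "\<bar>u x - u z\<bar> \<le> 2 * s * (norm (x - z) / \<rho>) powr \<alpha>0"
          by (rule glob[OF \<rho>(1) s]) (use inn[OF z] sub m mK[OF x] in blast)+
        also have "\<dots> = 2 * s / \<rho> powr \<alpha>0 * norm (x - z) powr \<alpha>0"
          using \<rho> by (simp add: powr_divide)
        also have "norm (x - z) powr \<alpha>0 \<le> 2 * norm (x - z) powr \<alpha>"
        proof -
          have "norm x < 1" "norm z < 1" using K' x z by auto
          then have "norm (x - z) \<le> 2" using norm_triangle_ineq4[of x z] by simp
          then have "norm (x - z) powr (\<alpha>0 - \<alpha>) \<le> 2 powr (\<alpha>0 - \<alpha>)" using al by (intro powr_mono2) auto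
          also have "\<dots> \<le> 2 powr 1" using al al0 by (intro powr_mono) auto
          finally have "norm (x - z) powr (\<alpha>0 - \<alpha>) * norm (x - z) powr \<alpha> \<le> 2 * norm (x - z) powr \<alpha>"
            by (intro mult_right_mono) auto
          then show ?thesis by (simp add: powr_add[symmetric])
        qed
        finally show "\<bar>u x - u z\<bar> \<le> 4 * s / \<rho> powr \<alpha>0 * norm (x - z) powr \<alpha>"
          using s by (simp add: mult_left_mono divide_right_mono)
      qed
      then show ?thesis by (rule le_less_trans) simp
    qed
    then have hl: "holder_loc \<alpha> B1 u" unfolding holder_loc_def by blast
    have "holder_norm \<alpha> (cball 0 (1 / 2)) u \<le> ennreal 5 * (Linf_norm B1 u + ennreal ((q + 1) powr (1 / (q + 1)) * Pc))"
    proof (cases "Linf_norm B1 u = \<infinity>")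
      case True
      then show ?thesis by (simp add: ennreal_mult_top)
    next
      case False
      define m where "m = enn2real (Linf_norm B1 u)"
      have Lm: "Linf_norm B1 u = ennreal m" using False by (simp add: m_def less_top)
      have m0: "0 \<le> m" by (simp add: m_def)
      have um: "\<bar>u x\<bar> \<le> m" if "x \<in> B1" for x
        using le_Linf_norm[OF u that] m0 unfolding Lm by simp
      define P where "P = (q + 1) powr (1 / (q + 1)) * Pc"
      have "1 \<le> (q + 1) powr (1 / (q + 1))" using q by (intro ge_one_powr_ge_zero) auto
      then have P: "Pc \<le> P" using Pc0 mult_right_mono[of 1 "(q + 1) powr (1 / (q + 1))" Pc] by (simp add: P_def)
      define J where "J = m + P"
      have J0: "0 \<le> J" "m \<le> J" using m0 P Pc0 by (auto simp: J_def)
      have half: "cball 0 (1 / 2) \<subseteq> (B1 :: (real ^ 'n) set)" by auto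
      have "holder_norm \<alpha> (cball 0 (1 / 2)) u \<le> ennreal (J + 4 * J)"
      proof (rule holder_norm_le)
        show "0 \<le> J" "0 \<le> 4 * J" using J0 by auto
        show "\<bar>u x\<bar> \<le> J" if "x \<in> cball 0 (1 / 2)" for x using um[of x] half that J0 by force
        fix x z :: "real ^ 'n" assume x: "x \<in> cball 0 (1 / 2)" and z: "z \<in> cball 0 (1 / 2)" and xz: "x \<noteq> z"
        have xb: "x \<in> B1" and zb: "z \<in> B1" using x z half by auto
        have d: "\<bar>u x - u z\<bar> \<le> 2 * J" using um[OF xb] um[OF zb] J0 by linarith
        show "\<bar>u x - u z\<bar> \<le> 4 * J * norm (x - z) powr \<alpha>"
        proof (cases "J = 0")
          case True
          then show ?thesis using d by simp
        next
          case False
          then have J: "0 < J" using J0 by simp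
          define s where "s = A (1 / 4) * J"
          have A4: "2 \<le> A (1 / 4)" using A(1)[of "1 / 4"] by simp
          have s: "0 < s" "A (1 / 4) * Pc \<le> s" "2 * m \<le> s"
          proof -
            show "0 < s" using A4 J by (simp add: s_def)
            have "Pc \<le> J" using P m0 by (simp add: J_def)
            then show "A (1 / 4) * Pc \<le> s" unfolding s_def using A4 by (intro mult_left_mono) auto
            show "2 * m \<le> s" unfolding s_def using A4 J0 m0 by (intro mult_mono) auto
          qed
          have B: "ball z (1 / 4) \<subseteq> B1"
          proof
            fix y assume "y \<in> ball z (1 / 4)"
            then show "y \<in> B1" using z norm_triangle_ineq[of z "y - z"] by (simp add: dist_norm norm_minus_commute)
          qed
          have "\<bar>u x - u z\<bar> \<le> 2 * s * (norm (x - z) / (1 / 4)) powr \<alpha>0"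
            by (rule glob[OF _ s B]) (use um xb B in auto)
          also have "(norm (x - z) / (1 / 4)) powr \<alpha>0 = 4 powr \<alpha>0 * norm (x - z) powr \<alpha>0"
            by (simp add: powr_mult mult.commute)
          also have "2 * s * (4 powr \<alpha>0 * norm (x - z) powr \<alpha>0) \<le> 2 * s * (4 * norm (x - z) powr \<alpha>0)"
            using s al0 powr_mono[of \<alpha>0 1 4] by (intro mult_left_mono mult_right_mono) auto
          also have "\<dots> = (A0 * norm (x - z) powr \<alpha>0) * (2 * J)" by (simp add: s_def A0_def)
          finally have "\<bar>u x - u z\<bar> / (2 * J) \<le> A0 * norm (x - z) powr \<alpha>0"
            using J by (simp add: pos_divide_le_eq)
          moreover have "\<bar>u x - u z\<bar> / (2 * J) \<le> 1" using d J by (simp add: pos_divide_le_eq)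
          ultimately have "\<bar>u x - u z\<bar> / (2 * J) \<le> 2 * norm (x - z) powr (\<alpha>0 * t)"
            using J A0 At t xz by (intro holder_interpolate[where A = A0]) auto
          then show ?thesis using J by (simp add: pos_divide_le_eq \<alpha>_def mult_ac)
        qed
      qed
      also have "ennreal (J + 4 * J) = ennreal 5 * (Linf_norm B1 u + ennreal P)"
      proof -
        have "0 \<le> P" using P Pc0 by simp
        then have "Linf_norm B1 u + ennreal P = ennreal J" unfolding Lm J_def using m0 by simp
        moreover have "ennreal (J + 4 * J) = ennreal 5 * ennreal J"
          using J0 ennreal_mult[of 5 J] by simp
        ultimately show ?thesis by simp
      qed
      finally show ?thesis by (simp add: P_def)
    qed
    with hl show "holder_loc \<alpha> B1 u \<and> holder_norm \<alpha> (cball 0 (1 / 2)) u \<le>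
            ennreal 5 * (Linf_norm B1 u + ennreal ((q + 1) powr (1 / (q + 1)) * Pi_const p q L\<^sub>1 f a))"
      by (simp add: Pc_def)
  qed
qed

end
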